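(* Let $g$ be a metric on the pullback tangent bundle $\pi^*(TM)\to E$ and let $\nabla$ be a Finsler connection. Let $\Psi=e_a\Psi^a$, $\Psi^a:=T^a+\tfrac12 g^{ar}Dg_{rb}\wedge\omega^b$, be the canonical horizontal torsion of $(g,\nabla)$. Suppose that ($\alpha$) $\nabla$ is regular; ($\beta$) $g_{ab}\Psi^a\wedge\omega^b=0$; ($\gamma$) $y^b g_{ab}\Psi^a=0$. Then $g$ is the vertical Hessian of a Finsler Lagrangian $\mathscr{L}\colon E\to\mathbb{R}$, namely of $\mathscr{L}=\tfrac12 g_y(y,y)$ (hence $\mathscr L$ is positively homogeneous of degree two). Suppose that additionally ($\delta$) $g_{ab}\Psi^a\wedge\bar\omega^b=0$; ($\varepsilon$) $y^aDg_{ab}=0$. Then $H_{abc}=\Gamma_{abc}+\Lambda_{abc}$ where $\Lambda_{abc}=\Lambda_{bac}$ and $y^a\Lambda_{abc}=0$; $\nabla$ is strongly regular; $V_{abc}=V_{bac}$ and $y^aV_{abc}=0$; and the non-linear connection induced by $\nabla$ is the Barthel non-linear connection of $\mathscr{L}$. Moreover, all conditions ($\alpha$)-($\varepsilon$) are invariant under the replacement of $\nabla$ by any Finsler connection $\nabla'$ with connection 1-forms $\omega'^a{}_b=\omega^a{}_b+W^a{}_b$, where $W=e_a\otimes e^b\,W^a{}_b$ is a $TM\otimes_M T^*M$-valued 1-form on $E$ such that $W_{ab}=W_{ba}$ and $W_{ab}y^b=0$; so $V_{abc}$ and $\Lambda_{abc}$ are not further constrained by conditions ($\alpha$)-($\varepsilon$).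 The Finsler connections that satisfy ($\alpha$)-($\varepsilon$) for the given $g$ belong to one equivalence class $[\nabla]_g$, and this class contains the Berwald, Chern, Cartan and Hashiguchi connections of $\mathscr{L}$.
   Context: Setting. $M$ is a connected smooth $n$-dimensional manifold, $E=TM\setminus 0$ its slit tangent bundle, $\pi\colon E\to M$ the projection; all objects are smooth. A metric $g$ is a symmetric non-degenerate (of any signature) section of $\pi^*(T^*M\otimes_M T^*M)$ over $E$. A Finsler connection is a Koszul (linear) connection $\nabla$ on the vector bundle $\pi^*(TM)\to E$. It extends to pullback tensor bundles and defines the covariant exterior differential $D$ on forms on $E$ with values in pullback tensor bundles, by $D(S\otimes\beta)=\nabla S\wedge\beta+S\otimes d\beta$. Local coordinates $\{x^a\}$ on $M$ induce $\{x^a,y^a\}$ on $E$; $e_a=\partial/\partial x^a$, $e^a=dx^a$. The connection 1-forms $\omega^a{}_b$ on $E$ are defined by $\nabla e_b=\omega^a{}_b e_a$. The Liouville section is $y=y^ae_a$ (its value at $X\in E$ is $X$ itself). Set $\omega=\omega^ae_a$ with $\omega^a=\pi^*dx^a$, and $\bar\omega=Dy=\bar\omega^ae_a$, $\bar\omega^a=dy^a+\omega^a{}_by^b$. $Dg_{ab}=dg_{ab}-\omega^c{}_ag_{cb}-\omega^c{}_bg_{ac}$. The horizontal torsion is $T=D\omega$, $T^a=\omega^a{}_b\wedge\omega^b$. The first index is lowered with $g$: $H_{abc}=g_{ad}H^d{}_{bc}$, $W_{ab}=g_{ad}W^d{}_b$, etc. Regularity. $VE=\ker\pi_*$ is the vertical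 bundle. $\nabla$ is regular if for every $X\in E$ the map $V_XE\to T_{\pi(X)}M$, $Z\mapsto\nabla_Zy$, is injective (equivalently $\{\omega^a,\bar\omega^a\}$ is a basis of $T^*E$ at each point); it is strongly regular if this map is the identity under the canonical identification $V_XE\cong T_{\pi(X)}M$, $\partial/\partial y^a\leftrightarrow e_a$. For regular $\nabla$, write uniquely $\omega^a{}_b=H^a{}_{bc}\omega^c+V^a{}_{bc}\bar\omega^c$. The induced non-linear connection is the horizontal distribution $HE=\ker\nabla y$; its coefficients are $N^a_c=H^a{}_{bc}y^b$, i.e. $HE$ is spanned by $\frac{\delta}{\delta x^a}=\frac{\partial}{\partial x^a}-N^b_a\frac{\partial}{\partial y^b}$. Finsler Lagrangian. A smooth $\mathscr{L}\colon E\to\mathbb{R}$ with $\mathscr{L}(sy)=s^2\mathscr{L}(y)$ for $s>0$ and non-degenerate vertical Hessian $\partial^2\mathscr{L}/\partial y^a\partial y^b$. "$g$ is the vertical Hessian of $\mathscr{L}$" means $g_{ab}=\partial^2\mathscr{L}/\partial y^a\partial y^b$. $g_y(y,y)=g_{ab}(x,y)y^ay^b$. The spray coefficients are $2G^a=g^{ad}\big(\frac{\partial^2\mathscr{L}}{\partial x^c\partial y^d}y^c-\frac{\partial\mathscr{L}}{\partial x^d}\big)$ and the Barthel non-linear connection of $\mathscr{L}$ has coefficients $N^a_c=\partial G^a/\partial y^c$. Put $G^a{}_{bc}=\partial^2G^a/\partial y^b\partial y^c$, $C_{abc}=\frac12\partial g_{ab}/\partial y^c$, $C^a{}_{bc}=g^{ad}C_{dbc}$,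 and $\Gamma^a{}_{bc}=\tfrac12g^{an}\big[\tfrac{\delta}{\delta x^b}g_{nc}+\tfrac{\delta}{\delta x^c}g_{nb}-\tfrac{\delta}{\delta x^n}g_{bc}\big]$ with $\delta/\delta x^a$ built from the Barthel non-linear connection. The notable connections of $\mathscr{L}$ (all inducing the Barthel non-linear connection) are: Chern ($H=\Gamma$, $V=0$), Berwald ($H^a{}_{bc}=G^a{}_{bc}$, $V=0$), Cartan ($H=\Gamma$, $V^a{}_{bc}=C^a{}_{bc}$), Hashiguchi ($H^a{}_{bc}=G^a{}_{bc}$, $V^a{}_{bc}=C^a{}_{bc}$). Equivalence classes. Given $g$, two regular Finsler connections $\nabla,\nabla'$ are equivalent if $\omega'^a{}_b=\omega^a{}_b+W^a{}_b$ for some $TM\otimes_MT^*M$-valued 1-form $W=e_a\otimes e^bW^a{}_b$ on $E$ (each $W^a{}_b$ is a 1-form) with $W_{ab}=W_{ba}$ and $W_{ab}y^b=0$; the class of $\nabla$ is denoted $[\nabla]_g$. *)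

theory Defs
  imports "HOL-Analysis.Analysis"
begin

section \<open>Smooth maps, charts and tangent vectors\<close>

text \<open>Continuous differentiability of order \<open>k\<close>, and of every order, meant for open sets \<open>S\<close>.\<close>

fun cont_diff_on :: "nat \<Rightarrow> 'a::real_normed_vector set \<Rightarrow> ('a \<Rightarrow> 'b::real_normed_vector) \<Rightarrow> bool" where
  "cont_diff_on 0 S f = continuous_on S f"
| "cont_diff_on (Suc k) S f =
     ((\<forall>x\<in>S. f differentiable (at x)) \<and>
      (\<forall>v. cont_diff_on k S (\<lambda>x. frechet_derivative f (at x) v)))"

definition smooth_on :: "'a::real_normed_vector set \<Rightarrow> ('a \<Rightarrow> 'b::real_normed_vector) \<Rightarrow> bool" where
  "smooth_on S f \<longleftrightarrow> (\<forall>k. cont_diff_on k S f)"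

text \<open>A chart is a domain together with a map that is only relevant on that domain.\<close>

type_synonym ('a, 'e) chart = "'a set \<times> ('a \<Rightarrow> 'e)"

abbreviation cdom :: "('a, 'e) chart \<Rightarrow> 'a set" where "cdom \<equiv> fst"
abbreviation cmap :: "('a, 'e) chart \<Rightarrow> 'a \<Rightarrow> 'e" where "cmap \<equiv> snd"

definition cinv :: "('a, 'e) chart \<Rightarrow> 'e \<Rightarrow> 'a" where
  "cinv c = inv_into (cdom c) (cmap c)"

definition transition :: "('a, 'e) chart \<Rightarrow> ('a, 'e) chart \<Rightarrow> 'e \<Rightarrow> 'e" where
  "transition c d = cmap d \<circ> cinv c"

definition charts_at :: "('a, 'e) chart set \<Rightarrow> 'a \<Rightarrow> ('a, 'e) chart set" where
  "charts_at A p = {c \<in> A. p \<in> cdom c}"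

definition connected_smooth_manifold ::
  "('m::{t2_space, second_countable_topology}, real ^ 'n) chart set \<Rightarrow> bool" where
  "connected_smooth_manifold A \<longleftrightarrow>
     connected (UNIV :: 'm set) \<and>
     (\<Union>c\<in>A. cdom c) = UNIV \<and>
     (\<forall>c\<in>A. open (cdom c) \<and> open (cmap c ` cdom c) \<and>
        (\<exists>\<psi>. homeomorphism (cdom c) (cmap c ` cdom c) (cmap c) \<psi>)) \<and>
     (\<forall>c\<in>A. \<forall>d\<in>A. smooth_on (cmap c ` (cdom c \<inter> cdom d)) (transition c d))"

text \<open>
  A tangent vector at \<open>p\<close> is the family of its components in all charts around \<open>p\<close>, related by
  the differentials of the transition maps. It is \<open>0\<close> at all other charts, so that equality of
  functions is equality of tangent vectors. The definitions below are used for \<open>M\<close> and for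
  \<open>E\<close> with its induced atlas.
\<close>

type_synonym ('a, 'e) tvec = "('a, 'e) chart \<Rightarrow> 'e"

definition tangent_space ::
  "('a, 'e::real_normed_vector) chart set \<Rightarrow> 'a \<Rightarrow> ('a, 'e) tvec set" where
  "tangent_space A p =
     {v. (\<forall>c\<in>charts_at A p. \<forall>d\<in>charts_at A p.
            v d = frechet_derivative (transition c d) (at (cmap c p)) (v c)) \<and>
         (\<forall>c. c \<notin> charts_at A p \<longrightarrow> v c = 0)}"

definition tlin :: "real \<Rightarrow> ('i \<Rightarrow> 'e::real_vector) \<Rightarrow> real \<Rightarrow> ('i \<Rightarrow> 'e) \<Rightarrow> ('i \<Rightarrow> 'e)" where
  "tlin r u s v = (\<lambda>i. r *\<^sub>R u i + s *\<^sub>R v i)"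

definition linear_form_on :: "('i \<Rightarrow> 'e::real_vector) set \<Rightarrow> (('i \<Rightarrow> 'e) \<Rightarrow> real) \<Rightarrow> bool" where
  "linear_form_on V f \<longleftrightarrow>
     (\<forall>u\<in>V. \<forall>v\<in>V. \<forall>r s. f (tlin r u s v) = r * f u + s * f v)"

definition linear_map_on ::
  "('i \<Rightarrow> 'e::real_vector) set \<Rightarrow> ('j \<Rightarrow> 'f::real_vector) set
     \<Rightarrow> (('i \<Rightarrow> 'e) \<Rightarrow> ('j \<Rightarrow> 'f)) \<Rightarrow> bool" where
  "linear_map_on V U f \<longleftrightarrow>
     (\<forall>u\<in>V. f u \<in> U) \<and>
     (\<forall>u\<in>V. \<forall>v\<in>V. \<forall>r s. f (tlin r u s v) = tlin r (f u) s (f v))"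

definition smooth_near ::
  "('a, 'e::real_normed_vector) chart set \<Rightarrow> ('a \<Rightarrow> 'b::real_normed_vector) \<Rightarrow> 'a \<Rightarrow> bool" where
  "smooth_near A f p \<longleftrightarrow>
     (\<forall>c\<in>charts_at A p. \<exists>S. open S \<and> cmap c p \<in> S \<and> S \<subseteq> cmap c ` cdom c \<and>
        smooth_on S (f \<circ> cinv c))"

definition dir_deriv ::
  "('a, 'e::real_normed_vector) chart \<Rightarrow> ('a \<Rightarrow> 'b::real_normed_vector) \<Rightarrow> 'a
     \<Rightarrow> ('a, 'e) tvec \<Rightarrow> 'b" where
  "dir_deriv c f p v = frechet_derivative (f \<circ> cinv c) (at (cmap c p)) (v c)"


section \<open>The slit tangent bundle \<open>E\<close>\<close>

text \<open>
  A point \<open>X\<close> of \<open>E\<close> is a pair of a base point \<open>fst X\<close> and a nonzero tangent vector \<open>snd X\<close>.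
\<close>

type_synonym ('m, 'n) tpoint = "'m \<times> ('m, real ^ 'n) tvec"
type_synonym ('m, 'n) etvec = "(('m, 'n) tpoint, (real ^ 'n) \<times> (real ^ 'n)) tvec"

definition slit :: "('m, real ^ 'n) chart set \<Rightarrow> ('m, 'n) tpoint set" where
  "slit A = {X. snd X \<in> tangent_space A (fst X) \<and> snd X \<noteq> (\<lambda>_. 0)}"

text \<open>The coordinates \<open>(x, y)\<close> on \<open>E\<close> induced by a chart \<open>x\<close> of \<open>M\<close>.\<close>

definition lift_chart ::
  "('m, real ^ 'n) chart set \<Rightarrow> ('m, real ^ 'n) chart
     \<Rightarrow> (('m, 'n) tpoint, (real ^ 'n) \<times> (real ^ 'n)) chart" where
  "lift_chart A c = ({X \<in> slit A. fst X \<in> cdom c}, \<lambda>X. (cmap c (fst X), snd X c))"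

definition slit_atlas ::
  "('m, real ^ 'n) chart set \<Rightarrow> (('m, 'n) tpoint, (real ^ 'n) \<times> (real ^ 'n)) chart set" where
  "slit_atlas A = lift_chart A ` A"

abbreviation TE ::
  "('m, real ^ 'n) chart set \<Rightarrow> ('m, 'n) tpoint \<Rightarrow> ('m, 'n) etvec set" where
  "TE A X \<equiv> tangent_space (slit_atlas A) X"

text \<open>The fibre at \<open>X\<close> of the pullback bundle.\<close>

abbreviation fibre ::
  "('m, real ^ 'n) chart set \<Rightarrow> ('m, 'n) tpoint \<Rightarrow> ('m, real ^ 'n) tvec set" where
  "fibre A X \<equiv> tangent_space A (fst X)"

text \<open>The coordinate frame \<open>e\<^sub>a\<close>, extended by zero outside the chart.\<close>

definition frame ::
  "('m, real ^ 'n) chart set \<Rightarrow> ('m, real ^ 'n) chart \<Rightarrow> 'n \<Rightarrow> ('m, 'n) tpoint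
     \<Rightarrow> ('m, real ^ 'n) tvec" where
  "frame A c a X = (\<lambda>d. if c \<in> charts_at A (fst X) \<and> d \<in> charts_at A (fst X)
     then frechet_derivative (transition c d) (at (cmap c (fst X))) (axis a 1) else 0)"

definition ycoord :: "('m, real ^ 'n) chart \<Rightarrow> 'n \<Rightarrow> ('m, 'n) tpoint \<Rightarrow> real" where
  "ycoord c a X = snd X c $ a"

text \<open>The 1-forms \<open>\<omega>\<^sup>a = \<pi>\<^sup>*dx\<^sup>a\<close> and \<open>dy\<^sup>a\<close> on \<open>E\<close>.\<close>

definition dx_form ::
  "('m, real ^ 'n) chart set \<Rightarrow> ('m, real ^ 'n) chart \<Rightarrow> 'n \<Rightarrow> ('m, 'n) etvec \<Rightarrow> real" where
  "dx_form A c a Z = fst (Z (lift_chart A c)) $ a"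

definition dy_form ::
  "('m, real ^ 'n) chart set \<Rightarrow> ('m, real ^ 'n) chart \<Rightarrow> 'n \<Rightarrow> ('m, 'n) etvec \<Rightarrow> real" where
  "dy_form A c a Z = snd (Z (lift_chart A c)) $ a"

definition vertical ::
  "('m, real ^ 'n) chart set \<Rightarrow> ('m, 'n) tpoint \<Rightarrow> ('m, 'n) etvec set" where
  "vertical A X = {Z \<in> TE A X. \<forall>c\<in>charts_at A (fst X). \<forall>a. dx_form A c a Z = 0}"

text \<open>The partial derivatives \<open>\<partial>/\<partial>x\<^sup>a\<close> and \<open>\<partial>/\<partial>y\<^sup>a\<close> of functions on \<open>E\<close>.\<close>

definition dx ::
  "('m, real ^ 'n) chart set \<Rightarrow> ('m, real ^ 'n) chart \<Rightarrow> 'n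
     \<Rightarrow> (('m, 'n) tpoint \<Rightarrow> real) \<Rightarrow> ('m, 'n) tpoint \<Rightarrow> real" where
  "dx A c a f X = frechet_derivative (f \<circ> cinv (lift_chart A c))
     (at (cmap (lift_chart A c) X)) (axis a 1, 0)"

definition dy ::
  "('m, real ^ 'n) chart set \<Rightarrow> ('m, real ^ 'n) chart \<Rightarrow> 'n
     \<Rightarrow> (('m, 'n) tpoint \<Rightarrow> real) \<Rightarrow> ('m, 'n) tpoint \<Rightarrow> real" where
  "dy A c a f X = frechet_derivative (f \<circ> cinv (lift_chart A c))
     (at (cmap (lift_chart A c) X)) (0, axis a 1)"

definition wedge11 :: "('z \<Rightarrow> real) \<Rightarrow> ('z \<Rightarrow> real) \<Rightarrow> 'z \<Rightarrow> 'z \<Rightarrow> real" where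
  "wedge11 \<alpha> \<beta> Z\<^sub>1 Z\<^sub>2 = \<alpha> Z\<^sub>1 * \<beta> Z\<^sub>2 - \<alpha> Z\<^sub>2 * \<beta> Z\<^sub>1"

definition wedge21 ::
  "('z \<Rightarrow> 'z \<Rightarrow> real) \<Rightarrow> ('z \<Rightarrow> real) \<Rightarrow> 'z \<Rightarrow> 'z \<Rightarrow> 'z \<Rightarrow> real" where
  "wedge21 \<alpha> \<beta> Z\<^sub>1 Z\<^sub>2 Z\<^sub>3 =
     \<alpha> Z\<^sub>1 Z\<^sub>2 * \<beta> Z\<^sub>3 + \<alpha> Z\<^sub>2 Z\<^sub>3 * \<beta> Z\<^sub>1 + \<alpha> Z\<^sub>3 Z\<^sub>1 * \<beta> Z\<^sub>2"


section \<open>Sections, metrics and tensors on the pullback bundle\<close>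

text \<open>
  Sections and vector fields are total on \<open>E\<close> but smooth only near a given point, so that they
  represent germs (extend a local section by zero).
\<close>

type_synonym ('m, 'n) psection = "('m, 'n) tpoint \<Rightarrow> ('m, real ^ 'n) tvec"

definition smooth_section_near ::
  "('m, real ^ 'n) chart set \<Rightarrow> ('m, 'n) psection \<Rightarrow> ('m, 'n) tpoint \<Rightarrow> bool" where
  "smooth_section_near A s X \<longleftrightarrow>
     (\<forall>Y\<in>slit A. s Y \<in> fibre A Y) \<and>
     (\<forall>c\<in>charts_at A (fst X). smooth_near (slit_atlas A) (\<lambda>Y. s Y c) X)"

definition smooth_field_near ::
  "('m, real ^ 'n) chart set \<Rightarrow> (('m, 'n) tpoint \<Rightarrow> ('m, 'n) etvec) \<Rightarrow> ('m, 'n) tpoint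
     \<Rightarrow> bool" where
  "smooth_field_near A Z X \<longleftrightarrow>
     (\<forall>Y\<in>slit A. Z Y \<in> TE A Y) \<and>
     (\<forall>C\<in>charts_at (slit_atlas A) X. smooth_near (slit_atlas A) (\<lambda>Y. Z Y C) X)"

type_synonym ('m, 'n) cotensor2 =
  "('m, 'n) tpoint \<Rightarrow> ('m, real ^ 'n) tvec \<Rightarrow> ('m, real ^ 'n) tvec \<Rightarrow> real"

definition gcomp ::
  "('m, real ^ 'n) chart set \<Rightarrow> ('m, 'n) cotensor2 \<Rightarrow> ('m, real ^ 'n) chart \<Rightarrow> 'n \<Rightarrow> 'n
     \<Rightarrow> ('m, 'n) tpoint \<Rightarrow> real" where
  "gcomp A g c a b X = g X (frame A c a X) (frame A c b X)"

definition ginv ::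
  "('m, real ^ 'n) chart set \<Rightarrow> ('m, 'n) cotensor2 \<Rightarrow> ('m, real ^ 'n) chart \<Rightarrow> 'n \<Rightarrow> 'n
     \<Rightarrow> ('m, 'n) tpoint \<Rightarrow> real" where
  "ginv A g c a b X = matrix_inv (\<chi> i j. gcomp A g c i j X) $ a $ b"

definition pullback_metric ::
  "('m, real ^ 'n) chart set \<Rightarrow> ('m, 'n) cotensor2 \<Rightarrow> bool" where
  "pullback_metric A g \<longleftrightarrow> (\<forall>X\<in>slit A.
     (\<forall>u\<in>fibre A X. linear_form_on (fibre A X) (g X u)) \<and>
     (\<forall>u\<in>fibre A X. \<forall>v\<in>fibre A X. g X u v = g X v u) \<and>
     (\<forall>u\<in>fibre A X. (\<forall>v\<in>fibre A X. g X u v = 0) \<longrightarrow> u = (\<lambda>_. 0)) \<and>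
     (\<forall>c\<in>charts_at A (fst X). \<forall>a b. smooth_near (slit_atlas A) (gcomp A g c a b) X))"

type_synonym ('m, 'n) cotensor3 =
  "('m, 'n) tpoint \<Rightarrow> ('m, real ^ 'n) tvec \<Rightarrow> ('m, real ^ 'n) tvec \<Rightarrow> ('m, real ^ 'n) tvec \<Rightarrow> real"

definition tcomp ::
  "('m, real ^ 'n) chart set \<Rightarrow> ('m, 'n) cotensor3 \<Rightarrow> ('m, real ^ 'n) chart
     \<Rightarrow> 'n \<Rightarrow> 'n \<Rightarrow> 'n \<Rightarrow> ('m, 'n) tpoint \<Rightarrow> real" where
  "tcomp A K c a b d X = K X (frame A c a X) (frame A c b X) (frame A c d X)"

definition pullback_tensor3 ::
  "('m, real ^ 'n) chart set \<Rightarrow> ('m, 'n) cotensor3 \<Rightarrow> bool" where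
  "pullback_tensor3 A K \<longleftrightarrow> (\<forall>X\<in>slit A.
     (\<forall>u\<in>fibre A X. \<forall>v\<in>fibre A X.
        linear_form_on (fibre A X) (\<lambda>w. K X u v w) \<and>
        linear_form_on (fibre A X) (\<lambda>w. K X u w v) \<and>
        linear_form_on (fibre A X) (\<lambda>w. K X w u v)) \<and>
     (\<forall>c\<in>charts_at A (fst X). \<forall>a b d.
        smooth_near (slit_atlas A) (tcomp A K c a b d) X))"

text \<open>The algebraic conditions \<open>K\<^sub>a\<^sub>b\<^sub>c = K\<^sub>b\<^sub>a\<^sub>c\<close> and \<open>y\<^sup>a K\<^sub>a\<^sub>b\<^sub>c = 0\<close> on components.\<close>

definition sym_transverse ::
  "('m, real ^ 'n) chart set
     \<Rightarrow> (('m, real ^ 'n) chart \<Rightarrow> 'n \<Rightarrow> 'n \<Rightarrow> 'n \<Rightarrow> ('m, 'n) tpoint \<Rightarrow> real) \<Rightarrow> bool" where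
  "sym_transverse A K \<longleftrightarrow> (\<forall>X\<in>slit A. \<forall>c\<in>charts_at A (fst X). \<forall>b d.
     (\<forall>a. K c a b d X = K c b a d X) \<and>
     (\<Sum>a\<in>UNIV. ycoord c a X * K c a b d X) = 0)"


section \<open>Finsler connections\<close>

text \<open>
  A Koszul connection on the pullback bundle, as an operator on germs of sections:
  \<open>nab s X Z\<close> is \<open>\<nabla>\<^sub>Z s\<close> for \<open>Z\<close> tangent to \<open>E\<close> at \<open>X\<close> and \<open>s\<close> smooth near \<open>X\<close>; it is unconstrained
  for other arguments. That it depends only on the germ of \<open>s\<close> at \<open>X\<close> follows from the Leibniz rule:
  if \<open>s\<close> vanishes near \<open>X\<close>, then \<open>s = f s\<close> for the function \<open>f\<close> which is \<open>0\<close> near \<open>X\<close> and \<open>1\<close> elsewhere.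
\<close>

type_synonym ('m, 'n) connection =
  "('m, 'n) psection \<Rightarrow> ('m, 'n) tpoint \<Rightarrow> ('m, 'n) etvec \<Rightarrow> ('m, real ^ 'n) tvec"

definition finsler_connection ::
  "('m, real ^ 'n) chart set \<Rightarrow> ('m, 'n) connection \<Rightarrow> bool" where
  "finsler_connection A nab \<longleftrightarrow> (\<forall>X\<in>slit A.
     (\<forall>s. smooth_section_near A s X \<longrightarrow> linear_map_on (TE A X) (fibre A X) (nab s X)) \<and>
     (\<forall>s t. smooth_section_near A s X \<longrightarrow> smooth_section_near A t X \<longrightarrow>
        (\<forall>Z\<in>TE A X. nab (\<lambda>Y. tlin 1 (s Y) 1 (t Y)) X Z = tlin 1 (nab s X Z) 1 (nab t X Z))) \<and>
     (\<forall>f s. smooth_near (slit_atlas A) f X \<longrightarrow> smooth_section_near A s X \<longrightarrow>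
        (\<forall>Z\<in>TE A X. \<forall>C\<in>charts_at (slit_atlas A) X.
           nab (\<lambda>Y c. f Y *\<^sub>R s Y c) X Z = tlin (dir_deriv C f X Z) (s X) (f X) (nab s X Z))) \<and>
     (\<forall>s Z. smooth_section_near A s X \<longrightarrow> smooth_field_near A Z X \<longrightarrow>
        (\<forall>c\<in>charts_at A (fst X). smooth_near (slit_atlas A) (\<lambda>Y. nab s Y (Z Y) c) X)))"

text \<open>The connection forms \<open>\<omega>\<^sup>a\<^sub>b\<close>; the Liouville section \<open>y\<close> is \<open>snd\<close>.\<close>

definition conn_form ::
  "('m, real ^ 'n) chart set \<Rightarrow> ('m, 'n) connection \<Rightarrow> ('m, real ^ 'n) chart \<Rightarrow> 'n \<Rightarrow> 'n
     \<Rightarrow> ('m, 'n) tpoint \<Rightarrow> ('m, 'n) etvec \<Rightarrow> real" where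
  "conn_form A nab c a b X Z = nab (frame A c b) X Z c $ a"

definition omega_bar ::
  "('m, 'n) connection \<Rightarrow> ('m, real ^ 'n) chart \<Rightarrow> 'n
     \<Rightarrow> ('m, 'n) tpoint \<Rightarrow> ('m, 'n) etvec \<Rightarrow> real" where
  "omega_bar nab c a X Z = nab snd X Z c $ a"

definition regular :: "('m, real ^ 'n) chart set \<Rightarrow> ('m, 'n) connection \<Rightarrow> bool" where
  "regular A nab \<longleftrightarrow> (\<forall>X\<in>slit A. inj_on (nab snd X) (vertical A X))"

definition strongly_regular :: "('m, real ^ 'n) chart set \<Rightarrow> ('m, 'n) connection \<Rightarrow> bool" where
  "strongly_regular A nab \<longleftrightarrow> (\<forall>X\<in>slit A. \<forall>Z\<in>vertical A X.
     \<forall>c\<in>charts_at A (fst X). \<forall>a. nab snd X Z c $ a = dy_form A c a Z)"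

text \<open>
  The coefficients \<open>(H, V)\<close> in \<open>\<omega>\<^sup>a\<^sub>b = H\<^sup>a\<^sub>b\<^sub>c \<omega>\<^sup>c + V\<^sup>a\<^sub>b\<^sub>c (\<nabla>y)\<^sup>c\<close>, which are unique for a regular
  connection.
\<close>

definition conn_coeffs ::
  "('m, real ^ 'n) chart set \<Rightarrow> ('m, 'n) connection \<Rightarrow> ('m, real ^ 'n) chart
     \<Rightarrow> ('m, 'n) tpoint \<Rightarrow> ('n \<Rightarrow> 'n \<Rightarrow> 'n \<Rightarrow> real) \<times> ('n \<Rightarrow> 'n \<Rightarrow> 'n \<Rightarrow> real)" where
  "conn_coeffs A nab c X = (THE HV. \<forall>a b. \<forall>Z\<in>TE A X.
     conn_form A nab c a b X Z =
       (\<Sum>d\<in>UNIV. fst HV a b d * dx_form A c d Z + snd HV a b d * omega_bar nab c d X Z))"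

definition Hcoeff ::
  "('m, real ^ 'n) chart set \<Rightarrow> ('m, 'n) connection \<Rightarrow> ('m, real ^ 'n) chart
     \<Rightarrow> 'n \<Rightarrow> 'n \<Rightarrow> 'n \<Rightarrow> ('m, 'n) tpoint \<Rightarrow> real" where
  "Hcoeff A nab c a b d X = fst (conn_coeffs A nab c X) a b d"

definition Vcoeff ::
  "('m, real ^ 'n) chart set \<Rightarrow> ('m, 'n) connection \<Rightarrow> ('m, real ^ 'n) chart
     \<Rightarrow> 'n \<Rightarrow> 'n \<Rightarrow> 'n \<Rightarrow> ('m, 'n) tpoint \<Rightarrow> real" where
  "Vcoeff A nab c a b d X = snd (conn_coeffs A nab c X) a b d"

text \<open>Lowering the first of three indices with \<open>g\<close>.\<close>

definition lower3 ::
  "('m, real ^ 'n) chart set \<Rightarrow> ('m, 'n) cotensor2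
     \<Rightarrow> (('m, real ^ 'n) chart \<Rightarrow> 'n \<Rightarrow> 'n \<Rightarrow> 'n \<Rightarrow> ('m, 'n) tpoint \<Rightarrow> real)
     \<Rightarrow> ('m, real ^ 'n) chart \<Rightarrow> 'n \<Rightarrow> 'n \<Rightarrow> 'n \<Rightarrow> ('m, 'n) tpoint \<Rightarrow> real" where
  "lower3 A g K c a b d X = (\<Sum>e\<in>UNIV. gcomp A g c a e X * K c e b d X)"

definition horizontal ::
  "('m, real ^ 'n) chart set \<Rightarrow> ('m, 'n) connection \<Rightarrow> ('m, 'n) tpoint
     \<Rightarrow> ('m, 'n) etvec set" where
  "horizontal A nab X = {Z \<in> TE A X. nab snd X Z = (\<lambda>_. 0)}"

text \<open>\<open>Dg\<^sub>a\<^sub>b = dg\<^sub>a\<^sub>b - \<omega>\<^sup>e\<^sub>a g\<^sub>e\<^sub>b - \<omega>\<^sup>e\<^sub>b g\<^sub>a\<^sub>e\<close>\<close>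

definition Dg ::
  "('m, real ^ 'n) chart set \<Rightarrow> ('m, 'n) cotensor2 \<Rightarrow> ('m, 'n) connection
     \<Rightarrow> ('m, real ^ 'n) chart \<Rightarrow> 'n \<Rightarrow> 'n \<Rightarrow> ('m, 'n) tpoint \<Rightarrow> ('m, 'n) etvec \<Rightarrow> real" where
  "Dg A g nab c a b X Z =
     dir_deriv (lift_chart A c) (gcomp A g c a b) X Z
     - (\<Sum>e\<in>UNIV. conn_form A nab c e a X Z * gcomp A g c e b X)
     - (\<Sum>e\<in>UNIV. conn_form A nab c e b X Z * gcomp A g c a e X)"

text \<open>\<open>T = D(e\<^sub>a \<omega>\<^sup>a)\<close> has components \<open>T\<^sup>a = \<omega>\<^sup>a\<^sub>b \<and> \<omega>\<^sup>b\<close> because \<open>\<omega>\<^sup>a = \<pi>\<^sup>*dx\<^sup>a\<close> is closed.\<close>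

definition torsion ::
  "('m, real ^ 'n) chart set \<Rightarrow> ('m, 'n) connection
     \<Rightarrow> ('m, real ^ 'n) chart \<Rightarrow> 'n \<Rightarrow> ('m, 'n) tpoint
     \<Rightarrow> ('m, 'n) etvec \<Rightarrow> ('m, 'n) etvec \<Rightarrow> real" where
  "torsion A nab c a X Z\<^sub>1 Z\<^sub>2 =
     (\<Sum>b\<in>UNIV. wedge11 (conn_form A nab c a b X) (dx_form A c b) Z\<^sub>1 Z\<^sub>2)"

definition Psi ::
  "('m, real ^ 'n) chart set \<Rightarrow> ('m, 'n) cotensor2 \<Rightarrow> ('m, 'n) connection
     \<Rightarrow> ('m, real ^ 'n) chart \<Rightarrow> 'n \<Rightarrow> ('m, 'n) tpoint
     \<Rightarrow> ('m, 'n) etvec \<Rightarrow> ('m, 'n) etvec \<Rightarrow> real" where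
  "Psi A g nab c a X Z\<^sub>1 Z\<^sub>2 = torsion A nab c a X Z\<^sub>1 Z\<^sub>2
     + 1/2 * (\<Sum>r\<in>UNIV. \<Sum>b\<in>UNIV.
         ginv A g c a r X * wedge11 (Dg A g nab c r b X) (dx_form A c b) Z\<^sub>1 Z\<^sub>2)"

definition cond_beta ::
  "('m, real ^ 'n) chart set \<Rightarrow> ('m, 'n) cotensor2 \<Rightarrow> ('m, 'n) connection \<Rightarrow> bool" where
  "cond_beta A g nab \<longleftrightarrow> (\<forall>X\<in>slit A. \<forall>c\<in>charts_at A (fst X).
     \<forall>Z\<^sub>1\<in>TE A X. \<forall>Z\<^sub>2\<in>TE A X. \<forall>Z\<^sub>3\<in>TE A X.
       (\<Sum>a\<in>UNIV. \<Sum>b\<in>UNIV. gcomp A g c a b X *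
          wedge21 (Psi A g nab c a X) (dx_form A c b) Z\<^sub>1 Z\<^sub>2 Z\<^sub>3) = 0)"

definition cond_gamma ::
  "('m, real ^ 'n) chart set \<Rightarrow> ('m, 'n) cotensor2 \<Rightarrow> ('m, 'n) connection \<Rightarrow> bool" where
  "cond_gamma A g nab \<longleftrightarrow> (\<forall>X\<in>slit A. \<forall>c\<in>charts_at A (fst X).
     \<forall>Z\<^sub>1\<in>TE A X. \<forall>Z\<^sub>2\<in>TE A X.
       (\<Sum>a\<in>UNIV. \<Sum>b\<in>UNIV. ycoord c b X * gcomp A g c a b X * Psi A g nab c a X Z\<^sub>1 Z\<^sub>2) = 0)"

definition cond_delta ::
  "('m, real ^ 'n) chart set \<Rightarrow> ('m, 'n) cotensor2 \<Rightarrow> ('m, 'n) connection \<Rightarrow> bool" where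
  "cond_delta A g nab \<longleftrightarrow> (\<forall>X\<in>slit A. \<forall>c\<in>charts_at A (fst X).
     \<forall>Z\<^sub>1\<in>TE A X. \<forall>Z\<^sub>2\<in>TE A X. \<forall>Z\<^sub>3\<in>TE A X.
       (\<Sum>a\<in>UNIV. \<Sum>b\<in>UNIV. gcomp A g c a b X *
          wedge21 (Psi A g nab c a X) (omega_bar nab c b X) Z\<^sub>1 Z\<^sub>2 Z\<^sub>3) = 0)"

definition cond_epsilon ::
  "('m, real ^ 'n) chart set \<Rightarrow> ('m, 'n) cotensor2 \<Rightarrow> ('m, 'n) connection \<Rightarrow> bool" where
  "cond_epsilon A g nab \<longleftrightarrow> (\<forall>X\<in>slit A. \<forall>c\<in>charts_at A (fst X). \<forall>Z\<in>TE A X.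
     \<forall>b. (\<Sum>a\<in>UNIV. ycoord c a X * Dg A g nab c a b X Z) = 0)"

definition conds_alpha_epsilon ::
  "('m, real ^ 'n) chart set \<Rightarrow> ('m, 'n) cotensor2 \<Rightarrow> ('m, 'n) connection \<Rightarrow> bool" where
  "conds_alpha_epsilon A g nab \<longleftrightarrow> regular A nab \<and> cond_beta A g nab \<and> cond_gamma A g nab \<and>
     cond_delta A g nab \<and> cond_epsilon A g nab"


section \<open>Finsler Lagrangians and their notable connections\<close>

definition vertical_hessian ::
  "('m, real ^ 'n) chart set \<Rightarrow> (('m, 'n) tpoint \<Rightarrow> real) \<Rightarrow> ('m, real ^ 'n) chart
     \<Rightarrow> 'n \<Rightarrow> 'n \<Rightarrow> ('m, 'n) tpoint \<Rightarrow> real" where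
  "vertical_hessian A L c a b = dy A c a (dy A c b L)"

definition hessian_inv ::
  "('m, real ^ 'n) chart set \<Rightarrow> (('m, 'n) tpoint \<Rightarrow> real) \<Rightarrow> ('m, real ^ 'n) chart
     \<Rightarrow> 'n \<Rightarrow> 'n \<Rightarrow> ('m, 'n) tpoint \<Rightarrow> real" where
  "hessian_inv A L c a b X = matrix_inv (\<chi> i j. vertical_hessian A L c i j X) $ a $ b"

definition finsler_lagrangian ::
  "('m, real ^ 'n) chart set \<Rightarrow> (('m, 'n) tpoint \<Rightarrow> real) \<Rightarrow> bool" where
  "finsler_lagrangian A L \<longleftrightarrow> (\<forall>X\<in>slit A.
     smooth_near (slit_atlas A) L X \<and>
     (\<forall>s>0. L (fst X, \<lambda>c. s *\<^sub>R snd X c) = s\<^sup>2 * L X) \<and>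
     (\<forall>c\<in>charts_at A (fst X). invertible (\<chi> a b. vertical_hessian A L c a b X)))"

definition is_vertical_hessian_of ::
  "('m, real ^ 'n) chart set \<Rightarrow> ('m, 'n) cotensor2 \<Rightarrow> (('m, 'n) tpoint \<Rightarrow> real) \<Rightarrow> bool" where
  "is_vertical_hessian_of A g L \<longleftrightarrow> (\<forall>X\<in>slit A. \<forall>c\<in>charts_at A (fst X). \<forall>a b.
     gcomp A g c a b X = vertical_hessian A L c a b X)"

definition half_energy :: "('m, 'n) cotensor2 \<Rightarrow> ('m, 'n) tpoint \<Rightarrow> real" where
  "half_energy g X = 1/2 * g X (snd X) (snd X)"

definition spray ::
  "('m, real ^ 'n) chart set \<Rightarrow> (('m, 'n) tpoint \<Rightarrow> real) \<Rightarrow> ('m, real ^ 'n) chart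
     \<Rightarrow> 'n \<Rightarrow> ('m, 'n) tpoint \<Rightarrow> real" where
  "spray A L c a X = 1/2 * (\<Sum>d\<in>UNIV. hessian_inv A L c a d X *
     ((\<Sum>e\<in>UNIV. dx A c e (dy A c d L) X * ycoord c e X) - dx A c d L X))"

definition barthel ::
  "('m, real ^ 'n) chart set \<Rightarrow> (('m, 'n) tpoint \<Rightarrow> real) \<Rightarrow> ('m, real ^ 'n) chart
     \<Rightarrow> 'n \<Rightarrow> 'n \<Rightarrow> ('m, 'n) tpoint \<Rightarrow> real" where
  "barthel A L c a b = dy A c b (spray A L c a)"

text \<open>The span of the \<open>\<delta>/\<delta>x\<^sup>b = \<partial>/\<partial>x\<^sup>b - N\<^sup>a\<^sub>b \<partial>/\<partial>y\<^sup>a\<close>, described in every chart at once.\<close>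

definition barthel_horizontal ::
  "('m, real ^ 'n) chart set \<Rightarrow> (('m, 'n) tpoint \<Rightarrow> real) \<Rightarrow> ('m, 'n) tpoint
     \<Rightarrow> ('m, 'n) etvec set" where
  "barthel_horizontal A L X = {Z \<in> TE A X. \<forall>c\<in>charts_at A (fst X). \<forall>a.
     dy_form A c a Z = - (\<Sum>b\<in>UNIV. barthel A L c a b X * dx_form A c b Z)}"

definition delta ::
  "('m, real ^ 'n) chart set \<Rightarrow> (('m, 'n) tpoint \<Rightarrow> real) \<Rightarrow> ('m, real ^ 'n) chart
     \<Rightarrow> 'n \<Rightarrow> (('m, 'n) tpoint \<Rightarrow> real) \<Rightarrow> ('m, 'n) tpoint \<Rightarrow> real" where
  "delta A L c b f X = dx A c b f X - (\<Sum>a\<in>UNIV. barthel A L c a b X * dy A c a f X)"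

definition Gamma_coeff ::
  "('m, real ^ 'n) chart set \<Rightarrow> (('m, 'n) tpoint \<Rightarrow> real) \<Rightarrow> ('m, real ^ 'n) chart
     \<Rightarrow> 'n \<Rightarrow> 'n \<Rightarrow> 'n \<Rightarrow> ('m, 'n) tpoint \<Rightarrow> real" where
  "Gamma_coeff A L c a b d X = 1/2 * (\<Sum>k\<in>UNIV. hessian_inv A L c a k X *
     (delta A L c b (vertical_hessian A L c k d) X
      + delta A L c d (vertical_hessian A L c k b) X
      - delta A L c k (vertical_hessian A L c b d) X))"

definition Berwald_coeff ::
  "('m, real ^ 'n) chart set \<Rightarrow> (('m, 'n) tpoint \<Rightarrow> real) \<Rightarrow> ('m, real ^ 'n) chart
     \<Rightarrow> 'n \<Rightarrow> 'n \<Rightarrow> 'n \<Rightarrow> ('m, 'n) tpoint \<Rightarrow> real" where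
  "Berwald_coeff A L c a b d = dy A c b (dy A c d (spray A L c a))"

definition Cartan_coeff ::
  "('m, real ^ 'n) chart set \<Rightarrow> (('m, 'n) tpoint \<Rightarrow> real) \<Rightarrow> ('m, real ^ 'n) chart
     \<Rightarrow> 'n \<Rightarrow> 'n \<Rightarrow> 'n \<Rightarrow> ('m, 'n) tpoint \<Rightarrow> real" where
  "Cartan_coeff A L c a b d X = (\<Sum>k\<in>UNIV. hessian_inv A L c a k X *
     (1/2 * dy A c d (vertical_hessian A L c k b) X))"

text \<open>
  \<open>nab\<close> is a regular Finsler connection inducing the Barthel non-linear connection of \<open>L\<close> and having
  the coefficients \<open>H\<close> and \<open>V\<close>.
\<close>

definition notable_connection ::
  "('m, real ^ 'n) chart set \<Rightarrow> (('m, 'n) tpoint \<Rightarrow> real)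
     \<Rightarrow> (('m, real ^ 'n) chart \<Rightarrow> 'n \<Rightarrow> 'n \<Rightarrow> 'n \<Rightarrow> ('m, 'n) tpoint \<Rightarrow> real)
     \<Rightarrow> (('m, real ^ 'n) chart \<Rightarrow> 'n \<Rightarrow> 'n \<Rightarrow> 'n \<Rightarrow> ('m, 'n) tpoint \<Rightarrow> real)
     \<Rightarrow> ('m, 'n) connection \<Rightarrow> bool" where
  "notable_connection A L H V nab \<longleftrightarrow> finsler_connection A nab \<and> regular A nab \<and>
     (\<forall>X\<in>slit A. horizontal A nab X = barthel_horizontal A L X) \<and>
     (\<forall>X\<in>slit A. \<forall>c\<in>charts_at A (fst X). \<forall>a b d.
        Hcoeff A nab c a b d X = H c a b d X \<and> Vcoeff A nab c a b d X = V c a b d X)"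

definition Chern_connection ::
  "('m, real ^ 'n) chart set \<Rightarrow> (('m, 'n) tpoint \<Rightarrow> real) \<Rightarrow> ('m, 'n) connection \<Rightarrow> bool" where
  "Chern_connection A L = notable_connection A L (Gamma_coeff A L) (\<lambda>c a b d X. 0)"

definition Berwald_connection ::
  "('m, real ^ 'n) chart set \<Rightarrow> (('m, 'n) tpoint \<Rightarrow> real) \<Rightarrow> ('m, 'n) connection \<Rightarrow> bool" where
  "Berwald_connection A L = notable_connection A L (Berwald_coeff A L) (\<lambda>c a b d X. 0)"

definition Cartan_connection ::
  "('m, real ^ 'n) chart set \<Rightarrow> (('m, 'n) tpoint \<Rightarrow> real) \<Rightarrow> ('m, 'n) connection \<Rightarrow> bool" where
  "Cartan_connection A L = notable_connection A L (Gamma_coeff A L) (Cartan_coeff A L)"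

definition Hashiguchi_connection ::
  "('m, real ^ 'n) chart set \<Rightarrow> (('m, 'n) tpoint \<Rightarrow> real) \<Rightarrow> ('m, 'n) connection \<Rightarrow> bool" where
  "Hashiguchi_connection A L = notable_connection A L (Berwald_coeff A L) (Cartan_coeff A L)"


section \<open>Equivalence of Finsler connections\<close>

text \<open>Endomorphism-valued 1-forms on \<open>E\<close>.\<close>

type_synonym ('m, 'n) endo_form =
  "('m, 'n) tpoint \<Rightarrow> ('m, 'n) etvec \<Rightarrow> ('m, real ^ 'n) tvec \<Rightarrow> ('m, real ^ 'n) tvec"

definition wcomp ::
  "('m, real ^ 'n) chart set \<Rightarrow> ('m, 'n) endo_form \<Rightarrow> ('m, real ^ 'n) chart \<Rightarrow> 'n \<Rightarrow> 'n
     \<Rightarrow> ('m, 'n) tpoint \<Rightarrow> ('m, 'n) etvec \<Rightarrow> real" where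
  "wcomp A W c a b X Z = W X Z (frame A c b X) c $ a"

definition pullback_endo_form ::
  "('m, real ^ 'n) chart set \<Rightarrow> ('m, 'n) endo_form \<Rightarrow> bool" where
  "pullback_endo_form A W \<longleftrightarrow> (\<forall>X\<in>slit A.
     (\<forall>Z\<in>TE A X. linear_map_on (fibre A X) (fibre A X) (W X Z)) \<and>
     (\<forall>u\<in>fibre A X. linear_map_on (TE A X) (fibre A X) (\<lambda>Z. W X Z u)) \<and>
     (\<forall>Z. smooth_field_near A Z X \<longrightarrow> (\<forall>c\<in>charts_at A (fst X). \<forall>a b.
        smooth_near (slit_atlas A) (\<lambda>Y. wcomp A W c a b Y (Z Y)) X)))"

text \<open>\<open>W\<^sub>a\<^sub>b = W\<^sub>b\<^sub>a\<close> and \<open>W\<^sub>a\<^sub>b y\<^sup>b = 0\<close>\<close>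

definition sym_transverse_form ::
  "('m, real ^ 'n) chart set \<Rightarrow> ('m, 'n) cotensor2 \<Rightarrow> ('m, 'n) endo_form \<Rightarrow> bool" where
  "sym_transverse_form A g W \<longleftrightarrow> (\<forall>X\<in>slit A. \<forall>c\<in>charts_at A (fst X). \<forall>Z\<in>TE A X.
     (let Wl = (\<lambda>a b. \<Sum>d\<in>UNIV. gcomp A g c a d X * wcomp A W c d b X Z) in
        (\<forall>a b. Wl a b = Wl b a) \<and> (\<forall>a. (\<Sum>b\<in>UNIV. Wl a b * ycoord c b X) = 0)))"

definition differ_by_sym_transverse ::
  "('m, real ^ 'n) chart set \<Rightarrow> ('m, 'n) cotensor2 \<Rightarrow> ('m, 'n) connection
     \<Rightarrow> ('m, 'n) connection \<Rightarrow> bool" where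
  "differ_by_sym_transverse A g nab nab' \<longleftrightarrow>
     (\<exists>W. pullback_endo_form A W \<and> sym_transverse_form A g W \<and>
        (\<forall>X\<in>slit A. \<forall>c\<in>charts_at A (fst X). \<forall>Z\<in>TE A X. \<forall>a b.
           conn_form A nab' c a b X Z = conn_form A nab c a b X Z + wcomp A W c a b X Z))"

definition conn_class ::
  "('m, real ^ 'n) chart set \<Rightarrow> ('m, 'n) cotensor2 \<Rightarrow> ('m, 'n) connection
     \<Rightarrow> ('m, 'n) connection set" where
  "conn_class A g nab =
     {nab'. finsler_connection A nab' \<and> regular A nab' \<and> differ_by_sym_transverse A g nab nab'}"

end

theory Submission
  imports Defs
begin

text \<open>
  Lowering an index turns \<open>\<Psi>\<close> into \<open>\<Psi>\<^sub>a = (dg\<^sub>a\<^sub>b + \<omega>\<^sub>a\<^sub>b - \<omega>\<^sub>b\<^sub>a) \<and> \<omega>\<^sup>b / 2\<close>. On vertical vectors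
  (\<open>\<beta>\<close>) makes \<open>\<omega>\<^sub>a\<^sub>b\<close> symmetric and then (\<open>\<gamma>\<close>) gives \<open>y\<^sup>a \<partial>g\<^sub>a\<^sub>b/\<partial>y\<^sup>c = 0\<close>, which is the condition for \<open>g\<close> to be
  the vertical Hessian of \<open>L = g(y,y)/2\<close>.

  Next, (\<open>\<epsilon>\<close>) on vertical vectors gives \<open>\<omega>\<^sup>a\<^sub>b y\<^sup>b = 0\<close> there, hence strong regularity. On horizontal vectors
  (\<open>\<delta>\<close>) says that \<open>dg\<^sub>a\<^sub>b + \<omega>\<^sub>a\<^sub>b - \<omega>\<^sub>b\<^sub>a\<close> is symmetric in \<open>b\<close> and the form index; the same holds with \<open>\<Gamma>\<close> in
  place of \<open>H\<close>, and an array antisymmetric in its first two and symmetric in its last two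
  indices vanishes, so that \<open>H\<^sub>a\<^sub>b\<^sub>c - \<Gamma>\<^sub>a\<^sub>b\<^sub>c\<close> is symmetric in \<open>a, b\<close>. It equals \<open>- Dg\<^sub>a\<^sub>b(\<delta>/\<delta>x\<^sup>c) / 2\<close>, which is a tensor
  annihilated by \<open>y\<close> because of (\<open>\<epsilon>\<close>). Contracting with \<open>y\<close> determines first \<open>N\<^sup>a\<^sub>b y\<^sup>b = 2 G\<^sup>a\<close> and then \<open>N\<close>.

  Two connections with these symmetries differ by a symmetric transverse \<open>W\<close>, and \<open>\<Psi>\<close>, \<open>\<nabla>y\<close> and \<open>y\<^sup>a Dg\<^sub>a\<^sub>b\<close> do
  not change under such a \<open>W\<close>. Adding \<open>W = Dg/2\<close> to \<open>\<nabla>\<close> gives the Cartan connection, and from there all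
  other coefficients are reached by adding tensors; for the Berwald and Hashiguchi connections this
  tensor is the Landsberg tensor.
\<close>

section \<open>Smooth functions\<close>

text \<open>The existence claims shape the proof. Writing the Chern or Berwald connection down chart
  by chart would call for the transformation law of its coefficients, with second derivatives of the
  transition maps. Instead the given connection supplies the inhomogeneous part once, and every
  other connection arises from it by adding a tensor. That something is a tensor is read off from an
  expression free of coordinates, such as the directional derivative of g(s, t) corrected by the
  covariant derivatives of s and t. The Landsberg tensor is obtained as a covariant derivative for a
  Chern connection, so a Chern connection has to exist before the Berwald one.

  The property \<open>canonical\<close> is the hub between the descriptions of the class. It speaks
  of connection forms on the frame \<delta>/\<delta>x, \<partial>/\<partial>y of the Barthel
  connection and thus makes sense before regularity, on which the coefficients H and V depend, is
  known. It follows from the conditions as well as from suitable coefficients of a regular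
  connection, and any two connections having it are equivalent.\<close>

lemma frechet_derivative_eqI:
  "(f has_derivative D) (at x) \<Longrightarrow> frechet_derivative f (at x) v = D v"
  using frechet_derivative_at by metis

text \<open>The derivatives are taken at full neighbourhoods, so openness of \<open>S\<close> lets
  equality on \<open>S\<close> pass to them and the induction can continue.\<close>

lemma cont_diff_on_cong:
  assumes "open S" "cont_diff_on k S f" "\<And>x. x \<in> S \<Longrightarrow> f x = g x"
  shows "cont_diff_on k S g"
  using assms(2,3)
proof (induction k arbitrary: f g)
  case 0 then show ?case using continuous_on_cong by force
next
  case (Suc k)
  have D: "(g has_derivative frechet_derivative f (at x)) (at x)" if "x \<in> S" for x
    using Suc.prems that assms(1)
    by (auto intro!: has_derivative_transform_within_open[of f _ _ _ S g] simp: frechet_derivative_works[symmetric])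
  have "cont_diff_on k S (\<lambda>x. frechet_derivative g (at x) v)" for v
    by (rule Suc.IH[of "\<lambda>x. frechet_derivative f (at x) v"])
      (use Suc.prems in \<open>simp_all add: frechet_derivative_eqI[OF D]\<close>)
  then show ?case using D by (auto simp: differentiable_def)
qed

lemma cont_diff_on_subset: "cont_diff_on k S f \<Longrightarrow> T \<subseteq> S \<Longrightarrow> cont_diff_on k T f"
  by (induction k arbitrary: f) (auto intro: continuous_on_subset)

lemma cont_diff_on_Suc: "cont_diff_on (Suc k) S f \<Longrightarrow> cont_diff_on k S f"
proof (induction k arbitrary: f)
  case 0 then show ?case
    by (simp add: continuous_on_eq_continuous_within
        differentiable_imp_continuous_within differentiable_at_withinI)
qed auto

lemma cont_diff_on_local:
  assumes "\<And>x. x \<in> S \<Longrightarrow> \<exists>T. open T \<and> x \<in> T \<and> cont_diff_on k T f"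
  shows "cont_diff_on k S f"
  using assms
proof (induction k arbitrary: f)
  case 0
  show ?case unfolding cont_diff_on.simps continuous_on_eq_continuous_within
  proof
    fix x assume "x \<in> S"
    then obtain T where "open T" "x \<in> T" "continuous_on T f" using 0 by auto
    then have "isCont f x" by (simp add: continuous_on_eq_continuous_at)
    then show "continuous (at x within S) f" by (rule continuous_at_imp_continuous_at_within)
  qed
next
  case (Suc k)
  show ?case unfolding cont_diff_on.simps
  proof (intro conjI ballI allI)
    fix x assume "x \<in> S" then show "f differentiable at x" using Suc.prems by fastforce
  next
    fix v show "cont_diff_on k S (\<lambda>x. frechet_derivative f (at x) v)"
      using Suc.prems by (intro Suc.IH) fastforce
  qed
qed

lemma cont_diff_on_const: "cont_diff_on k S (\<lambda>x. c)"
  by (induction k arbitrary: c) auto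

lemma cont_diff_on_add:
  assumes "open S" "cont_diff_on k S f" "cont_diff_on k S g"
  shows "cont_diff_on k S (\<lambda>x. f x + g x)"
  using assms(2,3)
proof (induction k arbitrary: f g)
  case 0 then show ?case by (auto intro: continuous_intros)
next
  case (Suc k)
  have D: "((\<lambda>x. f x + g x) has_derivative (\<lambda>v. frechet_derivative f (at x) v + frechet_derivative g (at x) v)) (at x)"
    if "x \<in> S" for x
    using Suc.prems that by (auto intro!: has_derivative_add simp: frechet_derivative_works[symmetric])
  have "cont_diff_on k S (\<lambda>x. frechet_derivative (\<lambda>x. f x + g x) (at x) v)" for v
    by (rule cont_diff_on_cong[OF assms(1) Suc.IH[of "\<lambda>x. frechet_derivative f (at x) v" "\<lambda>x. frechet_derivative g (at x) v"]])
      (use Suc.prems in \<open>simp_all add: frechet_derivative_eqI[OF D]\<close>)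
  then show ?case using D by (auto simp: differentiable_def)
qed

lemma cont_diff_on_bounded_linear:
  assumes "open S" "bounded_linear h" "cont_diff_on k S f"
  shows "cont_diff_on k S (\<lambda>x. h (f x))"
  using assms(3)
proof (induction k arbitrary: f)
  case 0 then show ?case by (auto intro: assms(2) bounded_linear.continuous_on)
next
  case (Suc k)
  have D: "((\<lambda>x. h (f x)) has_derivative (\<lambda>v. h (frechet_derivative f (at x) v))) (at x)"
    if "x \<in> S" for x
    using Suc.prems that
    by (auto intro!: bounded_linear.has_derivative[OF assms(2)] simp: frechet_derivative_works[symmetric])
  have "cont_diff_on k S (\<lambda>x. frechet_derivative (\<lambda>x. h (f x)) (at x) v)" for v
    by (rule cont_diff_on_cong[OF assms(1) Suc.IH[of "\<lambda>x. frechet_derivative f (at x) v"]])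
      (use Suc.prems in \<open>simp_all add: frechet_derivative_eqI[OF D]\<close>)
  then show ?case using D by (auto simp: differentiable_def)
qed

lemma cont_diff_on_bounded_bilinear:
  assumes "open S" "bounded_bilinear h" "cont_diff_on k S f" "cont_diff_on k S g"
  shows "cont_diff_on k S (\<lambda>x. h (f x) (g x))"
  using assms(3,4)
proof (induction k arbitrary: f g)
  case 0 then show ?case by (auto intro: assms(2) bounded_bilinear.continuous_on)
next
  case (Suc k)
  have D: "((\<lambda>x. h (f x) (g x)) has_derivative
      (\<lambda>v. h (f x) (frechet_derivative g (at x) v) + h (frechet_derivative f (at x) v) (g x))) (at x)"
    if "x \<in> S" for x
    using Suc.prems that
    by (auto intro!: bounded_bilinear.FDERIV[OF assms(2)] simp: frechet_derivative_works[symmetric])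
  have "cont_diff_on k S (\<lambda>x. frechet_derivative (\<lambda>x. h (f x) (g x)) (at x) v)" for v
    by (rule cont_diff_on_cong[OF assms(1) cont_diff_on_add[OF assms(1)
            Suc.IH[of f "\<lambda>x. frechet_derivative g (at x) v"]
            Suc.IH[of "\<lambda>x. frechet_derivative f (at x) v" g]]])
      (use Suc.prems cont_diff_on_Suc in \<open>auto simp: frechet_derivative_eqI[OF D]\<close>)
  then show ?case using D by (auto simp: differentiable_def)
qed

lemma cont_diff_on_sum:
  assumes "open S" "\<And>i. i \<in> I \<Longrightarrow> cont_diff_on k S (f i)"
  shows "cont_diff_on k S (\<lambda>x. \<Sum>i\<in>I. f i x)"
  using assms(2)
  by (induction I rule: infinite_finite_induct)
    (auto intro: cont_diff_on_const cont_diff_on_add[OF assms(1)])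

text \<open>Rewrites a derivative in a varying direction as a combination of derivatives in fixed
  directions, the only ones of which \<open>cont_diff_on\<close> speaks.\<close>

lemma frechet_derivative_basis_expansion:
  fixes f :: "'b::euclidean_space \<Rightarrow> 'c::real_normed_vector"
  assumes "f differentiable at x"
  shows "frechet_derivative f (at x) v = (\<Sum>i\<in>Basis. (v \<bullet> i) *\<^sub>R frechet_derivative f (at x) i)"
proof -
  have l: "linear (frechet_derivative f (at x))" using assms by (rule linear_frechet_derivative)
  have "frechet_derivative f (at x) (\<Sum>i\<in>Basis. (v \<bullet> i) *\<^sub>R i) =
      (\<Sum>i\<in>Basis. (v \<bullet> i) *\<^sub>R frechet_derivative f (at x) i)"
    by (simp add: linear_sum[OF l] linear_scale[OF l])
  then show ?thesis by (simp add: euclidean_representation)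
qed

text \<open>The chain rule differentiates \<open>f\<close> in a direction that depends on the point.
  Expansion along \<open>Basis\<close> brings this back to fixed directions, which is why the middle
  space is euclidean.\<close>

lemma cont_diff_on_compose:
  fixes f :: "'b::euclidean_space \<Rightarrow> 'c::real_normed_vector" and g :: "'a::real_normed_vector \<Rightarrow> 'b"
  assumes "open S" "cont_diff_on k T f" "cont_diff_on k S g" "g ` S \<subseteq> T"
  shows "cont_diff_on k S (\<lambda>x. f (g x))"
  using assms(2,3)
proof (induction k arbitrary: f)
  case 0 then show ?case using assms(4)
    by (auto intro: continuous_on_compose2)
next
  case (Suc k)
  have D: "((\<lambda>x. f (g x)) has_derivative
      (\<lambda>v. frechet_derivative f (at (g x)) (frechet_derivative g (at x) v))) (at x)"
    if "x \<in> S" for x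
    using Suc.prems that assms(4)
    by (auto intro!: has_derivative_compose[of g _ x UNIV f] simp: frechet_derivative_works[symmetric])
  have E: "(\<Sum>i\<in>Basis. (frechet_derivative g (at x) v \<bullet> i) *\<^sub>R frechet_derivative f (at (g x)) i) =
      frechet_derivative (\<lambda>x. f (g x)) (at x) v" if "x \<in> S" for x v
    using that Suc.prems assms(4) fun_cong[OF frechet_derivative_at[OF D[OF that]], of v]
      frechet_derivative_basis_expansion[of f "g x" "frechet_derivative g (at x) v"] by auto
  have "cont_diff_on k S (\<lambda>x. frechet_derivative (\<lambda>x. f (g x)) (at x) v)" for v
  proof (rule cont_diff_on_cong[OF assms(1) cont_diff_on_sum[OF assms(1)] E])
    fix i :: 'b assume "i \<in> Basis"
    show "cont_diff_on k S (\<lambda>x. (frechet_derivative g (at x) v \<bullet> i) *\<^sub>R frechet_derivative f (at (g x)) i)"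
      by (rule cont_diff_on_bounded_bilinear[OF assms(1) bounded_bilinear_scaleR
            cont_diff_on_bounded_linear[OF assms(1) bounded_linear_inner_left]])
        (use Suc.prems in \<open>auto intro!: Suc.IH[of "\<lambda>z. frechet_derivative f (at z) i"] intro: cont_diff_on_Suc\<close>)
  qed
  then show ?case using D by (auto simp: differentiable_def)
qed

text \<open>The derivative of 1/f is a product of f' with two factors 1/f, and these are of class k
  by the induction hypothesis; hence the induction keeps \<open>f\<close> fixed.\<close>

lemma cont_diff_on_inverse:
  fixes f :: "'a::real_normed_vector \<Rightarrow> real"
  assumes "open S" "cont_diff_on k S f" "\<And>x. x \<in> S \<Longrightarrow> f x \<noteq> 0"
  shows "cont_diff_on k S (\<lambda>x. inverse (f x))"
  using assms(2)
proof (induction k)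
  case 0 then show ?case using assms(3) by (auto intro: continuous_intros)
next
  case (Suc k)
  have D: "((\<lambda>x. inverse (f x)) has_derivative
      (\<lambda>v. - (inverse (f x) * frechet_derivative f (at x) v * inverse (f x)))) (at x)"
    if "x \<in> S" for x
    using Suc.prems that assms(3)
    by (auto intro!: has_derivative_inverse simp: frechet_derivative_works[symmetric])
  have I: "cont_diff_on k S (\<lambda>x. inverse (f x))" using Suc cont_diff_on_Suc by blast
  have "cont_diff_on k S (\<lambda>x. frechet_derivative (\<lambda>x. inverse (f x)) (at x) v)" for v
    by (rule cont_diff_on_cong[OF assms(1) cont_diff_on_bounded_linear[OF assms(1)
            bounded_linear_minus[OF bounded_linear_ident]
            cont_diff_on_bounded_bilinear[OF assms(1) bounded_bilinear_mult
              cont_diff_on_bounded_bilinear[OF assms(1) bounded_bilinear_mult I, of "\<lambda>x. frechet_derivative f (at x) v"] I]]])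
      (use Suc.prems in \<open>simp_all add: frechet_derivative_eqI[OF D]\<close>)
  then show ?case using D by (auto simp: differentiable_def)
qed

section \<open>Smoothness of a germ at a point\<close>

definition smooth_at :: "('a::real_normed_vector \<Rightarrow> 'b::real_normed_vector) \<Rightarrow> 'a \<Rightarrow> bool" where
  "smooth_at f p \<longleftrightarrow> (\<exists>S. open S \<and> p \<in> S \<and> smooth_on S f)"

lemma smooth_on_subset: "smooth_on S f \<Longrightarrow> T \<subseteq> S \<Longrightarrow> smooth_on T f"
  unfolding smooth_on_def using cont_diff_on_subset by blast

lemma smooth_on_imp_smooth_at: "smooth_on S f \<Longrightarrow> open S \<Longrightarrow> p \<in> S \<Longrightarrow> smooth_at f p"
  unfolding smooth_at_def by blast

lemma smooth_on_iff_smooth_at: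
  assumes "open S"
  shows "smooth_on S f \<longleftrightarrow> (\<forall>p\<in>S. smooth_at f p)"
proof
  assume "smooth_on S f" then show "\<forall>p\<in>S. smooth_at f p" using assms smooth_on_imp_smooth_at by blast
next
  assume a: "\<forall>p\<in>S. smooth_at f p"
  have "cont_diff_on k S f" for k
    by (rule cont_diff_on_local) (use a in \<open>auto simp: smooth_at_def smooth_on_def\<close>)
  then show "smooth_on S f" by (simp add: smooth_on_def)
qed

lemma smooth_at_cong:
  assumes "smooth_at f p" "eventually (\<lambda>x. f x = g x) (nhds p)"
  shows "smooth_at g p"
proof -
  obtain S where S: "open S" "p \<in> S" "smooth_on S f" using assms(1) unfolding smooth_at_def by auto
  obtain T where T: "open T" "p \<in> T" "\<forall>x\<in>T. f x = g x" using assms(2) unfolding eventually_nhds by auto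
  have "smooth_on (S \<inter> T) g"
    using S T cont_diff_on_cong[of "S \<inter> T" _ f g] cont_diff_on_subset[of _ S f "S \<inter> T"]
    unfolding smooth_on_def by auto
  then show ?thesis using S T unfolding smooth_at_def by blast
qed

lemma smooth_at_eventually: "smooth_at f p \<Longrightarrow> eventually (smooth_at f) (nhds p)"
  unfolding smooth_at_def eventually_nhds by blast

lemma smooth_at_differentiable: "smooth_at f p \<Longrightarrow> f differentiable at p"
  unfolding smooth_at_def smooth_on_def by (metis cont_diff_on.simps(2))

lemma smooth_at_has_derivative:
  "smooth_at f p \<Longrightarrow> (f has_derivative frechet_derivative f (at p)) (at p)"
  using smooth_at_differentiable frechet_derivative_works by blast

lemma smooth_at_isCont: "smooth_at f p \<Longrightarrow> isCont f p"
  using smooth_at_differentiable differentiable_imp_continuous_within by blast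

lemma smooth_at_const: "smooth_at (\<lambda>x. c) p"
  unfolding smooth_at_def smooth_on_def using cont_diff_on_const by blast

lemma smooth_at_bounded_linear:
  "bounded_linear h \<Longrightarrow> smooth_at f p \<Longrightarrow> smooth_at (\<lambda>x. h (f x)) p"
  unfolding smooth_at_def smooth_on_def using cont_diff_on_bounded_linear by blast

lemma smooth_at_bounded_bilinear:
  assumes "bounded_bilinear h" "smooth_at f p" "smooth_at g p"
  shows "smooth_at (\<lambda>x. h (f x) (g x)) p"
proof -
  obtain S T where "open S" "p \<in> S" "smooth_on S f" "open T" "p \<in> T" "smooth_on T g"
    using assms unfolding smooth_at_def by auto
  then have "open (S \<inter> T)" "p \<in> S \<inter> T" "smooth_on (S \<inter> T) f" "smooth_on (S \<inter> T) g"
    using smooth_on_subset[of S f "S \<inter> T"] smooth_on_subset[of T g "S \<inter> T"]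
    by (simp_all add: open_Int)
  then show ?thesis unfolding smooth_at_def smooth_on_def
    by (intro exI[of _ "S \<inter> T"]) (simp add: cont_diff_on_bounded_bilinear[OF _ assms(1)])
qed

lemma smooth_at_add:
  assumes "smooth_at f p" "smooth_at g p"
  shows "smooth_at (\<lambda>x. f x + g x) p"
proof -
  obtain S T where "open S" "p \<in> S" "smooth_on S f" "open T" "p \<in> T" "smooth_on T g"
    using assms unfolding smooth_at_def by auto
  then have "open (S \<inter> T)" "p \<in> S \<inter> T" "smooth_on (S \<inter> T) f" "smooth_on (S \<inter> T) g"
    using smooth_on_subset[of S f "S \<inter> T"] smooth_on_subset[of T g "S \<inter> T"]
    by (simp_all add: open_Int)
  then show ?thesis unfolding smooth_at_def smooth_on_def
    by (intro exI[of _ "S \<inter> T"]) (simp add: cont_diff_on_add)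
qed

lemma smooth_at_sum:
  "(\<And>i. i \<in> I \<Longrightarrow> smooth_at (f i) p) \<Longrightarrow> smooth_at (\<lambda>x. \<Sum>i\<in>I. f i x) p"
  by (induction I rule: infinite_finite_induct) (auto intro: smooth_at_const smooth_at_add)

lemma smooth_at_inverse:
  fixes f :: "'a::real_normed_vector \<Rightarrow> real"
  assumes "smooth_at f p" "f p \<noteq> 0"
  shows "smooth_at (\<lambda>x. inverse (f x)) p"
proof -
  obtain S where S: "open S" "p \<in> S" "smooth_on S f" using assms unfolding smooth_at_def by auto
  have "((f \<longlongrightarrow> f p) (nhds p))"
    using smooth_at_isCont[OF assms(1)] by (simp add: isCont_def tendsto_at_iff_tendsto_nhds)
  then have "eventually (\<lambda>x. f x \<noteq> 0) (nhds p)" by (rule tendsto_imp_eventually_ne[OF _ assms(2)])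
  then obtain T where T: "open T" "p \<in> T" "\<forall>x\<in>T. f x \<noteq> 0" unfolding eventually_nhds by auto
  have "smooth_on (S \<inter> T) f" using smooth_on_subset[OF S(3)] by auto
  then show ?thesis unfolding smooth_at_def smooth_on_def
    using cont_diff_on_inverse[of "S \<inter> T" _ f] S T by blast
qed

lemma smooth_at_compose:
  fixes f :: "'b::euclidean_space \<Rightarrow> 'c::real_normed_vector" and g :: "'a::real_normed_vector \<Rightarrow> 'b"
  assumes "smooth_at g p" "smooth_at f (g p)"
  shows "smooth_at (\<lambda>x. f (g x)) p"
proof -
  obtain S T where S: "open S" "p \<in> S" "smooth_on S g" and T: "open T" "g p \<in> T" "smooth_on T f"
    using assms unfolding smooth_at_def by auto
  have "continuous_on S g" using S(3) unfolding smooth_on_def by (metis cont_diff_on.simps(1))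
  then obtain U where U: "open U" "p \<in> U" "U \<subseteq> S" "g ` U \<subseteq> T"
    using S T continuous_on_open_vimage[of S g] by (metis Int_iff image_subset_iff_subset_vimage inf_le1 inf_le2 vimageI)
  then show ?thesis using smooth_on_subset[OF S(3) U(3)] T
    unfolding smooth_at_def smooth_on_def using cont_diff_on_compose[of U _ T f g] by blast
qed

lemma smooth_at_frechet_derivative:
  "smooth_at f p \<Longrightarrow> smooth_at (\<lambda>x. frechet_derivative f (at x) v) p"
  unfolding smooth_at_def smooth_on_def by (metis cont_diff_on.simps(2))

lemma smooth_at_ident: "smooth_at (\<lambda>x. x) p"
proof -
  have "cont_diff_on k UNIV (\<lambda>x. x)" for k
    by (cases k) (auto simp: cont_diff_on_const)
  then show ?thesis unfolding smooth_at_def smooth_on_def by blast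
qed

lemma smooth_at_Pair:
  assumes "smooth_at f p" "smooth_at g p"
  shows "smooth_at (\<lambda>x. (f x, g x)) p"
proof -
  have b: "bounded_linear (\<lambda>x. (x, 0))" "bounded_linear (\<lambda>x. (0, x))"
    by (auto intro!: bounded_linear_Pair bounded_linear_ident bounded_linear_zero)
  show ?thesis
    using smooth_at_add[OF smooth_at_bounded_linear[OF b(1) assms(1)] smooth_at_bounded_linear[OF b(2) assms(2)]]
    by simp
qed

lemma smooth_at_vec:
  fixes f :: "'a::real_normed_vector \<Rightarrow> real ^ 'n"
  assumes "\<And>i. smooth_at (\<lambda>x. f x $ i) p"
  shows "smooth_at f p"
proof -
  have "f = (\<lambda>x. \<Sum>i\<in>UNIV. (f x $ i) *\<^sub>R axis i 1)"
    by (simp add: fun_eq_iff vec_eq_iff axis_def if_distrib cong: if_cong)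
  moreover have "smooth_at (\<lambda>x. \<Sum>i\<in>UNIV. (f x $ i) *\<^sub>R (axis i 1 :: real ^ 'n)) p"
    by (intro smooth_at_sum smooth_at_bounded_linear[OF bounded_linear_scaleR_left assms])
  ultimately show ?thesis by simp
qed

text \<open>Base point and direction vary together, as in the fibre component (x, y) \<mapsto>
  d\<tau>(x) y of a transition map of the tangent bundle.\<close>

lemma smooth_at_frechet_derivative_vector:
  fixes f :: "'b::euclidean_space \<Rightarrow> 'c::real_normed_vector" and g h :: "'a::real_normed_vector \<Rightarrow> 'b"
  assumes "smooth_at f (g p)" "smooth_at g p" "smooth_at h p"
  shows "smooth_at (\<lambda>x. frechet_derivative f (at (g x)) (h x)) p"
proof (rule smooth_at_cong)
  show "smooth_at (\<lambda>x. \<Sum>i\<in>Basis. (h x \<bullet> i) *\<^sub>R frechet_derivative f (at (g x)) i) p"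
    by (intro smooth_at_sum smooth_at_bounded_bilinear[OF bounded_bilinear_scaleR]
        smooth_at_bounded_linear[OF bounded_linear_inner_left] assms
        smooth_at_compose[OF assms(2), of "\<lambda>z. frechet_derivative f (at z) i" for i]
        smooth_at_frechet_derivative)
  have "filterlim g (nhds (g p)) (nhds p)"
    using smooth_at_isCont[OF assms(2)] by (simp add: isCont_def tendsto_at_iff_tendsto_nhds)
  then have "eventually (\<lambda>x. smooth_at f (g x)) (nhds p)"
    using smooth_at_eventually[OF assms(1)] by (simp add: filterlim_iff)
  then show "eventually (\<lambda>x. (\<Sum>i\<in>Basis. (h x \<bullet> i) *\<^sub>R frechet_derivative f (at (g x)) i) =
      frechet_derivative f (at (g x)) (h x)) (nhds p)"
    by (rule eventually_mono) (metis frechet_derivative_basis_expansion smooth_at_differentiable)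
qed

text \<open>\<open>frechet_derivative\<close> is a choice that depends only on the set of
  derivatives, and the germ determines this set; so the rule holds for arbitrary germs.\<close>

lemma frechet_derivative_cong_eventually:
  assumes "eventually (\<lambda>x. f x = g x) (nhds p)"
  shows "frechet_derivative f (at p) = frechet_derivative g (at p)"
proof -
  obtain S where "open S" "p \<in> S" "\<And>x. x \<in> S \<Longrightarrow> f x = g x" using assms unfolding eventually_nhds by auto
  then have "(f has_derivative D) (at p) \<longleftrightarrow> (g has_derivative D) (at p)" for D
    using has_derivative_transform_within_open by metis
  then show ?thesis unfolding frechet_derivative_def by simp
qed

section \<open>Symmetry of second derivatives\<close>

text \<open>Twice the mean value theorem.\<close>

lemma second_difference_mixed_derivative:
  fixes f :: "'a::real_normed_vector \<Rightarrow> real"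
  assumes "h > 0" and f: "\<And>s t. 0 \<le> s \<Longrightarrow> s \<le> h \<Longrightarrow> 0 \<le> t \<Longrightarrow> t \<le> h \<Longrightarrow> smooth_at f (p + s *\<^sub>R u + t *\<^sub>R v)"
  shows "\<exists>s t. 0 < s \<and> s < h \<and> 0 < t \<and> t < h \<and>
    f (p + h *\<^sub>R u + h *\<^sub>R v) - f (p + h *\<^sub>R u) - f (p + h *\<^sub>R v) + f p =
    h * h * frechet_derivative (\<lambda>x. frechet_derivative f (at x) u) (at (p + s *\<^sub>R u + t *\<^sub>R v)) v"
proof -
  have d1: "((\<lambda>s. F (q + s *\<^sub>R w)) has_real_derivative frechet_derivative F (at (q + s *\<^sub>R w)) w) (at s)"
    if "smooth_at F (q + s *\<^sub>R w)" for s q w and F :: "'a \<Rightarrow> real"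
  proof -
    have "((\<lambda>s. F (q + s *\<^sub>R w)) has_derivative (\<lambda>r. frechet_derivative F (at (q + s *\<^sub>R w)) (r *\<^sub>R w))) (at s)"
      by (rule has_derivative_compose[of "\<lambda>s. q + s *\<^sub>R w" _ s UNIV F, OF _ smooth_at_has_derivative[OF that]])
        (auto intro!: derivative_eq_intros)
    moreover have "frechet_derivative F (at (q + s *\<^sub>R w)) (r *\<^sub>R w) = frechet_derivative F (at (q + s *\<^sub>R w)) w * r" for r
      by (simp add: linear_scale[OF linear_frechet_derivative[OF smooth_at_differentiable[OF that]]])
    ultimately show ?thesis unfolding has_field_derivative_def by simp
  qed
  \<comment> \<open>The second difference is the increment of this first difference along
    \<open>u\<close>; the derivative so obtained is in turn an increment along
    \<open>v\<close>.\<close>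
  let ?\<phi> = "\<lambda>s. f ((p + h *\<^sub>R v) + s *\<^sub>R u) - f (p + s *\<^sub>R u)"
  let ?D = "\<lambda>x. frechet_derivative f (at x) u"
  have sm: "smooth_at f (p + h *\<^sub>R v + s *\<^sub>R u)" "smooth_at f (p + s *\<^sub>R u)" if "0 \<le> s" "s \<le> h" for s
    using f[of s h] f[of s 0] that assms(1) by (simp_all add: algebra_simps)
  have "(?\<phi> has_real_derivative (?D (p + h *\<^sub>R v + s *\<^sub>R u) - ?D (p + s *\<^sub>R u))) (at s)"
    if "0 \<le> s" "s \<le> h" for s
    using that sm by (intro DERIV_diff d1)
  from MVT2[OF assms(1) this] obtain s where s: "0 < s" "s < h"
    "?\<phi> h - ?\<phi> 0 = h * (?D (p + h *\<^sub>R v + s *\<^sub>R u) - ?D (p + s *\<^sub>R u))" by auto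
  have "((\<lambda>t. ?D ((p + s *\<^sub>R u) + t *\<^sub>R v)) has_real_derivative
      frechet_derivative ?D (at ((p + s *\<^sub>R u) + t *\<^sub>R v)) v) (at t)" if "0 \<le> t" "t \<le> h" for t
    by (rule d1) (use s f that in \<open>auto intro!: smooth_at_frechet_derivative\<close>)
  from MVT2[OF assms(1) this] obtain t where t: "0 < t" "t < h"
    "?D ((p + s *\<^sub>R u) + h *\<^sub>R v) - ?D (p + s *\<^sub>R u) = h * frechet_derivative ?D (at ((p + s *\<^sub>R u) + t *\<^sub>R v)) v"
    by auto
  show ?thesis
    by (rule exI[of _ s], rule exI[of _ t]) (use s t in \<open>simp add: algebra_simps\<close>)
qed

text \<open>The second difference does not see the order of \<open>u\<close> and \<open>v\<close>,
  and it equals \<open>h * h\<close> times either mixed derivative at a point of the same small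
  parallelogram. By continuity both values tend to those at \<open>p\<close>.\<close>

lemma frechet_derivative_commute:
  fixes f :: "'a::real_normed_vector \<Rightarrow> real"
  assumes "smooth_at f p"
  shows "frechet_derivative (\<lambda>x. frechet_derivative f (at x) u) (at p) v =
    frechet_derivative (\<lambda>x. frechet_derivative f (at x) v) (at p) u" (is "?A p = ?B p")
proof (rule ccontr)
  assume ne: "?A p \<noteq> ?B p"
  \<comment> \<open>Half the distance: two values within \<open>e\<close> of the respective limits
    cannot coincide.\<close>
  define e where "e = dist (?A p) (?B p) / 2"
  have e: "e > 0" using ne by (simp add: e_def)
  have sA: "smooth_at ?A p" and sB: "smooth_at ?B p"
    by (intro smooth_at_frechet_derivative assms)+
  obtain r where r: "r > 0" "\<And>x. dist x p < r \<Longrightarrow> smooth_at f x" "\<And>x. dist x p < r \<Longrightarrow> dist (?A x) (?A p) < e"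
    "\<And>x. dist x p < r \<Longrightarrow> dist (?B x) (?B p) < e"
  proof -
    obtain r1 where "r1 > 0" "\<forall>x. dist x p < r1 \<longrightarrow> smooth_at f x"
      using smooth_at_eventually[OF assms] unfolding eventually_nhds_metric by auto
    moreover obtain r2 where "r2 > 0" "\<forall>x. dist x p < r2 \<longrightarrow> dist (?A x) (?A p) < e"
      using smooth_at_isCont[OF sA] e unfolding continuous_at_eps_delta by metis
    moreover obtain r3 where "r3 > 0" "\<forall>x. dist x p < r3 \<longrightarrow> dist (?B x) (?B p) < e"
      using smooth_at_isCont[OF sB] e unfolding continuous_at_eps_delta by metis
    ultimately show thesis by (intro that[of "min r1 (min r2 r3)"]) auto
  qed
  \<comment> \<open>Chosen so that the parallelogram with sides \<open>h u\<close> and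
    \<open>h v\<close> stays within r/2 of \<open>p\<close>; the summand 1 covers the case that both
    vectors are zero.\<close>
  define h where "h = r / (2 * (norm u + norm v + 1))"
  have nz: "norm u + norm v + 1 > 0" by (simp add: add_nonneg_pos)
  have h: "h > 0" using r nz by (simp add: h_def)
  have close: "dist (p + s *\<^sub>R u + t *\<^sub>R v) p < r" if "0 \<le> s" "s \<le> h" "0 \<le> t" "t \<le> h" for s t
  proof -
    have "dist (p + s *\<^sub>R u + t *\<^sub>R v) p = norm (s *\<^sub>R u + t *\<^sub>R v)" by (simp add: dist_norm algebra_simps)
    also have "\<dots> \<le> h * norm u + h * norm v"
      using that by (intro order.trans[OF norm_triangle_ineq] add_mono) (auto intro: mult_right_mono)
    also have "\<dots> \<le> h * (norm u + norm v + 1)" using h by (simp add: algebra_simps)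
    also have "\<dots> = r / 2" using nz unfolding h_def times_divide_eq_left
      by (metis less_irrefl mult.commute mult_divide_mult_cancel_right)
    finally show ?thesis using r(1) by simp
  qed
  obtain s t where st: "0 < s" "s < h" "0 < t" "t < h"
    "f (p + h *\<^sub>R u + h *\<^sub>R v) - f (p + h *\<^sub>R u) - f (p + h *\<^sub>R v) + f p = h * h * ?A (p + s *\<^sub>R u + t *\<^sub>R v)"
    using second_difference_mixed_derivative[OF h, of f p u v] r(2) close by blast
  have "smooth_at f (p + s *\<^sub>R v + t *\<^sub>R u)" if "0 \<le> s" "s \<le> h" "0 \<le> t" "t \<le> h" for s t
    using r(2)[OF close[of t s]] that by (simp add: algebra_simps)
  from second_difference_mixed_derivative[OF h this]
  obtain s' t' where st': "0 < s'" "s' < h" "0 < t'" "t' < h"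
    "f (p + h *\<^sub>R v + h *\<^sub>R u) - f (p + h *\<^sub>R v) - f (p + h *\<^sub>R u) + f p = h * h * ?B (p + s' *\<^sub>R v + t' *\<^sub>R u)"
    by blast
  have "h * h * ?A (p + s *\<^sub>R u + t *\<^sub>R v) = h * h * ?B (p + s' *\<^sub>R v + t' *\<^sub>R u)"
    unfolding st(5)[symmetric] st'(5)[symmetric]
    by (simp add: add.assoc add.commute[of "h *\<^sub>R u"])
  then have "?A (p + s *\<^sub>R u + t *\<^sub>R v) = ?B (p + t' *\<^sub>R u + s' *\<^sub>R v)"
    using h by (simp add: add.assoc add.commute[of "t' *\<^sub>R u"])
  moreover have "dist (?A (p + s *\<^sub>R u + t *\<^sub>R v)) (?A p) < e" using st close r(3) by simp
  moreover have "dist (?B (p + t' *\<^sub>R u + s' *\<^sub>R v)) (?B p) < e" using st' close r(4) by simp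
  ultimately have "dist (?A p) (?B p) < e + e" unfolding dist_real_def by linarith
  then show False by (simp add: e_def)
qed

section \<open>Calculus on an atlas\<close>

text \<open>The inverse of taking components in the chart \<open>C\<close>, with the value 0 outside
  the charts around \<open>p\<close> that the encoding of tangent vectors prescribes.\<close>

definition tvec_of ::
  "('a, 'e::real_normed_vector) chart set \<Rightarrow> ('a, 'e) chart \<Rightarrow> 'a \<Rightarrow> 'e \<Rightarrow> ('a, 'e) tvec" where
  "tvec_of B C p v = (\<lambda>D. if C \<in> charts_at B p \<and> D \<in> charts_at B p
     then frechet_derivative (transition C D) (at (cmap C p)) v else 0)"

text \<open>The common form of \<open>dx\<close>, \<open>dy\<close> and \<open>dir_deriv\<close>:
  the direction is a vector of the model space, so that a single calculus serves all three.\<close>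

definition pd :: "('a, 'e::real_normed_vector) chart \<Rightarrow> 'e \<Rightarrow> ('a \<Rightarrow> 'b::real_normed_vector) \<Rightarrow> 'a \<Rightarrow> 'b" where
  "pd C w f p = frechet_derivative (f \<circ> cinv C) (at (cmap C p)) w"

lemma dir_deriv_eq_pd: "dir_deriv C f p v = pd C (v C) f p"
  by (simp add: dir_deriv_def pd_def)

text \<open>Openness is asked of chart images in the model space, not of subsets of the point set.
  The same calculus therefore serves M and its slit tangent bundle.\<close>

locale smooth_atlas =
  fixes B :: "('a, 'e::euclidean_space) chart set"
  assumes inj: "C \<in> B \<Longrightarrow> inj_on (cmap C) (cdom C)"
    and opn: "C \<in> B \<Longrightarrow> D \<in> B \<Longrightarrow> open (cmap C ` (cdom C \<inter> cdom D))"
    and smt: "C \<in> B \<Longrightarrow> D \<in> B \<Longrightarrow> smooth_on (cmap C ` (cdom C \<inter> cdom D)) (transition C D)"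
begin

section \<open>Charts and germs of functions\<close>

lemma charts_atD: "C \<in> charts_at B p \<Longrightarrow> C \<in> B" "C \<in> charts_at B p \<Longrightarrow> p \<in> cdom C"
  by (auto simp: charts_at_def)

lemma cinv_cmap [simp]: "C \<in> charts_at B p \<Longrightarrow> cinv C (cmap C p) = p"
  unfolding cinv_def using inj charts_atD inv_into_f_f by metis

text \<open>\<open>cinv\<close> is a true inverse only on the image of the chart. This turns
  identities on chart domains into identities of germs in the model space.\<close>

lemma eventually_chart:
  assumes "C \<in> charts_at B p" "D \<in> charts_at B p"
  shows "eventually (\<lambda>x. C \<in> charts_at B (cinv C x) \<and> D \<in> charts_at B (cinv C x) \<and> cmap C (cinv C x) = x)
    (nhds (cmap C p))"
proof -
  have o: "open (cmap C ` (cdom C \<inter> cdom D))" using assms opn charts_atD by blast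
  have "cmap C p \<in> cmap C ` (cdom C \<inter> cdom D)" using assms charts_atD by auto
  moreover have "C \<in> charts_at B (cinv C x) \<and> D \<in> charts_at B (cinv C x) \<and> cmap C (cinv C x) = x"
    if x: "x \<in> cmap C ` (cdom C \<inter> cdom D)" for x
  proof -
    obtain q where q: "q \<in> cdom C" "q \<in> cdom D" "x = cmap C q" using x by auto
    then have "C \<in> charts_at B q" "D \<in> charts_at B q" using assms by (auto simp: charts_at_def)
    then show ?thesis using q by simp
  qed
  ultimately show ?thesis unfolding eventually_nhds using o by blast
qed

lemma smooth_at_transition:
  assumes "C \<in> charts_at B p" "D \<in> charts_at B p"
  shows "smooth_at (transition C D) (cmap C p)"
  using assms charts_atD by (intro smooth_on_imp_smooth_at[OF smt opn]) auto

lemma transition_at [simp]: "C \<in> charts_at B p \<Longrightarrow> transition C D (cmap C p) = cmap D p"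
  by (simp add: transition_def)

lemma transition_self:
  assumes "C \<in> charts_at B p"
  shows "frechet_derivative (transition C C) (at (cmap C p)) = (\<lambda>v. v)"
proof -
  have "frechet_derivative (transition C C) (at (cmap C p)) = frechet_derivative (\<lambda>x. x) (at (cmap C p))"
    by (rule frechet_derivative_cong_eventually[OF eventually_mono[OF eventually_chart[OF assms assms]]])
      (simp add: transition_def)
  then show ?thesis by simp
qed

lemma comp_cinv_change:
  assumes "C \<in> charts_at B p" "D \<in> charts_at B p"
  shows "eventually (\<lambda>x. (f \<circ> cinv D) (transition C D x) = (f \<circ> cinv C) x) (nhds (cmap C p))"
  by (rule eventually_mono[OF eventually_chart[OF assms]]) (auto simp: transition_def)

lemma smooth_near_iff_charts:
  "smooth_near B f p \<longleftrightarrow> (\<forall>C\<in>charts_at B p. smooth_at (f \<circ> cinv C) (cmap C p))"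
proof
  assume "smooth_near B f p"
  then show "\<forall>C\<in>charts_at B p. smooth_at (f \<circ> cinv C) (cmap C p)"
    unfolding smooth_near_def smooth_at_def by blast
next
  assume a: "\<forall>C\<in>charts_at B p. smooth_at (f \<circ> cinv C) (cmap C p)"
  show "smooth_near B f p" unfolding smooth_near_def
  proof
    fix C assume C: "C \<in> charts_at B p"
    then obtain S where S: "open S" "cmap C p \<in> S" "smooth_on S (f \<circ> cinv C)"
      using a unfolding smooth_at_def by blast
    have "open (cmap C ` cdom C)" using opn[of C C] C charts_atD by auto
    then show "\<exists>S. open S \<and> cmap C p \<in> S \<and> S \<subseteq> cmap C ` cdom C \<and> smooth_on S (f \<circ> cinv C)"
      using S C charts_atD smooth_on_subset[OF S(3)]
      by (intro exI[of _ "S \<inter> cmap C ` cdom C"]) (auto intro: open_Int)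
  qed
qed

lemma smooth_at_change_chart:
  assumes "C \<in> charts_at B p" "D \<in> charts_at B p" "smooth_at (f \<circ> cinv D) (cmap D p)"
  shows "smooth_at (f \<circ> cinv C) (cmap C p)"
proof (rule smooth_at_cong[OF _ comp_cinv_change[OF assms(1,2)]])
  show "smooth_at (\<lambda>x. (f \<circ> cinv D) (transition C D x)) (cmap C p)"
    by (rule smooth_at_compose[OF smooth_at_transition[OF assms(1,2)]])
      (simp only: transition_at[OF assms(1)] assms(3))
qed

text \<open>\<open>smooth_near\<close> quantifies over all charts at the point; smooth transition
  maps reduce it to any one of them.\<close>

lemma smooth_near_iff:
  assumes "C \<in> charts_at B p"
  shows "smooth_near B f p \<longleftrightarrow> smooth_at (f \<circ> cinv C) (cmap C p)"
  using assms smooth_at_change_chart smooth_near_iff_charts by blast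

lemma eventually_agree:
  assumes "C \<in> charts_at B p" "D \<in> charts_at B p"
    "\<And>q. C \<in> charts_at B q \<Longrightarrow> D \<in> charts_at B q \<Longrightarrow> f q = g q"
  shows "eventually (\<lambda>x. (f \<circ> cinv C) x = (g \<circ> cinv C) x) (nhds (cmap C p))"
  by (rule eventually_mono[OF eventually_chart[OF assms(1,2)]]) (auto simp: assms(3))

text \<open>Agreement is asked only where both charts are defined, since coordinate expressions take
  arbitrary values elsewhere.\<close>

lemma smooth_near_cong:
  assumes "C \<in> charts_at B p" "D \<in> charts_at B p"
    "\<And>q. C \<in> charts_at B q \<Longrightarrow> D \<in> charts_at B q \<Longrightarrow> f q = g q" "smooth_near B f p"
  shows "smooth_near B g p"
  using assms(4) unfolding smooth_near_iff[OF assms(1)]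
  by (rule smooth_at_cong[OF _ eventually_agree[OF assms(1-3)]])

lemma pd_cong:
  assumes "C \<in> charts_at B p" "D \<in> charts_at B p"
    "\<And>q. C \<in> charts_at B q \<Longrightarrow> D \<in> charts_at B q \<Longrightarrow> f q = g q"
  shows "pd C w f p = pd C w g p"
  unfolding pd_def
  by (rule fun_cong[OF frechet_derivative_cong_eventually[OF eventually_agree[OF assms]]])

section \<open>Closure properties of smooth functions\<close>

lemma smooth_near_const [intro]: "smooth_near B (\<lambda>q. k) p"
  unfolding smooth_near_iff_charts by (simp add: comp_def smooth_at_const)

lemma smooth_near_add [intro]:
  "smooth_near B f p \<Longrightarrow> smooth_near B g p \<Longrightarrow> smooth_near B (\<lambda>q. f q + g q) p"
  unfolding smooth_near_iff_charts by (simp add: comp_def smooth_at_add)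

lemma smooth_near_bounded_linear:
  "bounded_linear h \<Longrightarrow> smooth_near B f p \<Longrightarrow> smooth_near B (\<lambda>q. h (f q)) p"
  unfolding smooth_near_iff_charts comp_def
  by (intro ballI, rule smooth_at_bounded_linear[where h = h], simp_all)

lemma smooth_near_bounded_bilinear:
  "bounded_bilinear h \<Longrightarrow> smooth_near B f p \<Longrightarrow> smooth_near B g p \<Longrightarrow> smooth_near B (\<lambda>q. h (f q) (g q)) p"
  unfolding smooth_near_iff_charts comp_def
  by (intro ballI, rule smooth_at_bounded_bilinear[where h = h], simp_all)

lemma smooth_near_scaleR [intro]:
  "smooth_near B f p \<Longrightarrow> smooth_near B g p \<Longrightarrow> smooth_near B (\<lambda>q. f q *\<^sub>R g q) p"
  by (rule smooth_near_bounded_bilinear[OF bounded_bilinear_scaleR])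

lemma smooth_near_mult [intro]:
  "smooth_near B f p \<Longrightarrow> smooth_near B g p \<Longrightarrow> smooth_near B (\<lambda>q. f q * g q :: real) p"
  by (rule smooth_near_bounded_bilinear[OF bounded_bilinear_mult])

lemma smooth_near_minus [intro]:
  "smooth_near B f p \<Longrightarrow> smooth_near B (\<lambda>q. - f q) p"
  by (rule smooth_near_bounded_linear[OF bounded_linear_minus[OF bounded_linear_ident]])

lemma smooth_near_diff [intro]:
  "smooth_near B f p \<Longrightarrow> smooth_near B g p \<Longrightarrow> smooth_near B (\<lambda>q. f q - g q) p"
  using smooth_near_add[of f p "\<lambda>q. - g q"] smooth_near_minus[of g p] by simp

lemma smooth_near_sum [intro]:
  "(\<And>i. i \<in> I \<Longrightarrow> smooth_near B (f i) p) \<Longrightarrow> smooth_near B (\<lambda>q. \<Sum>i\<in>I. f i q) p"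
  unfolding smooth_near_iff_charts by (simp add: comp_def smooth_at_sum)

lemma smooth_near_prod [intro]:
  fixes f :: "'i \<Rightarrow> 'a \<Rightarrow> real"
  shows "(\<And>i. i \<in> I \<Longrightarrow> smooth_near B (f i) p) \<Longrightarrow> smooth_near B (\<lambda>q. \<Prod>i\<in>I. f i q) p"
  by (induction I rule: infinite_finite_induct) auto

lemma smooth_near_divide [intro]:
  fixes f g :: "'a \<Rightarrow> real"
  assumes "smooth_near B f p" "smooth_near B g p" "g p \<noteq> 0"
  shows "smooth_near B (\<lambda>q. f q / g q) p"
proof -
  have "smooth_near B (\<lambda>q. inverse (g q)) p"
    unfolding smooth_near_iff_charts comp_def
  proof
    fix C assume C: "C \<in> charts_at B p"
    show "smooth_at (\<lambda>x. inverse (g (cinv C x))) (cmap C p)"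
      using assms(2,3) C smooth_near_iff[OF C, of g] by (intro smooth_at_inverse) (simp_all add: comp_def)
  qed
  then show ?thesis using smooth_near_mult[OF assms(1)] by (simp add: divide_inverse)
qed

lemma smooth_near_nth [intro]:
  fixes f :: "'a \<Rightarrow> real ^ 'k"
  shows "smooth_near B f p \<Longrightarrow> smooth_near B (\<lambda>q. f q $ i) p"
  by (rule smooth_near_bounded_linear[OF bounded_linear_vec_nth])

lemma smooth_near_vec:
  fixes f :: "'a \<Rightarrow> real ^ 'k"
  shows "(\<And>i. smooth_near B (\<lambda>q. f q $ i) p) \<Longrightarrow> smooth_near B f p"
  unfolding smooth_near_iff_charts by (simp add: comp_def smooth_at_vec)

lemma smooth_near_cmap:
  assumes "C \<in> charts_at B p"
  shows "smooth_near B (cmap C) p"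
  unfolding smooth_near_iff[OF assms]
  by (rule smooth_at_cong[OF smooth_at_ident eventually_mono[OF eventually_chart[OF assms assms]]]) simp

lemma smooth_near_comp:
  fixes F :: "'f::euclidean_space \<Rightarrow> 'b::real_normed_vector"
  assumes "smooth_near B h p" "smooth_at F (h p)"
  shows "smooth_near B (\<lambda>q. F (h q)) p"
  unfolding smooth_near_iff_charts comp_def
proof
  fix C assume C: "C \<in> charts_at B p"
  show "smooth_at (\<lambda>x. F (h (cinv C x))) (cmap C p)"
    using assms C unfolding smooth_near_iff[OF C] comp_def
    by (intro smooth_at_compose[where f = F and g = "\<lambda>x. h (cinv C x)"]) simp_all
qed

lemma smooth_near_frechet_derivative:
  fixes F :: "'f::euclidean_space \<Rightarrow> 'b::real_normed_vector"
  assumes "smooth_near B h p" "smooth_at F (h p)" "smooth_near B k p"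
  shows "smooth_near B (\<lambda>q. frechet_derivative F (at (h q)) (k q)) p"
  unfolding smooth_near_iff_charts comp_def
proof
  fix C assume C: "C \<in> charts_at B p"
  show "smooth_at (\<lambda>x. frechet_derivative F (at (h (cinv C x))) (k (cinv C x))) (cmap C p)"
    using assms C unfolding smooth_near_iff[OF C] comp_def
    by (intro smooth_at_frechet_derivative_vector[where f = F and g = "\<lambda>x. h (cinv C x)"]) simp_all
qed

section \<open>Derivatives in a chart\<close>

lemma has_derivative_pd:
  assumes "C \<in> charts_at B p" "smooth_near B f p"
  shows "((f \<circ> cinv C) has_derivative (\<lambda>w. pd C w f p)) (at (cmap C p))"
  unfolding pd_def using assms smooth_near_iff smooth_at_has_derivative by metis

lemma linear_pd:
  assumes "C \<in> charts_at B p" "smooth_near B f p"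
  shows "linear (\<lambda>w. pd C w f p)"
  using has_derivative_pd[OF assms] has_derivative_linear by blast

lemma pd_const [simp]: "pd C w (\<lambda>q. k) p = 0"
  by (simp add: pd_def comp_def)

lemma pd_bounded_linear:
  assumes "bounded_linear h" "C \<in> charts_at B p" "smooth_near B f p"
  shows "pd C w (\<lambda>q. h (f q)) p = h (pd C w f p)"
  unfolding pd_def[of C w "\<lambda>q. h (f q)"] comp_def
  by (rule frechet_derivative_eqI[OF bounded_linear.has_derivative[OF assms(1)
          has_derivative_pd[OF assms(2,3), unfolded comp_def]]])

lemma pd_bounded_bilinear:
  assumes "bounded_bilinear h" "C \<in> charts_at B p" "smooth_near B f p" "smooth_near B g p"
  shows "pd C w (\<lambda>q. h (f q) (g q)) p = h (f p) (pd C w g p) + h (pd C w f p) (g p)"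
proof -
  note D = bounded_bilinear.FDERIV[OF assms(1)
          has_derivative_pd[OF assms(2,3), unfolded comp_def]
          has_derivative_pd[OF assms(2,4), unfolded comp_def]]
  show ?thesis using frechet_derivative_eqI[OF D] assms(2) unfolding pd_def[of C w "\<lambda>q. h (f q) (g q)"] comp_def
    by simp
qed

lemma pd_add:
  assumes "C \<in> charts_at B p" "smooth_near B f p" "smooth_near B g p"
  shows "pd C w (\<lambda>q. f q + g q) p = pd C w f p + pd C w g p"
  unfolding pd_def[of C w "\<lambda>q. f q + g q"] comp_def
  by (rule frechet_derivative_eqI[OF has_derivative_add[OF
          has_derivative_pd[OF assms(1,2), unfolded comp_def]
          has_derivative_pd[OF assms(1,3), unfolded comp_def]]])

lemma pd_minus:
  assumes "C \<in> charts_at B p" "smooth_near B f p"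
  shows "pd C w (\<lambda>q. - f q) p = - pd C w f p"
  by (rule pd_bounded_linear[OF bounded_linear_minus[OF bounded_linear_ident] assms])

lemma pd_diff:
  assumes "C \<in> charts_at B p" "smooth_near B f p" "smooth_near B g p"
  shows "pd C w (\<lambda>q. f q - g q) p = pd C w f p - pd C w g p"
  using pd_add[OF assms(1,2) smooth_near_minus[OF assms(3)]] pd_minus[OF assms(1,3)] by simp

lemma pd_mult:
  fixes f g :: "'a \<Rightarrow> real"
  assumes "C \<in> charts_at B p" "smooth_near B f p" "smooth_near B g p"
  shows "pd C w (\<lambda>q. f q * g q) p = f p * pd C w g p + pd C w f p * g p"
  by (rule pd_bounded_bilinear[OF bounded_bilinear_mult assms])

lemma pd_cmult:
  fixes f :: "'a \<Rightarrow> real"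
  assumes "C \<in> charts_at B p" "smooth_near B f p"
  shows "pd C w (\<lambda>q. k * f q) p = k * pd C w f p"
  by (rule pd_bounded_linear[OF bounded_linear_mult_right assms])

lemma pd_sum:
  assumes "C \<in> charts_at B p" "\<And>i. i \<in> I \<Longrightarrow> smooth_near B (f i) p"
  shows "pd C w (\<lambda>q. \<Sum>i\<in>I. f i q) p = (\<Sum>i\<in>I. pd C w (f i) p)"
  using assms(2)
  by (induction I rule: infinite_finite_induct) (auto simp: pd_add[OF assms(1)] smooth_near_sum)

lemma smooth_near_pd:
  assumes "C \<in> charts_at B p" "smooth_near B f p"
  shows "smooth_near B (pd C w f) p"
  unfolding smooth_near_iff[OF assms(1)]
proof (rule smooth_at_cong)
  show "smooth_at (\<lambda>x. frechet_derivative (f \<circ> cinv C) (at x) w) (cmap C p)"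
    using assms smooth_near_iff by (blast intro: smooth_at_frechet_derivative)
qed (rule eventually_mono[OF eventually_chart[OF assms(1,1)]], simp add: pd_def)

lemma pd_pd:
  assumes "C \<in> charts_at B p"
  shows "pd C v (pd C w f) p =
    frechet_derivative (\<lambda>x. frechet_derivative (f \<circ> cinv C) (at x) w) (at (cmap C p)) v"
  unfolding pd_def[of C v]
  by (rule fun_cong[OF frechet_derivative_cong_eventually[OF
        eventually_mono[OF eventually_chart[OF assms assms]]]]) (simp add: pd_def)

lemma pd_commute:
  fixes f :: "'a \<Rightarrow> real"
  assumes "C \<in> charts_at B p" "smooth_near B f p"
  shows "pd C v (pd C w f) p = pd C w (pd C v f) p"
  using assms smooth_near_iff[OF assms(1), of f] by (simp add: pd_pd frechet_derivative_commute)

lemma pd_change_chart: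
  assumes "C \<in> charts_at B p" "D \<in> charts_at B p" "smooth_near B f p"
  shows "pd C w f p = pd D (frechet_derivative (transition C D) (at (cmap C p)) w) f p"
proof -
  have "((\<lambda>x. (f \<circ> cinv D) (transition C D x)) has_derivative
    (\<lambda>w. pd D (frechet_derivative (transition C D) (at (cmap C p)) w) f p)) (at (cmap C p))"
    by (rule has_derivative_compose[OF smooth_at_has_derivative[OF smooth_at_transition[OF assms(1,2)]]])
      (simp only: transition_at[OF assms(1)] has_derivative_pd[OF assms(2,3)])
  from frechet_derivative_eqI[OF this]
  show ?thesis unfolding pd_def[of C] frechet_derivative_cong_eventually[OF comp_cinv_change[OF assms(1,2), of f]]
    by simp
qed

lemma pd_cmap:
  assumes "C \<in> charts_at B p"
  shows "pd C w (cmap C) p = w"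
proof -
  have "frechet_derivative (cmap C \<circ> cinv C) (at (cmap C p)) = frechet_derivative (\<lambda>x. x) (at (cmap C p))"
    by (rule frechet_derivative_cong_eventually[OF eventually_mono[OF eventually_chart[OF assms assms]]]) simp
  then show ?thesis by (simp add: pd_def)
qed

text \<open>This is the change of chart for the derivative of the map \<open>cmap F\<close>, because
  that derivative, read in a chart, is the differential of the transition to
  \<open>F\<close>.\<close>

lemma transition_cocycle:
  assumes "C \<in> charts_at B p" "D \<in> charts_at B p" "F \<in> charts_at B p"
  shows "frechet_derivative (transition C F) (at (cmap C p)) w =
    frechet_derivative (transition D F) (at (cmap D p)) (frechet_derivative (transition C D) (at (cmap C p)) w)"
  using pd_change_chart[OF assms(1,2) smooth_near_cmap[OF assms(3)], of w]
  by (simp add: pd_def transition_def)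

lemma linear_transition:
  assumes "C \<in> charts_at B p" "D \<in> charts_at B p"
  shows "linear (frechet_derivative (transition C D) (at (cmap C p)))"
  by (rule linear_frechet_derivative[OF smooth_at_differentiable[OF smooth_at_transition[OF assms]]])

section \<open>Tangent vectors and their components\<close>

lemma tvec_of_in: "tvec_of B C p v \<in> tangent_space B p"
proof (cases "C \<in> charts_at B p")
  case True
  show ?thesis unfolding tangent_space_def mem_Collect_eq
  proof (intro conjI ballI allI impI)
    fix D F assume "D \<in> charts_at B p" "F \<in> charts_at B p"
    then show "tvec_of B C p v F = frechet_derivative (transition D F) (at (cmap D p)) (tvec_of B C p v D)"
      using transition_cocycle[OF True, of D F v] True by (simp add: tvec_of_def)
  qed (simp add: tvec_of_def)
next
  case False
  then show ?thesis unfolding tangent_space_def mem_Collect_eq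
    by (simp add: tvec_of_def linear_0[OF linear_transition])
qed

lemma tvec_of_self [simp]: "C \<in> charts_at B p \<Longrightarrow> tvec_of B C p v C = v"
  by (simp add: tvec_of_def transition_self)

lemma tangent_outside: "v \<in> tangent_space B p \<Longrightarrow> C \<notin> charts_at B p \<Longrightarrow> v C = 0"
  unfolding tangent_space_def by blast

lemma tangent_change:
  assumes "C \<in> charts_at B p" "D \<in> charts_at B p" "v \<in> tangent_space B p"
  shows "v D = frechet_derivative (transition C D) (at (cmap C p)) (v C)"
  using assms unfolding tangent_space_def by blast

lemma tangent_eqI:
  assumes "C \<in> charts_at B p" "v \<in> tangent_space B p" "w \<in> tangent_space B p" "v C = w C"
  shows "v = w"
proof
  fix D show "v D = w D"
  proof (cases "D \<in> charts_at B p")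
    case True
    show ?thesis unfolding tangent_change[OF assms(1) True assms(2)] tangent_change[OF assms(1) True assms(3)] assms(4) ..
  next
    case False
    show ?thesis unfolding tangent_outside[OF assms(2) False] tangent_outside[OF assms(3) False] ..
  qed
qed

lemma tangent_eq_tvec_of:
  assumes "C \<in> charts_at B p" "v \<in> tangent_space B p"
  shows "v = tvec_of B C p (v C)"
  by (rule tangent_eqI[OF assms tvec_of_in]) (simp add: assms(1))

lemma tlin_in:
  assumes "u \<in> tangent_space B p" "v \<in> tangent_space B p"
  shows "tlin r u s v \<in> tangent_space B p"
  unfolding tangent_space_def mem_Collect_eq
proof (intro conjI ballI allI impI)
  fix C D assume C: "C \<in> charts_at B p" "D \<in> charts_at B p"
  show "tlin r u s v D = frechet_derivative (transition C D) (at (cmap C p)) (tlin r u s v C)"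
    by (simp add: tlin_def tangent_change[OF C assms(1)] tangent_change[OF C assms(2)]
        linear_add[OF linear_transition[OF C]] linear_scale[OF linear_transition[OF C]])
qed (simp add: tlin_def tangent_outside[OF assms(1)] tangent_outside[OF assms(2)])

lemma zero_in: "(\<lambda>_. 0) \<in> tangent_space B p"
  by (simp add: tangent_space_def linear_0[OF linear_transition])

lemma tvec_of_linear:
  "tvec_of B C p (r *\<^sub>R u + s *\<^sub>R v) = tlin r (tvec_of B C p u) s (tvec_of B C p v)"
  by (simp add: fun_eq_iff tvec_of_def tlin_def linear_add[OF linear_transition] linear_scale[OF linear_transition])

lemma smooth_near_tvec_of:
  assumes "C \<in> charts_at B p" "D \<in> charts_at B p" "smooth_near B h p"
  shows "smooth_near B (\<lambda>q. tvec_of B C q (h q) D) p"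
proof (rule smooth_near_cong[OF assms(1,2)])
  show "smooth_near B (\<lambda>q. frechet_derivative (transition C D) (at (cmap C q)) (h q)) p"
    by (rule smooth_near_frechet_derivative[OF smooth_near_cmap[OF assms(1)] smooth_at_transition[OF assms(1,2)] assms(3)])
qed (simp add: tvec_of_def)

lemma dir_deriv_change_chart:
  assumes "C \<in> charts_at B p" "D \<in> charts_at B p" "smooth_near B f p" "v \<in> tangent_space B p"
  shows "dir_deriv C f p v = dir_deriv D f p v"
  using pd_change_chart[OF assms(1-3)] tangent_change[OF assms(1,2,4)] by (simp add: dir_deriv_eq_pd)

end

section \<open>The atlas of the slit tangent bundle\<close>

locale manifold_atlas =
  fixes A :: "('m::{t2_space, second_countable_topology}, real ^ 'n) chart set"
  assumes manifold: "connected_smooth_manifold A"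
begin

sublocale base: smooth_atlas A
proof
  fix c d :: "('m, real ^ 'n) chart" assume c: "c \<in> A"
  obtain \<psi> where h: "homeomorphism (cdom c) (cmap c ` cdom c) (cmap c) \<psi>"
    and o: "open (cdom c)" "open (cmap c ` cdom c)"
    using manifold c unfolding connected_smooth_manifold_def by blast
  show "inj_on (cmap c) (cdom c)"
    by (rule inj_on_inverseI[of _ \<psi>]) (use h in \<open>simp add: homeomorphism_def\<close>)
  assume d: "d \<in> A"
  then have "open (cdom d)" using manifold unfolding connected_smooth_manifold_def by blast
  then have "openin (top_of_set (cdom c)) (cdom c \<inter> cdom d)" by (rule openin_open_Int)
  then have "openin (top_of_set (cmap c ` cdom c)) (cmap c ` (cdom c \<inter> cdom d))"
    by (rule homeomorphism_imp_open_map[OF h])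
  then show "open (cmap c ` (cdom c \<inter> cdom d))" using o(2) openin_open_trans by blast
  show "smooth_on (cmap c ` (cdom c \<inter> cdom d)) (transition c d)"
    using manifold c d unfolding connected_smooth_manifold_def by blast
qed

lemma chart_exists: "\<exists>c. c \<in> charts_at A p"
  using manifold unfolding connected_smooth_manifold_def charts_at_def by blast

lemma slitD: "X \<in> slit A \<Longrightarrow> snd X \<in> fibre A X" "X \<in> slit A \<Longrightarrow> snd X \<noteq> (\<lambda>_. 0)"
  by (auto simp: slit_def)

text \<open>A lifted chart evaluates its argument, a function on charts, at \<open>c\<close>;
  testing on a function supported at \<open>c\<close> alone recovers \<open>c\<close>. Hence a
  member of \<open>slit_atlas A\<close> comes from one chart only.\<close>

lemma lift_chart_inject: "lift_chart A c = lift_chart A d \<longleftrightarrow> c = d"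
proof
  assume "lift_chart A c = lift_chart A d"
  then have e: "(\<lambda>X :: ('m, 'n) tpoint. (cmap c (fst X), snd X c)) = (\<lambda>X. (cmap d (fst X), snd X d))"
    unfolding lift_chart_def by (rule Pair_inject)
  have "v c = v d" for v :: "('m, real ^ 'n) tvec" using fun_cong[OF e, of "(undefined, v)"] by simp
  then have "(\<lambda>e. if e = c then axis undefined 1 else 0 :: real ^ 'n) c = (\<lambda>e. if e = c then axis undefined 1 else 0) d"
    .
  then show "c = d" by (auto split: if_splits)
qed simp

lemma lift_chart_at [simp]:
  "lift_chart A c \<in> charts_at (slit_atlas A) X \<longleftrightarrow> X \<in> slit A \<and> c \<in> charts_at A (fst X)"
  unfolding charts_at_def slit_atlas_def by (auto simp: lift_chart_inject) (auto simp: lift_chart_def)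

lemma chart_atE:
  assumes "C \<in> charts_at (slit_atlas A) X"
  obtains c where "C = lift_chart A c" "c \<in> charts_at A (fst X)" "X \<in> slit A"
proof -
  from assms obtain c where "C = lift_chart A c" by (auto simp: charts_at_def slit_atlas_def)
  then show thesis using that assms by simp
qed

lemma snd_chart_nonzero:
  assumes "X \<in> slit A" "c \<in> charts_at A (fst X)"
  shows "snd X c \<noteq> 0"
proof
  assume "snd X c = 0"
  then have "snd X = (\<lambda>_. 0)"
    using assms slitD by (intro base.tangent_eqI[OF assms(2) _ base.zero_in]) auto
  then show False using slitD assms by blast
qed

lemma cmap_lift: "cmap (lift_chart A c) X = (cmap c (fst X), snd X c)"
  by (simp add: lift_chart_def)

lemma tpoint_in_slit:
  assumes "c \<in> charts_at A p" "y \<noteq> 0"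
  shows "(p, tvec_of A c p y) \<in> slit A"
proof -
  have "tvec_of A c p y c \<noteq> 0" using assms by simp
  then have "tvec_of A c p y \<noteq> (\<lambda>_. 0)" by metis
  then show ?thesis unfolding slit_def using base.tvec_of_in by simp
qed

text \<open>Exhibits the chart images of E as products with the complement of 0, hence as open
  sets.\<close>

lemma lift_image:
  assumes "c \<in> A" "d \<in> A"
  shows "cmap (lift_chart A c) ` (cdom (lift_chart A c) \<inter> cdom (lift_chart A d)) =
    (cmap c ` (cdom c \<inter> cdom d)) \<times> (- {0})" (is "?l = ?r")
proof
  show "?l \<subseteq> ?r"
  proof
    fix z assume "z \<in> ?l"
    then obtain X where X: "X \<in> slit A" "fst X \<in> cdom c" "fst X \<in> cdom d" "z = (cmap c (fst X), snd X c)"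
      by (auto simp: lift_chart_def)
    then have "snd X c \<noteq> 0" using snd_chart_nonzero assms by (simp add: charts_at_def)
    then show "z \<in> ?r" using X by auto
  qed
next
  show "?r \<subseteq> ?l"
  proof
    fix z assume z: "z \<in> ?r"
    then obtain p y where p: "p \<in> cdom c" "p \<in> cdom d" "z = (cmap c p, y)" "y \<noteq> 0" by auto
    then have c: "c \<in> charts_at A p" using assms by (simp add: charts_at_def)
    let ?X = "(p, tvec_of A c p y)"
    have "z = cmap (lift_chart A c) ?X" using c p by (simp add: cmap_lift)
    moreover have "?X \<in> cdom (lift_chart A c) \<inter> cdom (lift_chart A d)"
      using tpoint_in_slit[OF c p(4)] p by (simp add: lift_chart_def)
    ultimately show "z \<in> ?l" by blast
  qed
qed

lemma lift_inj: "c \<in> A \<Longrightarrow> inj_on (cmap (lift_chart A c)) (cdom (lift_chart A c))"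
proof (rule inj_onI)
  fix X Y assume c: "c \<in> A" and X: "X \<in> cdom (lift_chart A c)" and Y: "Y \<in> cdom (lift_chart A c)"
    and eq: "cmap (lift_chart A c) X = cmap (lift_chart A c) Y"
  have a: "c \<in> charts_at A (fst X)" "c \<in> charts_at A (fst Y)" "X \<in> slit A" "Y \<in> slit A"
    using c X Y by (auto simp: lift_chart_def charts_at_def)
  have "fst X = fst Y" using eq a base.cinv_cmap unfolding cmap_lift by (metis Pair_inject)
  moreover then have "snd X = snd Y"
    using eq a slitD(1)[of X] slitD(1)[of Y] by (intro base.tangent_eqI[OF a(1)]) (simp_all add: cmap_lift)
  ultimately show "X = Y" by (simp add: prod_eq_iff)
qed

lemma lift_transition:
  assumes "c \<in> A" "d \<in> A" "z \<in> (cmap c ` (cdom c \<inter> cdom d)) \<times> (- {0})"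
  shows "transition (lift_chart A c) (lift_chart A d) z =
    (transition c d (fst z), frechet_derivative (transition c d) (at (fst z)) (snd z))"
proof -
  obtain p y where p: "p \<in> cdom c" "p \<in> cdom d" "z = (cmap c p, y)" "y \<noteq> 0" using assms(3) by auto
  then have c: "c \<in> charts_at A p" "d \<in> charts_at A p" using assms by (auto simp: charts_at_def)
  let ?X = "(p, tvec_of A c p y)"
  have "?X \<in> cdom (lift_chart A c)"
    using tpoint_in_slit[OF c(1) p(4)] p by (simp add: lift_chart_def)
  moreover have "z = cmap (lift_chart A c) ?X" using c p by (simp add: cmap_lift)
  ultimately have "cinv (lift_chart A c) z = ?X" unfolding cinv_def using lift_inj[OF assms(1)] by simp
  then show ?thesis using p c by (simp add: transition_def cmap_lift) (simp add: tvec_of_def transition_def)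
qed

lemma has_derivative_lift_fst:
  assumes "smooth_at f (fst z)"
  shows "((\<lambda>z. f (fst z)) has_derivative (\<lambda>w. frechet_derivative f (at (fst z)) (fst w))) (at z)"
  by (rule has_derivative_compose[where f = fst and g = f and f' = fst])
    (auto intro!: derivative_eq_intros smooth_at_has_derivative[OF assms])

sublocale E: smooth_atlas "slit_atlas A"
proof
  fix C D :: "(('m, 'n) tpoint, (real ^ 'n) \<times> (real ^ 'n)) chart" assume "C \<in> slit_atlas A"
  then obtain c where c: "c \<in> A" "C = lift_chart A c" by (auto simp: slit_atlas_def)
  then show "inj_on (cmap C) (cdom C)" using lift_inj by simp
  assume "D \<in> slit_atlas A"
  then obtain d where d: "d \<in> A" "D = lift_chart A d" by (auto simp: slit_atlas_def)
  have o: "open (cmap c ` (cdom c \<inter> cdom d) \<times> (- {0 :: real ^ 'n}))"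
    using base.opn[OF c(1) d(1)] by (intro open_Times) auto
  then show "open (cmap C ` (cdom C \<inter> cdom D))" using lift_image c d by simp
  let ?\<tau> = "transition c d"
  have "smooth_at (transition C D) z" if z: "z \<in> cmap c ` (cdom c \<inter> cdom d) \<times> - {0}" for z
  proof (rule smooth_at_cong)
    have s: "smooth_at ?\<tau> (fst z)"
      by (rule smooth_on_imp_smooth_at[OF base.smt[OF c(1) d(1)] base.opn[OF c(1) d(1)]]) (use z in auto)
    show "smooth_at (\<lambda>z. (?\<tau> (fst z), frechet_derivative ?\<tau> (at (fst z)) (snd z))) z"
      by (intro smooth_at_Pair smooth_at_compose[where f = ?\<tau> and g = fst]
          smooth_at_frechet_derivative_vector[where f = ?\<tau> and g = fst and h = snd] s
          smooth_at_bounded_linear[OF bounded_linear_fst smooth_at_ident]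
          smooth_at_bounded_linear[OF bounded_linear_snd smooth_at_ident])
    show "\<forall>\<^sub>F x in nhds z. (?\<tau> (fst x), frechet_derivative ?\<tau> (at (fst x)) (snd x)) = transition C D x"
      unfolding eventually_nhds using o z lift_transition c d by metis
  qed
  then show "smooth_on (cmap C ` (cdom C \<inter> cdom D)) (transition C D)"
    unfolding c d lift_image[OF c(1) d(1)] smooth_on_iff_smooth_at[OF o] by blast
qed

text \<open>These are the blocks of the differential that act on projections and on vertical
  vectors. The block with second derivatives of the transition map is left out, because other
  vectors on E are compared through their projection and through \<nabla>y.\<close>

lemma lift_transition_derivative:
  assumes "X \<in> slit A" "c \<in> charts_at A (fst X)" "d \<in> charts_at A (fst X)"
  shows "fst (frechet_derivative (transition (lift_chart A c) (lift_chart A d)) (at (cmap (lift_chart A c) X)) (u, w)) =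
      frechet_derivative (transition c d) (at (cmap c (fst X))) u" (is ?f)
    and "snd (frechet_derivative (transition (lift_chart A c) (lift_chart A d)) (at (cmap (lift_chart A c) X)) (0, w)) =
      frechet_derivative (transition c d) (at (cmap c (fst X))) w" (is ?s)
proof -
  let ?T = "transition (lift_chart A c) (lift_chart A d)" and ?z = "cmap (lift_chart A c) X" and ?\<tau> = "transition c d"
  let ?D = "frechet_derivative ?T (at ?z)"
  have cd: "c \<in> A" "d \<in> A" using assms base.charts_atD by auto
  have o: "open (cmap c ` (cdom c \<inter> cdom d) \<times> (- {0 :: real ^ 'n}))"
    using base.opn[OF cd] by (intro open_Times) auto
  have z: "?z \<in> cmap c ` (cdom c \<inter> cdom d) \<times> (- {0 :: real ^ 'n})"
    using assms snd_chart_nonzero base.charts_atD by (auto simp: cmap_lift)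
  have D: "(?T has_derivative ?D) (at ?z)"
    using assms by (intro smooth_at_has_derivative E.smooth_at_transition) auto
  have s: "smooth_at ?\<tau> (fst ?z)" using assms base.smooth_at_transition by (simp add: cmap_lift)
  have "((\<lambda>z. fst (?T z)) has_derivative (\<lambda>w. fst (?D w))) (at ?z)"
    using D by (rule has_derivative_fst)
  then have "((\<lambda>z. ?\<tau> (fst z)) has_derivative (\<lambda>w. fst (?D w))) (at ?z)"
    by (rule has_derivative_transform_within_open[OF _ o z]) (simp add: lift_transition[OF cd])
  from frechet_derivative_eqI[OF this] frechet_derivative_eqI[OF has_derivative_lift_fst[OF s]]
  show ?f unfolding cmap_lift by (metis fst_conv)
  have "((\<lambda>y. (fst ?z, y)) has_derivative (\<lambda>w. (0, w))) (at (snd ?z))"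
    by (auto intro!: derivative_eq_intros)
  from has_derivative_compose[OF this, of ?T ?D]
  have "((\<lambda>y. ?T (fst ?z, y)) has_derivative (\<lambda>w. ?D (0, w))) (at (snd ?z))" using D by simp
  then have "((\<lambda>y. snd (?T (fst ?z, y))) has_derivative (\<lambda>w. snd (?D (0, w)))) (at (snd ?z))"
    by (rule has_derivative_snd)
  \<comment> \<open>With the base point frozen the transition is linear in y, hence equal to its own
    differential.\<close>
  then have "((\<lambda>y. frechet_derivative ?\<tau> (at (fst ?z)) y) has_derivative (\<lambda>w. snd (?D (0, w)))) (at (snd ?z))"
    by (rule has_derivative_transform_within_open[where s = "- {0}"])
      (use z in \<open>auto simp: lift_transition[OF cd] simp del: base.transition_at\<close>)
  moreover have "bounded_linear (frechet_derivative ?\<tau> (at (fst ?z)))"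
    using smooth_at_has_derivative[OF s] has_derivative_bounded_linear by blast
  ultimately have "frechet_derivative ?\<tau> (at (fst ?z)) w = snd (?D (0, w))"
    using has_derivative_unique[OF bounded_linear_imp_has_derivative] by metis
  then show ?s by (simp add: cmap_lift)
qed

lemma proj_change:
  assumes "X \<in> slit A" "c \<in> charts_at A (fst X)" "d \<in> charts_at A (fst X)" "Z \<in> TE A X"
  shows "fst (Z (lift_chart A d)) = frechet_derivative (transition c d) (at (cmap c (fst X))) (fst (Z (lift_chart A c)))"
  using lift_transition_derivative(1)[OF assms(1-3)]
    E.tangent_change[of "lift_chart A c" X "lift_chart A d" Z] assms
  by (metis lift_chart_at prod.collapse)

lemma vertical_change:
  assumes "X \<in> slit A" "c \<in> charts_at A (fst X)" "d \<in> charts_at A (fst X)" "Z \<in> TE A X"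
    "fst (Z (lift_chart A c)) = 0"
  shows "snd (Z (lift_chart A d)) = frechet_derivative (transition c d) (at (cmap c (fst X))) (snd (Z (lift_chart A c)))"
  using lift_transition_derivative(2)[OF assms(1-3)]
    E.tangent_change[of "lift_chart A c" X "lift_chart A d" Z] assms
  by (metis lift_chart_at prod.collapse)

text \<open>The differential of the bundle projection, which is also the value on Z of the form
  \<open>\<omega> = e\<^sub>a \<omega>\<^sup>a\<close> with values in the pullback bundle.\<close>

definition proj :: "('m, 'n) etvec \<Rightarrow> ('m, real ^ 'n) tvec" where
  "proj Z = (\<lambda>c. fst (Z (lift_chart A c)))"

lemma proj_in:
  assumes "X \<in> slit A" "Z \<in> TE A X"
  shows "proj Z \<in> fibre A X"
  unfolding tangent_space_def mem_Collect_eq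
proof (intro conjI ballI allI impI)
  fix c assume "c \<notin> charts_at A (fst X)"
  then have "Z (lift_chart A c) = 0" using E.tangent_outside[OF assms(2)] by simp
  then show "proj Z c = 0" by (simp add: proj_def)
next
  fix c d assume "c \<in> charts_at A (fst X)" "d \<in> charts_at A (fst X)"
  from proj_change[OF assms(1) this assms(2)]
  show "proj Z d = frechet_derivative (transition c d) (at (cmap c (fst X))) (proj Z c)"
    unfolding proj_def .
qed

lemma vertical_iff:
  assumes "X \<in> slit A" "c \<in> charts_at A (fst X)" "Z \<in> TE A X"
  shows "Z \<in> vertical A X \<longleftrightarrow> fst (Z (lift_chart A c)) = 0"
proof
  assume "Z \<in> vertical A X"
  then show "fst (Z (lift_chart A c)) = 0" using assms(2) by (simp add: vertical_def dx_form_def vec_eq_iff)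
next
  assume z: "fst (Z (lift_chart A c)) = 0"
  have "fst (Z (lift_chart A d)) = 0" if "d \<in> charts_at A (fst X)" for d
    using proj_change[OF assms(1,2) that assms(3)] z linear_0[OF base.linear_transition[OF assms(2) that]] by simp
  then show "Z \<in> vertical A X" using assms(3) by (simp add: vertical_def dx_form_def)
qed

section \<open>Functions from the base, fibre coordinates and partial derivatives\<close>

lemma smooth_near_fst:
  assumes "c \<in> charts_at A (fst X)" "smooth_near A f (fst X)"
  shows "smooth_near (slit_atlas A) (\<lambda>Y. f (fst Y)) X"
  unfolding E.smooth_near_iff_charts
proof
  fix C assume "C \<in> charts_at (slit_atlas A) X"
  then obtain c where c: "C = lift_chart A c" "c \<in> charts_at A (fst X)" "X \<in> slit A" by (rule chart_atE)
  have C: "C \<in> charts_at (slit_atlas A) X" using c by simp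
  have s: "smooth_near (slit_atlas A) (\<lambda>Y. (f \<circ> cinv c) (fst (cmap C Y))) X"
    using c assms(2) base.smooth_near_iff[OF c(2), of f]
    by (intro E.smooth_near_comp[where F = "f \<circ> cinv c"] E.smooth_near_bounded_linear[OF bounded_linear_fst]
        E.smooth_near_cmap[OF C]) (simp add: cmap_lift)
  have "smooth_near (slit_atlas A) (\<lambda>Y. f (fst Y)) X"
    by (rule E.smooth_near_cong[OF C C _ s]) (auto simp: c cmap_lift)
  then show "smooth_at ((\<lambda>Y. f (fst Y)) \<circ> cinv C) (cmap C X)" using E.smooth_near_iff[OF C] by blast
qed

lemma pd_fst:
  assumes "X \<in> slit A" "c \<in> charts_at A (fst X)" "smooth_near A f (fst X)"
  shows "pd (lift_chart A c) (u, w) (\<lambda>Y. f (fst Y)) X = pd c u f (fst X)"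
proof -
  let ?C = "lift_chart A c"
  have C: "?C \<in> charts_at (slit_atlas A) X" using assms by simp
  have s: "smooth_at (f \<circ> cinv c) (fst (cmap ?C X))"
    using assms base.smooth_near_iff[OF assms(2), of f] by (simp add: cmap_lift)
  have "frechet_derivative ((\<lambda>Y. f (fst Y)) \<circ> cinv ?C) (at (cmap ?C X)) =
      frechet_derivative (\<lambda>z. (f \<circ> cinv c) (fst z)) (at (cmap ?C X))"
    by (rule frechet_derivative_cong_eventually[OF eventually_mono[OF E.eventually_chart[OF C C]]])
      (auto simp: cmap_lift, metis base.cinv_cmap fst_conv)
  then show ?thesis using frechet_derivative_eqI[OF has_derivative_lift_fst[OF s], of "(u, w)"]
    by (simp add: pd_def cmap_lift)
qed

lemma smooth_ycoord:
  assumes "X \<in> slit A" "c \<in> charts_at A (fst X)"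
  shows "smooth_near (slit_atlas A) (ycoord c a) X"
proof -
  have "smooth_near (slit_atlas A) (\<lambda>Y. snd (cmap (lift_chart A c) Y) $ a) X"
    by (intro E.smooth_near_nth E.smooth_near_bounded_linear[OF bounded_linear_snd] E.smooth_near_cmap) (simp add: assms)
  then show ?thesis by (simp add: cmap_lift ycoord_def[abs_def])
qed

lemma pd_ycoord:
  assumes "X \<in> slit A" "c \<in> charts_at A (fst X)"
  shows "pd (lift_chart A c) (u, w) (ycoord c a) X = w $ a"
proof -
  have C: "lift_chart A c \<in> charts_at (slit_atlas A) X" using assms by simp
  have bl: "bounded_linear (\<lambda>z :: (real ^ 'n) \<times> (real ^ 'n). snd z $ a)"
    by (rule bounded_linear_compose[OF bounded_linear_vec_nth bounded_linear_snd])
  show ?thesis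
    using E.pd_bounded_linear[OF bl C E.smooth_near_cmap[OF C], of "(u, w)"] E.pd_cmap[OF C]
    by (simp add: cmap_lift ycoord_def[abs_def])
qed

lemma dx_eq_pd: "dx A c a = pd (lift_chart A c) (axis a 1, 0)"
  by (simp add: fun_eq_iff dx_def pd_def)

lemma dy_eq_pd: "dy A c a = pd (lift_chart A c) (0, axis a 1)"
  by (simp add: fun_eq_iff dy_def pd_def)

lemma frame_eq: "frame A c a X = tvec_of A c (fst X) (axis a 1)"
  by (simp add: frame_def tvec_of_def)

lemma vec_axis_expansion: "(v :: real ^ 'k) = (\<Sum>a\<in>UNIV. v $ a *\<^sub>R axis a 1)"
  by (simp add: vec_eq_iff axis_def if_distrib cong: if_cong)

lemma pd_expansion:
  fixes f :: "('m, 'n) tpoint \<Rightarrow> real"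
  assumes "X \<in> slit A" "c \<in> charts_at A (fst X)" "smooth_near (slit_atlas A) f X"
  shows "pd (lift_chart A c) (u, w) f X = (\<Sum>a\<in>UNIV. u $ a * dx A c a f X) + (\<Sum>a\<in>UNIV. w $ a * dy A c a f X)"
proof -
  have C: "lift_chart A c \<in> charts_at (slit_atlas A) X" using assms by simp
  note l = E.linear_pd[OF C assms(3)]
  have "(u, w) = (\<Sum>a\<in>UNIV. u $ a *\<^sub>R (axis a 1, 0)) + (\<Sum>a\<in>UNIV. w $ a *\<^sub>R (0, axis a 1))"
    using vec_axis_expansion[of u] vec_axis_expansion[of w]
    by (simp add: prod_eq_iff fst_sum snd_sum)
  then have "pd (lift_chart A c) (u, w) f X =
      pd (lift_chart A c) ((\<Sum>a\<in>UNIV. u $ a *\<^sub>R (axis a 1, 0)) + (\<Sum>a\<in>UNIV. w $ a *\<^sub>R (0, axis a 1))) f X"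
    by simp
  also have "\<dots> = (\<Sum>a\<in>UNIV. u $ a * dx A c a f X) + (\<Sum>a\<in>UNIV. w $ a * dy A c a f X)"
    by (simp add: linear_add[OF l] linear_sum[OF l] linear_scale[OF l] dx_eq_pd dy_eq_pd del: scaleR_Pair)
  finally show ?thesis .
qed

end

section \<open>Sections and connection forms\<close>

context manifold_atlas
begin

section \<open>Smooth sections of the pullback bundle\<close>

lemma smooth_section_nearI:
  assumes "\<And>Y. Y \<in> slit A \<Longrightarrow> s Y \<in> fibre A Y"
    and "\<And>c. c \<in> charts_at A (fst X) \<Longrightarrow> smooth_near (slit_atlas A) (\<lambda>Y. s Y c) X"
  shows "smooth_section_near A s X"
  using assms by (simp add: smooth_section_near_def)

lemma smooth_section_nearD:
  assumes "smooth_section_near A s X"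
  shows "Y \<in> slit A \<Longrightarrow> s Y \<in> fibre A Y"
    and "c \<in> charts_at A (fst X) \<Longrightarrow> smooth_near (slit_atlas A) (\<lambda>Y. s Y c) X"
    and "c \<in> charts_at A (fst X) \<Longrightarrow> smooth_near (slit_atlas A) (\<lambda>Y. s Y c $ a) X"
  using assms by (auto simp: smooth_section_near_def)

lemma smooth_near_base_tvec:
  assumes "c \<in> charts_at A (fst X)" "d \<in> charts_at A (fst X)"
  shows "smooth_near (slit_atlas A) (\<lambda>Y. tvec_of A c (fst Y) v d) X"
  by (rule smooth_near_fst[OF assms(1), where f = "\<lambda>p. tvec_of A c p v d"])
    (rule base.smooth_near_tvec_of[OF assms base.smooth_near_const])

lemma section_tvec_of:
  assumes "c \<in> charts_at A (fst X)"
  shows "smooth_section_near A (\<lambda>Y. tvec_of A c (fst Y) v) X"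
  by (rule smooth_section_nearI[OF base.tvec_of_in smooth_near_base_tvec[OF assms]])

lemma section_frame:
  "c \<in> charts_at A (fst X) \<Longrightarrow> smooth_section_near A (frame A c a) X"
  using section_tvec_of[of c X "axis a 1"] by (simp add: frame_eq[abs_def])

lemma section_snd:
  assumes "X \<in> slit A"
  shows "smooth_section_near A snd X"
proof (rule smooth_section_nearI)
  fix c assume "c \<in> charts_at A (fst X)"
  then show "smooth_near (slit_atlas A) (\<lambda>Y. snd Y c) X"
    using assms smooth_ycoord by (intro E.smooth_near_vec) (simp add: ycoord_def[abs_def])
qed (rule slitD)

lemma section_tlin:
  assumes "smooth_section_near A s X" "smooth_section_near A t X"
  shows "smooth_section_near A (\<lambda>Y. tlin r (s Y) q (t Y)) X"
proof (rule smooth_section_nearI)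
  show "tlin r (s Y) q (t Y) \<in> fibre A Y" if "Y \<in> slit A" for Y
    using assms that by (intro base.tlin_in smooth_section_nearD)
  show "smooth_near (slit_atlas A) (\<lambda>Y. tlin r (s Y) q (t Y) c) X" if "c \<in> charts_at A (fst X)" for c
    unfolding tlin_def using assms that
    by (intro E.smooth_near_add E.smooth_near_scaleR E.smooth_near_const smooth_section_nearD)
qed

lemma scale_in: "u \<in> fibre A X \<Longrightarrow> (\<lambda>c. r *\<^sub>R u c) \<in> fibre A X"
  using base.tlin_in[of u "fst X" u r 0] by (simp add: tlin_def)

lemma section_scale:
  assumes "smooth_near (slit_atlas A) f X" "smooth_section_near A s X"
  shows "smooth_section_near A (\<lambda>Y c. f Y *\<^sub>R s Y c) X"
proof (rule smooth_section_nearI)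
  show "(\<lambda>c. f Y *\<^sub>R s Y c) \<in> fibre A Y" if "Y \<in> slit A" for Y
    using assms that by (intro scale_in smooth_section_nearD)
  show "smooth_near (slit_atlas A) (\<lambda>Y. f Y *\<^sub>R s Y c) X" if "c \<in> charts_at A (fst X)" for c
    using assms that by (intro E.smooth_near_scaleR smooth_section_nearD)
qed

lemma section_zero: "smooth_section_near A (\<lambda>Y c. 0) X"
  by (rule smooth_section_nearI[OF base.zero_in E.smooth_near_const])

text \<open>
  The functional is local: a section vanishing near \<open>X\<close> is its own multiple by the function which is \<open>0\<close>
  near \<open>X\<close> and \<open>1\<close> elsewhere.
\<close>

lemma tensorial_expansion:
  assumes X: "X \<in> slit A" and c: "c \<in> charts_at A (fst X)"
    and add: "\<And>s t. smooth_section_near A s X \<Longrightarrow> smooth_section_near A t X \<Longrightarrow>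
      \<phi> (\<lambda>Y. tlin 1 (s Y) 1 (t Y)) = \<phi> s + \<phi> t"
    and mult: "\<And>f s. smooth_near (slit_atlas A) f X \<Longrightarrow> smooth_section_near A s X \<Longrightarrow>
      \<phi> (\<lambda>Y d. f Y *\<^sub>R s Y d) = f X * (\<phi> s :: real)"
    and s: "smooth_section_near A s X"
  shows "\<phi> s = (\<Sum>a\<in>UNIV. s X c $ a * \<phi> (frame A c a))"
proof -
  let ?C = "lift_chart A c"
  have C: "?C \<in> charts_at (slit_atlas A) X" using X c by simp
  have zero: "\<phi> w = 0" if w: "smooth_section_near A w X"
    and w0: "\<And>Y. ?C \<in> charts_at (slit_atlas A) Y \<Longrightarrow> w Y = (\<lambda>_. 0)" for w
  proof -
    define f :: "('m, 'n) tpoint \<Rightarrow> real" where "f Y = (if ?C \<in> charts_at (slit_atlas A) Y then 0 else 1)" for Y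
    have "smooth_near (slit_atlas A) f X"
      by (rule E.smooth_near_cong[OF C C _ E.smooth_near_const[of 0]]) (simp add: f_def)
    from mult[OF this w] have "\<phi> (\<lambda>Y d. f Y *\<^sub>R w Y d) = 0" using C by (simp add: f_def)
    moreover have "(\<lambda>Y d. f Y *\<^sub>R w Y d) = w" using w0 by (auto simp: fun_eq_iff f_def)
    ultimately show ?thesis by simp
  qed
  define S where "S I = (\<lambda>Y d. \<Sum>b\<in>I. (s Y c $ b) *\<^sub>R frame A c b Y d)" for I
  have S: "smooth_section_near A (S I) X \<and> \<phi> (S I) = (\<Sum>b\<in>I. s X c $ b * \<phi> (frame A c b))" if "finite I" for I
    using that
  proof induction
    case empty
    have "S {} = (\<lambda>Y d. 0)" by (simp add: S_def)
    then show ?case using section_zero zero[OF section_zero] by simp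
  next
    case (insert b I)
    let ?t = "\<lambda>Y d. (s Y c $ b) *\<^sub>R frame A c b Y d"
    have e: "S (insert b I) = (\<lambda>Y. tlin 1 (?t Y) 1 (S I Y))"
      using insert by (simp add: S_def tlin_def)
    have sm: "smooth_near (slit_atlas A) (\<lambda>Y. s Y c $ b) X" using smooth_section_nearD(3)[OF s c] .
    have t: "smooth_section_near A ?t X" by (rule section_scale[OF sm section_frame[OF c]])
    show ?case unfolding e using insert section_tlin[OF t] add[OF t] mult[OF sm section_frame[OF c]] by simp
  qed
  \<comment> \<open>The frame is extended by zero, so \<open>s\<close> agrees with its frame
    expansion on the chart domain only. The remainder is disposed of by locality.\<close>
  let ?w = "\<lambda>Y. tlin 1 (s Y) (-1) (S UNIV Y)"
  have w: "smooth_section_near A ?w X" using s S by (intro section_tlin) auto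
  have "\<phi> ?w = 0"
  proof (rule zero[OF w])
    fix Y assume "?C \<in> charts_at (slit_atlas A) Y"
    then have Y: "Y \<in> slit A" "c \<in> charts_at A (fst Y)" by auto
    have "S UNIV Y c = s Y c"
      using vec_axis_expansion[of "s Y c"] Y by (simp add: S_def frame_eq)
    moreover have "S UNIV Y \<in> fibre A Y"
    proof -
      have "(\<lambda>d. \<Sum>b\<in>I. (s Y c $ b) *\<^sub>R frame A c b Y d) \<in> fibre A Y" if "finite I" for I
        using that
      proof induction
        case (insert b I)
        have "tlin (s Y c $ b) (frame A c b Y) 1 (\<lambda>d. \<Sum>b\<in>I. (s Y c $ b) *\<^sub>R frame A c b Y d) \<in> fibre A Y"
          using insert by (intro base.tlin_in) (simp_all add: frame_eq base.tvec_of_in)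
        then show ?case using insert by (simp add: tlin_def)
      qed (simp add: base.zero_in)
      then show ?thesis by (simp add: S_def)
    qed
    ultimately show "?w Y = (\<lambda>_. 0)"
      using smooth_section_nearD(1)[OF s Y(1)] Y
      by (intro base.tangent_eqI[OF Y(2) base.tlin_in base.zero_in]) (simp_all add: tlin_def)
  qed
  moreover have "s = (\<lambda>Y. tlin 1 (S UNIV Y) 1 (?w Y))" by (simp add: fun_eq_iff tlin_def)
  ultimately show ?thesis using add[of "S UNIV" ?w] S w by simp
qed

lemma linear_form_expansion:
  assumes "c \<in> charts_at A (fst X)" "linear_form_on (fibre A X) f" "u \<in> fibre A X"
  shows "f u = (\<Sum>a\<in>UNIV. u c $ a * f (frame A c a X))"
proof -
  let ?h = "\<lambda>v. f (tvec_of A c (fst X) v)"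
  have l: "linear ?h"
  proof
    fix b1 b2
    show "?h (b1 + b2) = ?h b1 + ?h b2"
      using base.tvec_of_linear[of c "fst X" 1 b1 1 b2] assms(2) base.tvec_of_in[of c "fst X"]
      by (simp add: linear_form_on_def)
    fix r show "?h (r *\<^sub>R b1) = r *\<^sub>R ?h b1"
      using base.tvec_of_linear[of c "fst X" r b1 0 b1] assms(2) base.tvec_of_in[of c "fst X"]
      by (simp add: linear_form_on_def)
  qed
  have "f u = ?h (u c)" using base.tangent_eq_tvec_of[OF assms(1,3)] by simp
  also have "\<dots> = ?h (\<Sum>a\<in>UNIV. u c $ a *\<^sub>R axis a 1)" using vec_axis_expansion[of "u c"] by simp
  also have "\<dots> = (\<Sum>a\<in>UNIV. u c $ a * f (frame A c a X))"
    by (simp add: linear_sum[OF l] linear_scale[OF l] frame_eq)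
  finally show ?thesis .
qed

section \<open>Coordinate frames and coordinate vector fields\<close>

lemma frame_in: "frame A c a X \<in> fibre A X"
  by (simp add: frame_eq base.tvec_of_in)

lemma frame_self [simp]: "c \<in> charts_at A (fst X) \<Longrightarrow> frame A c a X c = axis a 1"
  by (simp add: frame_eq)

text \<open>The field with constant components \<open>w\<close> in the lifted chart;
  \<open>(axis a 1, 0)\<close> and \<open>(0, axis a 1)\<close> give \<partial>/\<partial>x and
  \<partial>/\<partial>y.\<close>

definition cfield :: "('m, real ^ 'n) chart \<Rightarrow> (real ^ 'n) \<times> (real ^ 'n) \<Rightarrow> ('m, 'n) tpoint \<Rightarrow> ('m, 'n) etvec" where
  "cfield c w X = tvec_of (slit_atlas A) (lift_chart A c) X w"

lemma cfield_in: "cfield c w X \<in> TE A X"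
  by (simp add: cfield_def E.tvec_of_in)

lemma cfield_self [simp]:
  "X \<in> slit A \<Longrightarrow> c \<in> charts_at A (fst X) \<Longrightarrow> cfield c w X (lift_chart A c) = w"
  by (simp add: cfield_def)

lemma eq_cfield:
  "X \<in> slit A \<Longrightarrow> c \<in> charts_at A (fst X) \<Longrightarrow> Z \<in> TE A X \<Longrightarrow> Z = cfield c (Z (lift_chart A c)) X"
  unfolding cfield_def by (rule E.tangent_eq_tvec_of) simp_all

lemma dx_form_cfield [simp]:
  "X \<in> slit A \<Longrightarrow> c \<in> charts_at A (fst X) \<Longrightarrow> dx_form A c a (cfield c w X) = fst w $ a"
  by (simp add: dx_form_def)

lemma dy_form_cfield [simp]:
  "X \<in> slit A \<Longrightarrow> c \<in> charts_at A (fst X) \<Longrightarrow> dy_form A c a (cfield c w X) = snd w $ a"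
  by (simp add: dy_form_def)

lemma dx_form_tlin: "dx_form A c a (tlin r Z q W) = r * dx_form A c a Z + q * dx_form A c a W"
  by (simp add: dx_form_def tlin_def)

end

section \<open>Koszul connections and their connection forms\<close>

locale connection_atlas = manifold_atlas A
  for A :: "('m::{t2_space, second_countable_topology}, real ^ 'n) chart set" +
  fixes nab :: "('m, 'n) connection"
  assumes connection: "finsler_connection A nab"
begin

lemmas connectionD = bspec[OF connection[unfolded finsler_connection_def]]

lemma nab_linear_map:
  "X \<in> slit A \<Longrightarrow> smooth_section_near A s X \<Longrightarrow> linear_map_on (TE A X) (fibre A X) (nab s X)"
  by (rule connectionD[THEN conjunct1, rule_format])

lemma nab_in:
  "X \<in> slit A \<Longrightarrow> smooth_section_near A s X \<Longrightarrow> Z \<in> TE A X \<Longrightarrow> nab s X Z \<in> fibre A X"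
  by (rule nab_linear_map[unfolded linear_map_on_def, THEN conjunct1, rule_format])

lemma nab_tlin:
  "X \<in> slit A \<Longrightarrow> smooth_section_near A s X \<Longrightarrow> Z \<in> TE A X \<Longrightarrow> W \<in> TE A X \<Longrightarrow>
    nab s X (tlin r Z q W) = tlin r (nab s X Z) q (nab s X W)"
  by (rule nab_linear_map[unfolded linear_map_on_def, THEN conjunct2, rule_format])

lemma nab_add:
  "X \<in> slit A \<Longrightarrow> smooth_section_near A s X \<Longrightarrow> smooth_section_near A t X \<Longrightarrow> Z \<in> TE A X \<Longrightarrow>
    nab (\<lambda>Y. tlin 1 (s Y) 1 (t Y)) X Z = tlin 1 (nab s X Z) 1 (nab t X Z)"
  by (rule connectionD[THEN conjunct2, THEN conjunct1, rule_format])

lemma nab_leibniz: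
  assumes "X \<in> slit A" "c \<in> charts_at A (fst X)" "smooth_near (slit_atlas A) f X"
    "smooth_section_near A s X" "Z \<in> TE A X"
  shows "nab (\<lambda>Y c. f Y *\<^sub>R s Y c) X Z =
    tlin (pd (lift_chart A c) (Z (lift_chart A c)) f X) (s X) (f X) (nab s X Z)"
  unfolding dir_deriv_eq_pd[symmetric]
  by (rule connectionD[THEN conjunct2, THEN conjunct2, THEN conjunct1, rule_format]) (simp_all add: assms)

lemma smooth_nab:
  "X \<in> slit A \<Longrightarrow> smooth_section_near A s X \<Longrightarrow> smooth_field_near A Z X \<Longrightarrow> c \<in> charts_at A (fst X) \<Longrightarrow>
    smooth_near (slit_atlas A) (\<lambda>Y. nab s Y (Z Y) c) X"
  by (rule connectionD[THEN conjunct2, THEN conjunct2, THEN conjunct2, rule_format])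

text \<open>The component of \<nabla>s minus the derivative of the component of s is tensorial in s,
  because the two Leibniz terms cancel. It is therefore determined by the frame, whose components
  are constant in the chart.\<close>

lemma nab_component:
  assumes X: "X \<in> slit A" and c: "c \<in> charts_at A (fst X)" and s: "smooth_section_near A s X" and Z: "Z \<in> TE A X"
  shows "nab s X Z c $ a = pd (lift_chart A c) (Z (lift_chart A c)) (\<lambda>Y. s Y c $ a) X +
    (\<Sum>b\<in>UNIV. conn_form A nab c a b X Z * s X c $ b)"
proof -
  let ?C = "lift_chart A c"
  have C: "?C \<in> charts_at (slit_atlas A) X" using X c by simp
  let ?\<phi> = "\<lambda>s. nab s X Z c $ a - pd ?C (Z ?C) (\<lambda>Y. s Y c $ a) X"
  have "?\<phi> s = (\<Sum>b\<in>UNIV. s X c $ b * ?\<phi> (frame A c b))"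
  proof (rule tensorial_expansion[OF X c])
    fix s t assume st: "smooth_section_near A s X" "smooth_section_near A t X"
    show "?\<phi> (\<lambda>Y. tlin 1 (s Y) 1 (t Y)) = ?\<phi> s + ?\<phi> t"
      using E.pd_add[OF C smooth_section_nearD(3)[OF st(1) c] smooth_section_nearD(3)[OF st(2) c]] nab_add[OF X st Z]
      by (simp add: tlin_def)
  next
    fix f :: "('m, 'n) tpoint \<Rightarrow> real" and s assume f: "smooth_near (slit_atlas A) f X" and s: "smooth_section_near A s X"
    show "?\<phi> (\<lambda>Y d. f Y *\<^sub>R s Y d) = f X * ?\<phi> s"
      using E.pd_mult[OF C f smooth_section_nearD(3)[OF s c]] nab_leibniz[OF X c f s Z]
      by (simp add: tlin_def algebra_simps)
  qed (rule s)
  moreover have "?\<phi> (frame A c b) = conn_form A nab c a b X Z" for b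
  proof -
    have "pd ?C (Z ?C) (\<lambda>Y. frame A c b Y c $ a) X = pd ?C (Z ?C) (\<lambda>Y. axis b 1 $ a :: real) X"
      by (rule E.pd_cong[OF C C]) simp
    then show ?thesis by (simp add: conn_form_def)
  qed
  ultimately show ?thesis by (simp add: mult.commute)
qed

lemma omega_bar_eq:
  assumes "X \<in> slit A" "c \<in> charts_at A (fst X)" "Z \<in> TE A X"
  shows "omega_bar nab c a X Z = dy_form A c a Z + (\<Sum>b\<in>UNIV. conn_form A nab c a b X Z * ycoord c b X)"
  unfolding omega_bar_def nab_component[OF assms(1,2) section_snd[OF assms(1)] assms(3)]
  using pd_ycoord[OF assms(1,2), of "fst (Z (lift_chart A c))" "snd (Z (lift_chart A c))" a]
  by (simp add: ycoord_def[abs_def] dy_form_def)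

lemma conn_form_tlin:
  assumes "X \<in> slit A" "c \<in> charts_at A (fst X)" "Z \<in> TE A X" "W \<in> TE A X"
  shows "conn_form A nab c a b X (tlin r Z q W) = r * conn_form A nab c a b X Z + q * conn_form A nab c a b X W"
  unfolding conn_form_def nab_tlin[OF assms(1) section_frame[OF assms(2)] assms(3,4)] by (simp add: tlin_def)

lemma omega_bar_tlin:
  assumes "X \<in> slit A" "Z \<in> TE A X" "W \<in> TE A X"
  shows "omega_bar nab c a X (tlin r Z q W) = r * omega_bar nab c a X Z + q * omega_bar nab c a X W"
  unfolding omega_bar_def nab_tlin[OF assms(1) section_snd[OF assms(1)] assms(2,3)] by (simp add: tlin_def)

lemma smooth_conn_form:
  assumes "X \<in> slit A" "c \<in> charts_at A (fst X)" "smooth_field_near A Z X"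
  shows "smooth_near (slit_atlas A) (\<lambda>Y. conn_form A nab c a b Y (Z Y)) X"
  unfolding conn_form_def
  by (rule E.smooth_near_nth[OF smooth_nab[OF assms(1) section_frame[OF assms(2)] assms(3,2)]])

lemma smooth_omega_bar:
  assumes "X \<in> slit A" "c \<in> charts_at A (fst X)" "smooth_field_near A Z X"
  shows "smooth_near (slit_atlas A) (\<lambda>Y. omega_bar nab c a Y (Z Y)) X"
  unfolding omega_bar_def
  by (rule E.smooth_near_nth[OF smooth_nab[OF assms(1) section_snd[OF assms(1)] assms(3,2)]])

end

section \<open>Tensors, metrics and the canonical torsion\<close>

lemma linear_axis_expansion:
  fixes f :: "real ^ 'k \<Rightarrow> real"
  assumes "linear f"
  shows "f v = (\<Sum>a\<in>UNIV. v $ a * f (axis a 1))"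
proof -
  have "f v = f (\<Sum>a\<in>UNIV. v $ a *\<^sub>R axis a 1)"
    by (rule arg_cong[of _ _ f]) (simp add: vec_eq_iff axis_def if_distrib cong: if_cong)
  then show ?thesis by (simp add: linear_sum[OF assms] linear_scale[OF assms])
qed

lemma matrix_inv_entries:
  fixes G :: "real ^ 'n ^ 'n"
  assumes "invertible G"
  shows "(\<Sum>b\<in>UNIV. G $ a $ b * matrix_inv G $ b $ d) = (if a = d then 1 else 0)"
    and "(\<Sum>b\<in>UNIV. matrix_inv G $ a $ b * G $ b $ d) = (if a = d then 1 else 0)"
proof -
  have "\<exists>A'. G ** A' = mat 1 \<and> A' ** G = mat 1" using assms by (simp add: invertible_def)
  then have i: "G ** matrix_inv G = mat 1" "matrix_inv G ** G = mat 1"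
    unfolding matrix_inv_def using someI_ex[of "\<lambda>A'. G ** A' = mat 1 \<and> A' ** G = mat 1"] by simp_all
  from arg_cong[OF i(1), of "\<lambda>M. M $ a $ d"] arg_cong[OF i(2), of "\<lambda>M. M $ a $ d"]
  show "(\<Sum>b\<in>UNIV. G $ a $ b * matrix_inv G $ b $ d) = (if a = d then 1 else 0)"
    and "(\<Sum>b\<in>UNIV. matrix_inv G $ a $ b * G $ b $ d) = (if a = d then 1 else 0)"
    by (simp_all add: matrix_matrix_mult_def mat_def)
qed

text \<open>Presents the inverse metric as a quotient of polynomials in the metric, from which its
  smoothness follows.\<close>

lemma matrix_inv_cramer:
  fixes G :: "real ^ 'n ^ 'n"
  assumes "invertible G"
  shows "matrix_inv G $ k $ d = det (\<chi> i j. if j = k then axis d 1 $ i else G $ i $ j) / det G"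
proof -
  have "det G \<noteq> 0" using assms invertible_det_nz by blast
  moreover have "G *v (\<chi> b. matrix_inv G $ b $ d) = axis d 1"
    using matrix_inv_entries(1)[OF assms] by (simp add: vec_eq_iff matrix_vector_mult_def axis_def)
  ultimately have "(\<chi> b. matrix_inv G $ b $ d) = (\<chi> k. det (\<chi> i j. if j = k then axis d 1 $ i else G $ i $ j) / det G)"
    using cramer by blast
  then show ?thesis by (simp add: vec_eq_iff)
qed

lemma (in smooth_atlas) smooth_near_det:
  fixes M :: "'a \<Rightarrow> real ^ 'n ^ 'n"
  assumes "\<And>i j. smooth_near B (\<lambda>q. M q $ i $ j) p"
  shows "smooth_near B (\<lambda>q. det (M q)) p"
  unfolding det_def
  by (intro smooth_near_sum smooth_near_mult smooth_near_const smooth_near_prod assms)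

section \<open>Covariant tensors with three slots\<close>

context manifold_atlas
begin

text \<open>Independence of the chart is demanded of the values of the trilinear form, not as a
  transformation law of its components. It can then be verified by exhibiting an invariant
  expression for these values.\<close>

lemma tensor3_of_components:
  assumes smooth: "\<And>X c a b e. X \<in> slit A \<Longrightarrow> c \<in> charts_at A (fst X) \<Longrightarrow> smooth_near (slit_atlas A) (k c a b e) X"
    and change: "\<And>X c d u v w. X \<in> slit A \<Longrightarrow> c \<in> charts_at A (fst X) \<Longrightarrow> d \<in> charts_at A (fst X) \<Longrightarrow>
      u \<in> fibre A X \<Longrightarrow> v \<in> fibre A X \<Longrightarrow> w \<in> fibre A X \<Longrightarrow>
      (\<Sum>a\<in>UNIV. \<Sum>b\<in>UNIV. \<Sum>e\<in>UNIV. u c $ a * v c $ b * w c $ e * k c a b e X) =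
      (\<Sum>a\<in>UNIV. \<Sum>b\<in>UNIV. \<Sum>e\<in>UNIV. u d $ a * v d $ b * w d $ e * k d a b e X)"
  obtains K where "pullback_tensor3 A K"
    and "\<And>X c a b e. X \<in> slit A \<Longrightarrow> c \<in> charts_at A (fst X) \<Longrightarrow> tcomp A K c a b e X = k c a b e X"
proof -
  define S where "S c X u v w = (\<Sum>a\<in>UNIV. \<Sum>b\<in>UNIV. \<Sum>e\<in>UNIV. u c $ a * v c $ b * w c $ e * k c a b e X)"
    for c X and u v w :: "('m, real ^ 'n) tvec"
  define K where "K X u v w = S (SOME c. c \<in> charts_at A (fst X)) X u v w" for X u v w
  have S: "K X u v w = S c X u v w"
    if "X \<in> slit A" "c \<in> charts_at A (fst X)" "u \<in> fibre A X" "v \<in> fibre A X" "w \<in> fibre A X" for X c u v w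
    unfolding K_def S_def by (rule change) (use that in \<open>auto intro: someI\<close>)
  have comp: "tcomp A K c a b e X = k c a b e X" if X: "X \<in> slit A" "c \<in> charts_at A (fst X)" for X c a b e
  proof -
    have "tcomp A K c a b e X = S c X (frame A c a X) (frame A c b X) (frame A c e X)"
      unfolding tcomp_def by (rule S[OF X frame_in frame_in frame_in])
    also have "\<dots> = k c a b e X"
      unfolding S_def frame_self[OF X(2)] axis_def mult.assoc sum_distrib_left[symmetric]
      by (simp add: if_distrib[of "\<lambda>z. z * _"] if_distrib[of "sum _"] cong: if_cong)
    finally show ?thesis .
  qed
  have "pullback_tensor3 A K" unfolding pullback_tensor3_def
  proof (intro ballI conjI allI)
    fix X u v assume X: "X \<in> slit A" and uv: "u \<in> fibre A X" "v \<in> fibre A X"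
    obtain c where c: "c \<in> charts_at A (fst X)" using chart_exists by blast
    note S' = S[OF X c]
    show "linear_form_on (fibre A X) (K X u v)"
      unfolding linear_form_on_def by (intro ballI allI)
        (simp add: S' uv base.tlin_in, simp add: S_def tlin_def algebra_simps sum.distrib sum_distrib_left)
    show "linear_form_on (fibre A X) (\<lambda>w. K X u w v)"
      unfolding linear_form_on_def by (intro ballI allI)
        (simp add: S' uv base.tlin_in, simp add: S_def tlin_def algebra_simps sum.distrib sum_distrib_left)
    show "linear_form_on (fibre A X) (\<lambda>w. K X w u v)"
      unfolding linear_form_on_def by (intro ballI allI)
        (simp add: S' uv base.tlin_in, simp add: S_def tlin_def algebra_simps sum.distrib sum_distrib_left)
  next
    fix X c a b e assume X: "X \<in> slit A" and c: "c \<in> charts_at A (fst X)"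
    then have C: "lift_chart A c \<in> charts_at (slit_atlas A) X" by simp
    show "smooth_near (slit_atlas A) (tcomp A K c a b e) X"
      by (rule E.smooth_near_cong[OF C C _ smooth[OF X c, of a b e]]) (simp add: comp)
  qed
  then show thesis using that comp by blast
qed

lemma tensor3_linear:
  assumes "pullback_tensor3 A K" "X \<in> slit A" "u \<in> fibre A X" "v \<in> fibre A X"
  shows "linear_form_on (fibre A X) (\<lambda>w. K X u v w)" "linear_form_on (fibre A X) (\<lambda>w. K X u w v)"
    "linear_form_on (fibre A X) (\<lambda>w. K X w u v)"
  using assms unfolding pullback_tensor3_def by auto

lemma tensor3_expansion:
  assumes K: "pullback_tensor3 A K" and X: "X \<in> slit A" and c: "c \<in> charts_at A (fst X)"
    and "u \<in> fibre A X" "v \<in> fibre A X" "w \<in> fibre A X"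
  shows "K X u v w = (\<Sum>a\<in>UNIV. \<Sum>b\<in>UNIV. \<Sum>e\<in>UNIV. u c $ a * v c $ b * w c $ e * tcomp A K c a b e X)"
proof -
  have 1: "K X u v w = (\<Sum>a\<in>UNIV. u c $ a * K X (frame A c a X) v w)"
    by (rule linear_form_expansion[OF c tensor3_linear(3)[OF K X]]) fact+
  have 2: "K X (frame A c a X) v w = (\<Sum>b\<in>UNIV. v c $ b * K X (frame A c a X) (frame A c b X) w)" for a
    by (rule linear_form_expansion[OF c tensor3_linear(2)[OF K X frame_in]]) fact+
  have 3: "K X (frame A c a X) (frame A c b X) w = (\<Sum>e\<in>UNIV. w c $ e * tcomp A K c a b e X)" for a b
    unfolding tcomp_def by (rule linear_form_expansion[OF c tensor3_linear(1)[OF K X frame_in frame_in]]) fact+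
  show ?thesis by (simp only: 1 2 3 sum_distrib_left mult.assoc)
qed

lemma smooth_tcomp:
  assumes "pullback_tensor3 A K" "X \<in> slit A" "c \<in> charts_at A (fst X)"
  shows "smooth_near (slit_atlas A) (tcomp A K c a b e) X"
  using assms unfolding pullback_tensor3_def by blast

lemma smooth_tensor3:
  assumes K: "pullback_tensor3 A K" and X: "X \<in> slit A"
    and s: "smooth_section_near A s X" "smooth_section_near A t X" "smooth_section_near A r X"
  shows "smooth_near (slit_atlas A) (\<lambda>Y. K Y (s Y) (t Y) (r Y)) X"
proof -
  obtain c where c: "c \<in> charts_at A (fst X)" using chart_exists by blast
  then have C: "lift_chart A c \<in> charts_at (slit_atlas A) X" using X by simp
  have "smooth_near (slit_atlas A) (\<lambda>Y. \<Sum>a\<in>UNIV. \<Sum>b\<in>UNIV. \<Sum>e\<in>UNIV. s Y c $ a * t Y c $ b * r Y c $ e * tcomp A K c a b e Y) X"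
    by (intro E.smooth_near_sum E.smooth_near_mult smooth_tcomp[OF K X c] smooth_section_nearD(3)[OF _ c] s)
  then show ?thesis
  proof (rule E.smooth_near_cong[OF C C, rotated])
    fix Y assume "lift_chart A c \<in> charts_at (slit_atlas A) Y"
    then show "(\<Sum>a\<in>UNIV. \<Sum>b\<in>UNIV. \<Sum>e\<in>UNIV. s Y c $ a * t Y c $ b * r Y c $ e * tcomp A K c a b e Y) = K Y (s Y) (t Y) (r Y)"
      using tensor3_expansion[OF K, of Y c "s Y" "t Y" "r Y"] smooth_section_nearD(1)[OF s(1), of Y]
        smooth_section_nearD(1)[OF s(2), of Y] smooth_section_nearD(1)[OF s(3), of Y] by simp
  qed
qed

end

section \<open>The metric: raising and lowering indices\<close>

locale metric_atlas = manifold_atlas A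
  for A :: "('m::{t2_space, second_countable_topology}, real ^ 'n) chart set" +
  fixes g :: "('m, 'n) cotensor2"
  assumes metric: "pullback_metric A g"
begin

lemma g_linear: "X \<in> slit A \<Longrightarrow> u \<in> fibre A X \<Longrightarrow> linear_form_on (fibre A X) (g X u)"
  using metric unfolding pullback_metric_def by blast

lemma g_sym: "X \<in> slit A \<Longrightarrow> u \<in> fibre A X \<Longrightarrow> v \<in> fibre A X \<Longrightarrow> g X u v = g X v u"
  using metric unfolding pullback_metric_def by blast

lemma g_linear': 
  assumes "X \<in> slit A" "u \<in> fibre A X"
  shows "linear_form_on (fibre A X) (\<lambda>v. g X v u)"
  using g_linear[OF assms] g_sym[OF assms(1)] assms(2) base.tlin_in
  by (simp add: linear_form_on_def)

lemma smooth_gcomp: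
  "X \<in> slit A \<Longrightarrow> c \<in> charts_at A (fst X) \<Longrightarrow> smooth_near (slit_atlas A) (gcomp A g c a b) X"
  using metric unfolding pullback_metric_def by blast

lemma gcomp_sym: "X \<in> slit A \<Longrightarrow> gcomp A g c a b X = gcomp A g c b a X"
  unfolding gcomp_def by (rule g_sym[OF _ frame_in frame_in])

lemma g_expansion:
  assumes "X \<in> slit A" "c \<in> charts_at A (fst X)" "u \<in> fibre A X" "v \<in> fibre A X"
  shows "g X u v = (\<Sum>a\<in>UNIV. \<Sum>b\<in>UNIV. u c $ a * v c $ b * gcomp A g c a b X)"
proof -
  have "g X u v = (\<Sum>a\<in>UNIV. u c $ a * g X (frame A c a X) v)"
    by (rule linear_form_expansion[OF assms(2) g_linear'[OF assms(1,4)] assms(3)])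
  also have "\<dots> = (\<Sum>a\<in>UNIV. u c $ a * (\<Sum>b\<in>UNIV. v c $ b * gcomp A g c a b X))"
    unfolding gcomp_def
    by (intro sum.cong refl arg_cong[of _ _ "\<lambda>z. _ * z"] linear_form_expansion[OF assms(2) g_linear[OF assms(1) frame_in] assms(4)])
  finally show ?thesis by (simp add: sum_distrib_left mult.assoc)
qed

lemma smooth_metric:
  assumes X: "X \<in> slit A" and s: "smooth_section_near A s X" "smooth_section_near A t X"
  shows "smooth_near (slit_atlas A) (\<lambda>Y. g Y (s Y) (t Y)) X"
proof -
  obtain c where c: "c \<in> charts_at A (fst X)" using chart_exists by blast
  then have C: "lift_chart A c \<in> charts_at (slit_atlas A) X" using X by simp
  have "smooth_near (slit_atlas A) (\<lambda>Y. \<Sum>a\<in>UNIV. \<Sum>b\<in>UNIV. s Y c $ a * t Y c $ b * gcomp A g c a b Y) X"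
    by (intro E.smooth_near_sum E.smooth_near_mult smooth_gcomp[OF X c] smooth_section_nearD(3)[OF _ c] s)
  then show ?thesis
  proof (rule E.smooth_near_cong[OF C C, rotated])
    fix Y assume "lift_chart A c \<in> charts_at (slit_atlas A) Y"
    then show "(\<Sum>a\<in>UNIV. \<Sum>b\<in>UNIV. s Y c $ a * t Y c $ b * gcomp A g c a b Y) = g Y (s Y) (t Y)"
      using g_expansion[of Y c "s Y" "t Y"] smooth_section_nearD(1)[OF s(1), of Y] smooth_section_nearD(1)[OF s(2), of Y] by simp
  qed
qed

lemma invertible_gcomp:
  assumes "X \<in> slit A" "c \<in> charts_at A (fst X)"
  shows "invertible (\<chi> i j. gcomp A g c i j X)" (is "invertible ?G")
proof -
  have "v = 0" if v: "?G *v v = 0" for v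
  proof -
    let ?u = "tvec_of A c (fst X) v"
    have "g X ?u w = 0" if w: "w \<in> fibre A X" for w
    proof -
      have "g X ?u w = g X w ?u" using g_sym assms w base.tvec_of_in by blast
      also have "\<dots> = (\<Sum>a\<in>UNIV. w c $ a * (?G *v v) $ a)"
        using assms(2) by (simp add: g_expansion[OF assms w base.tvec_of_in] matrix_vector_mult_def sum_distrib_left mult_ac)
      finally show ?thesis using v by simp
    qed
    then have "?u = (\<lambda>_. 0)" using metric assms(1) base.tvec_of_in unfolding pullback_metric_def by blast
    then have "?u c = 0" by simp
    then show "v = 0" using assms(2) by simp
  qed
  then show ?thesis using matrix_left_invertible_ker invertible_left_inverse by blast
qed

lemma ginv_right:
  assumes "X \<in> slit A" "c \<in> charts_at A (fst X)"
  shows "(\<Sum>b\<in>UNIV. gcomp A g c a b X * ginv A g c b d X) = (if a = d then 1 else 0)"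
  using matrix_inv_entries(1)[OF invertible_gcomp[OF assms]] by (simp add: ginv_def)

lemma ginv_left:
  assumes "X \<in> slit A" "c \<in> charts_at A (fst X)"
  shows "(\<Sum>b\<in>UNIV. ginv A g c a b X * gcomp A g c b d X) = (if a = d then 1 else 0)"
  using matrix_inv_entries(2)[OF invertible_gcomp[OF assms]] by (simp add: ginv_def)

lemma lower_raise:
  assumes "X \<in> slit A" "c \<in> charts_at A (fst X)"
  shows "(\<Sum>b\<in>UNIV. gcomp A g c a b X * (\<Sum>d\<in>UNIV. ginv A g c b d X * h d)) = h a"
proof -
  have "(\<Sum>b\<in>UNIV. gcomp A g c a b X * (\<Sum>d\<in>UNIV. ginv A g c b d X * h d)) =
      (\<Sum>d\<in>UNIV. \<Sum>b\<in>UNIV. gcomp A g c a b X * ginv A g c b d X * h d)"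
    by (subst sum.swap) (simp add: sum_distrib_left mult.assoc)
  also have "\<dots> = (\<Sum>d\<in>UNIV. (if a = d then 1 else 0) * h d)"
    by (simp only: sum_distrib_right[symmetric] ginv_right[OF assms])
  finally show ?thesis by (simp add: if_distrib[of "\<lambda>z. z * _"] cong: if_cong)
qed

lemma raise_lower:
  assumes "X \<in> slit A" "c \<in> charts_at A (fst X)"
  shows "(\<Sum>b\<in>UNIV. ginv A g c a b X * (\<Sum>d\<in>UNIV. gcomp A g c b d X * h d)) = h a"
proof -
  have "(\<Sum>b\<in>UNIV. ginv A g c a b X * (\<Sum>d\<in>UNIV. gcomp A g c b d X * h d)) =
      (\<Sum>d\<in>UNIV. \<Sum>b\<in>UNIV. ginv A g c a b X * gcomp A g c b d X * h d)"
    by (subst sum.swap) (simp add: sum_distrib_left mult.assoc)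
  also have "\<dots> = (\<Sum>d\<in>UNIV. (if a = d then 1 else 0) * h d)"
    by (simp only: sum_distrib_right[symmetric] ginv_left[OF assms])
  finally show ?thesis by (simp add: if_distrib[of "\<lambda>z. z * _"] cong: if_cong)
qed

lemma lower_inject:
  assumes "X \<in> slit A" "c \<in> charts_at A (fst X)"
    and "\<And>a. (\<Sum>d\<in>UNIV. gcomp A g c a d X * h d) = (\<Sum>d\<in>UNIV. gcomp A g c a d X * k d)"
  shows "h a = k a"
  using raise_lower[OF assms(1,2), of a h] raise_lower[OF assms(1,2), of a k] assms(3) by simp

lemma smooth_ginv:
  assumes X: "X \<in> slit A" and c: "c \<in> charts_at A (fst X)"
  shows "smooth_near (slit_atlas A) (ginv A g c a b) X"
proof -
  have C: "lift_chart A c \<in> charts_at (slit_atlas A) X" using X c by simp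
  have "smooth_near (slit_atlas A) (\<lambda>Y. det (\<chi> i j. if j = a then axis b 1 $ i else gcomp A g c i j Y) / det (\<chi> i j. gcomp A g c i j Y)) X"
  proof (intro E.smooth_near_divide E.smooth_near_det)
    show "smooth_near (slit_atlas A) (\<lambda>Y. (\<chi> i j. if j = a then axis b 1 $ i else gcomp A g c i j Y) $ i $ j) X" for i j
      using smooth_gcomp[OF X c, of i j] by (cases "j = a") (simp_all add: E.smooth_near_const)
    show "smooth_near (slit_atlas A) (\<lambda>Y. (\<chi> i j. gcomp A g c i j Y) $ i $ j) X" for i j
      using smooth_gcomp[OF X c, of i j] by simp
    show "det (\<chi> i j. gcomp A g c i j X) \<noteq> 0" using invertible_gcomp[OF X c] invertible_det_nz by blast
  qed
  then show ?thesis
  proof (rule E.smooth_near_cong[OF C C, rotated])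
    fix Y assume "lift_chart A c \<in> charts_at (slit_atlas A) Y"
    then have Y: "Y \<in> slit A" "c \<in> charts_at A (fst Y)" by auto
    show "det (\<chi> i j. if j = a then axis b 1 $ i else gcomp A g c i j Y) / det (\<chi> i j. gcomp A g c i j Y) = ginv A g c a b Y"
      unfolding ginv_def matrix_inv_cramer[OF invertible_gcomp[OF Y]]
      by (intro arg_cong2[of _ _ _ _ "(/)"] arg_cong[of _ _ det]) (simp_all add: vec_eq_iff)
  qed
qed

end

section \<open>Covariant differentiation, one slot at a time\<close>

context connection_atlas
begin

text \<open>The Leibniz term from differentiating h(s) cancels that of \<nabla>s, so the left side
  is tensorial in \<open>s\<close>. The linear form \<open>m\<close> makes room for the terms in
  which \<nabla> acts on the other slots of a tensor.\<close>

lemma covariant_slot: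
  assumes X: "X \<in> slit A" and c: "c \<in> charts_at A (fst X)" and Z: "Z \<in> TE A X"
    and h: "\<And>Y. Y \<in> slit A \<Longrightarrow> linear_form_on (fibre A Y) (h Y)"
    and m: "linear_form_on (fibre A X) m"
    and smooth: "\<And>s. smooth_section_near A s X \<Longrightarrow> smooth_near (slit_atlas A) (\<lambda>Y. h Y (s Y)) X"
    and s: "smooth_section_near A s X"
  shows "pd (lift_chart A c) (Z (lift_chart A c)) (\<lambda>Y. h Y (s Y)) X - h X (nab s X Z) - m (s X) =
    (\<Sum>a\<in>UNIV. s X c $ a * (pd (lift_chart A c) (Z (lift_chart A c)) (\<lambda>Y. h Y (frame A c a Y)) X
       - h X (nab (frame A c a) X Z) - m (frame A c a X)))"
    (is "?\<phi> s = _")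
proof (rule tensorial_expansion[OF X c _ _ s])
  let ?C = "lift_chart A c"
  have C: "?C \<in> charts_at (slit_atlas A) X" using X c by simp
  have hl: "h Y (tlin r u q v) = r * h Y u + q * h Y v" if "Y \<in> slit A" "u \<in> fibre A Y" "v \<in> fibre A Y" for Y r u q v
    using h[OF that(1)] that unfolding linear_form_on_def by blast
  have ml: "m (tlin r u q v) = r * m u + q * m v" if "u \<in> fibre A X" "v \<in> fibre A X" for r u q v
    using m that unfolding linear_form_on_def by blast
  fix s t assume st: "smooth_section_near A s X" "smooth_section_near A t X"
  have "pd ?C (Z ?C) (\<lambda>Y. h Y (tlin 1 (s Y) 1 (t Y))) X = pd ?C (Z ?C) (\<lambda>Y. h Y (s Y) + h Y (t Y)) X"
    by (rule E.pd_cong[OF C C]) (simp add: hl smooth_section_nearD(1)[OF st(1)] smooth_section_nearD(1)[OF st(2)])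
  then show "?\<phi> (\<lambda>Y. tlin 1 (s Y) 1 (t Y)) = ?\<phi> s + ?\<phi> t"
    by (simp add: E.pd_add[OF C smooth[OF st(1)] smooth[OF st(2)]] nab_add[OF X st Z]
        hl[OF X nab_in[OF X st(1) Z] nab_in[OF X st(2) Z]]
        ml[OF smooth_section_nearD(1)[OF st(1) X] smooth_section_nearD(1)[OF st(2) X]])
next
  let ?C = "lift_chart A c"
  have C: "?C \<in> charts_at (slit_atlas A) X" using X c by simp
  have hl: "h Y (tlin r u q v) = r * h Y u + q * h Y v" if "Y \<in> slit A" "u \<in> fibre A Y" "v \<in> fibre A Y" for Y r u q v
    using h[OF that(1)] that unfolding linear_form_on_def by blast
  have hs: "h Y (\<lambda>d. r *\<^sub>R u d) = r * h Y u" if "Y \<in> slit A" "u \<in> fibre A Y" for Y r u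
    using hl[OF that that(2), of r 0] by (simp add: tlin_def)
  have ms: "m (\<lambda>d. r *\<^sub>R u d) = r * m u" if "u \<in> fibre A X" for r u
  proof -
    have "m (tlin r u 0 u) = r * m u + 0 * m u" using m that unfolding linear_form_on_def by blast
    then show ?thesis by (simp add: tlin_def)
  qed
  fix f :: "('m, 'n) tpoint \<Rightarrow> real" and s
  assume f: "smooth_near (slit_atlas A) f X" and s: "smooth_section_near A s X"
  have "pd ?C (Z ?C) (\<lambda>Y. h Y (\<lambda>d. f Y *\<^sub>R s Y d)) X = pd ?C (Z ?C) (\<lambda>Y. f Y * h Y (s Y)) X"
    by (rule E.pd_cong[OF C C]) (simp add: hs smooth_section_nearD(1)[OF s])
  then show "?\<phi> (\<lambda>Y d. f Y *\<^sub>R s Y d) = f X * ?\<phi> s"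
    by (simp add: E.pd_mult[OF C f smooth[OF s]] nab_leibniz[OF X c f s Z]
        hl[OF X smooth_section_nearD(1)[OF s X] nab_in[OF X s Z]]
        ms[OF smooth_section_nearD(1)[OF s X]] algebra_simps)
qed

end

section \<open>The derivative of the metric and the canonical torsion\<close>

locale finsler = metric_atlas A g + connection_atlas A nab
  for A :: "('m::{t2_space, second_countable_topology}, real ^ 'n) chart set"
    and g :: "('m, 'n) cotensor2" and nab :: "('m, 'n) connection"
begin

definition olow :: "('m, real ^ 'n) chart \<Rightarrow> 'n \<Rightarrow> 'n \<Rightarrow> ('m, 'n) tpoint \<Rightarrow> ('m, 'n) etvec \<Rightarrow> real" where
  "olow c a b X Z = (\<Sum>e\<in>UNIV. gcomp A g c a e X * conn_form A nab c e b X Z)"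

lemma Dg_eq:
  assumes "X \<in> slit A"
  shows "Dg A g nab c a b X Z = pd (lift_chart A c) (Z (lift_chart A c)) (gcomp A g c a b) X - olow c b a X Z - olow c a b X Z"
  unfolding Dg_def olow_def dir_deriv_eq_pd
  by (simp add: gcomp_sym[OF assms, of c _ b] mult.commute)

lemma g_nab_frame:
  assumes "X \<in> slit A" "c \<in> charts_at A (fst X)" "Z \<in> TE A X"
  shows "g X (nab (frame A c a) X Z) (frame A c b X) = olow c b a X Z"
    and "g X (frame A c a X) (nab (frame A c b) X Z) = olow c a b X Z"
proof -
  note n = nab_in[OF assms(1) section_frame[OF assms(2)] assms(3)]
  show "g X (nab (frame A c a) X Z) (frame A c b X) = olow c b a X Z"
    using linear_form_expansion[OF assms(2) g_linear'[OF assms(1) frame_in] n]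
    by (simp add: olow_def conn_form_def gcomp_def mult.commute g_sym[OF assms(1) frame_in frame_in, of c b])
  show "g X (frame A c a X) (nab (frame A c b) X Z) = olow c a b X Z"
    using linear_form_expansion[OF assms(2) g_linear[OF assms(1) frame_in] n]
    by (simp add: olow_def conn_form_def gcomp_def mult.commute)
qed

text \<open>The left side is the Koszul form of the covariant derivative of g. A chart enters it
  only through the directional derivative of a function, and this exhibits the array
  \<open>Dg\<close> as a tensor.\<close>

lemma Dg_expansion:
  assumes X: "X \<in> slit A" and c: "c \<in> charts_at A (fst X)" and Z: "Z \<in> TE A X"
    and s: "smooth_section_near A s X" and t: "smooth_section_near A t X"
  shows "pd (lift_chart A c) (Z (lift_chart A c)) (\<lambda>Y. g Y (s Y) (t Y)) X - g X (nab s X Z) (t X) - g X (s X) (nab t X Z) =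
    (\<Sum>a\<in>UNIV. \<Sum>b\<in>UNIV. s X c $ a * t X c $ b * Dg A g nab c a b X Z)" (is "?l s t = _")
proof -
  note tY = smooth_section_nearD(1)[OF t]
  have slot2: "?l (frame A c a) t = (\<Sum>b\<in>UNIV. t X c $ b * Dg A g nab c a b X Z)" for a
  proof -
    have "pd (lift_chart A c) (Z (lift_chart A c)) (\<lambda>Y. g Y (frame A c a Y) (t Y)) X
        - g X (frame A c a X) (nab t X Z) - g X (nab (frame A c a) X Z) (t X) =
      (\<Sum>b\<in>UNIV. t X c $ b * (pd (lift_chart A c) (Z (lift_chart A c)) (\<lambda>Y. g Y (frame A c a Y) (frame A c b Y)) X
        - g X (frame A c a X) (nab (frame A c b) X Z) - g X (nab (frame A c a) X Z) (frame A c b X)))"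
      by (rule covariant_slot[OF X c Z, where h = "\<lambda>Y u. g Y (frame A c a Y) u" and m = "\<lambda>u. g X (nab (frame A c a) X Z) u"])
        (rule g_linear[OF _ frame_in] g_linear[OF X nab_in[OF X section_frame[OF c] Z]]
          smooth_metric[OF X section_frame[OF c]] t | assumption)+
    then show ?thesis
      unfolding Dg_eq[OF X] g_nab_frame[OF X c Z] gcomp_def[abs_def] by (simp add: algebra_simps)
  qed
  have "?l s t = (\<Sum>a\<in>UNIV. s X c $ a * ?l (frame A c a) t)"
    by (rule covariant_slot[OF X c Z, where h = "\<lambda>Y u. g Y u (t Y)" and m = "\<lambda>u. g X u (nab t X Z)"])
      (auto intro!: g_linear' tY smooth_metric X t s nab_in Z)
  also have "\<dots> = (\<Sum>a\<in>UNIV. s X c $ a * (\<Sum>b\<in>UNIV. t X c $ b * Dg A g nab c a b X Z))"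
    by (simp only: slot2)
  finally show ?thesis by (simp add: sum_distrib_left mult.assoc)
qed

text \<open>Extend \<open>u\<close> and \<open>v\<close> to sections with constant components in
  \<open>c\<close>; the invariant expression in \<open>Dg_expansion\<close> then has the same value
  in both charts.\<close>

lemma Dg_change:
  assumes X: "X \<in> slit A" and c: "c \<in> charts_at A (fst X)" and d: "d \<in> charts_at A (fst X)" and Z: "Z \<in> TE A X"
    and u: "u \<in> fibre A X" and v: "v \<in> fibre A X"
  shows "(\<Sum>a\<in>UNIV. \<Sum>b\<in>UNIV. u c $ a * v c $ b * Dg A g nab c a b X Z) =
    (\<Sum>a\<in>UNIV. \<Sum>b\<in>UNIV. u d $ a * v d $ b * Dg A g nab d a b X Z)"
proof -
  let ?s = "\<lambda>w Y. tvec_of A c (fst Y) (w c)"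
  note s = section_tvec_of[OF c]
  have e: "?s u X = u" "?s v X = v" using base.tangent_eq_tvec_of[OF c] u v by auto
  have "pd (lift_chart A c) (Z (lift_chart A c)) (\<lambda>Y. g Y (?s u Y) (?s v Y)) X =
      pd (lift_chart A d) (Z (lift_chart A d)) (\<lambda>Y. g Y (?s u Y) (?s v Y)) X"
    unfolding dir_deriv_eq_pd[symmetric]
    by (rule E.dir_deriv_change_chart) (simp_all add: X c d Z smooth_metric[OF X s s])
  then show ?thesis
    using Dg_expansion[OF X c Z s s, of "u c" "v c"] Dg_expansion[OF X d Z s s, of "u c" "v c"] by (simp add: e)
qed

text \<open>The forms multiplying \<open>\<omega>\<^sup>b\<close> in
  \<open>2 \<Psi>\<^sub>a\<close>. Twice the torsion contributes
  \<open>2 \<omega>\<^sub>a\<^sub>b\<close>, and \<open>Dg\<close> contributes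
  \<open>dg\<^sub>a\<^sub>b\<close> and takes
  \<open>\<omega>\<^sub>a\<^sub>b + \<omega>\<^sub>b\<^sub>a\<close> away; the factor 1/2 in \<Psi>
  is tuned to leave the antisymmetric part.\<close>

definition Alow :: "('m, real ^ 'n) chart \<Rightarrow> 'n \<Rightarrow> 'n \<Rightarrow> ('m, 'n) tpoint \<Rightarrow> ('m, 'n) etvec \<Rightarrow> real" where
  "Alow c a b X Z = pd (lift_chart A c) (Z (lift_chart A c)) (gcomp A g c a b) X + olow c a b X Z - olow c b a X Z"

definition Psi_low :: "('m, real ^ 'n) chart \<Rightarrow> 'n \<Rightarrow> ('m, 'n) tpoint \<Rightarrow> ('m, 'n) etvec \<Rightarrow> ('m, 'n) etvec \<Rightarrow> real" where
  "Psi_low c a X Z1 Z2 = (\<Sum>r\<in>UNIV. gcomp A g c a r X * Psi A g nab c r X Z1 Z2)"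

text \<open>
  Only the antisymmetric part of \<open>\<omega>\<^sub>a\<^sub>b\<close> enters, so that a symmetric \<open>W\<^sub>a\<^sub>b\<close> does not change \<open>\<Psi>\<close>.
\<close>

lemma Psi_low_eq:
  assumes "X \<in> slit A" "c \<in> charts_at A (fst X)"
  shows "2 * Psi_low c a X Z1 Z2 =
    (\<Sum>b\<in>UNIV. Alow c a b X Z1 * dx_form A c b Z2) - (\<Sum>b\<in>UNIV. Alow c a b X Z2 * dx_form A c b Z1)"
proof -
  let ?g = "\<lambda>a b. gcomp A g c a b X"
  let ?w = "\<lambda>\<alpha> b. wedge11 \<alpha> (dx_form A c b) Z1 Z2"
  have T: "(\<Sum>r\<in>UNIV. ?g a r * torsion A nab c r X Z1 Z2) = (\<Sum>b\<in>UNIV. ?w (olow c a b X) b)"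
  proof -
    have "(\<Sum>r\<in>UNIV. ?g a r * torsion A nab c r X Z1 Z2) =
        (\<Sum>b\<in>UNIV. \<Sum>r\<in>UNIV. ?g a r * ?w (conn_form A nab c r b X) b)"
      unfolding torsion_def sum_distrib_left by (rule sum.swap)
    also have "\<dots> = (\<Sum>b\<in>UNIV. ?w (olow c a b X) b)"
      by (intro sum.cong refl) (simp add: olow_def wedge11_def sum_distrib_right sum_subtractf[symmetric] right_diff_distrib mult.assoc)
    finally show ?thesis .
  qed
  have D: "(\<Sum>r\<in>UNIV. ?g a r * (\<Sum>s\<in>UNIV. \<Sum>b\<in>UNIV. ginv A g c r s X * ?w (Dg A g nab c s b X) b)) =
      (\<Sum>b\<in>UNIV. ?w (Dg A g nab c a b X) b)"
    unfolding sum_distrib_left[symmetric, of "ginv A g c _ _ X"] by (rule lower_raise[OF assms])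
  have "2 * Psi_low c a X Z1 Z2 = (\<Sum>b\<in>UNIV. 2 * ?w (olow c a b X) b + ?w (Dg A g nab c a b X) b)"
  proof -
    have "Psi_low c a X Z1 Z2 = (\<Sum>r\<in>UNIV. ?g a r * torsion A nab c r X Z1 Z2) +
        (\<Sum>r\<in>UNIV. 1/2 * (?g a r * (\<Sum>s\<in>UNIV. \<Sum>b\<in>UNIV. ginv A g c r s X * ?w (Dg A g nab c s b X) b)))"
      unfolding Psi_low_def Psi_def distrib_left sum.distrib by (simp only: mult.left_commute)
    then have "Psi_low c a X Z1 Z2 = (\<Sum>b\<in>UNIV. ?w (olow c a b X) b) + 1/2 * (\<Sum>b\<in>UNIV. ?w (Dg A g nab c a b X) b)"
      unfolding sum_distrib_left[symmetric, of "1/2"] T D by simp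
    then show ?thesis by (simp add: sum.distrib sum_distrib_left[symmetric])
  qed
  also have "\<dots> = (\<Sum>b\<in>UNIV. Alow c a b X Z1 * dx_form A c b Z2 - Alow c a b X Z2 * dx_form A c b Z1)"
    by (intro sum.cong refl) (simp add: wedge11_def Dg_eq[OF assms(1)] Alow_def algebra_simps)
  finally show ?thesis by (simp add: sum_subtractf)
qed

text \<open>The coframe \<theta> is left open because (\<beta>) wedges with the forms dx and
  (\<delta>) with the components of \<nabla>y.\<close>

lemma wedge21_lower:
  assumes "X \<in> slit A"
  shows "(\<Sum>a\<in>UNIV. \<Sum>b\<in>UNIV. gcomp A g c a b X * wedge21 (Psi A g nab c a X) (\<theta> b) Z1 Z2 Z3) =
    (\<Sum>b\<in>UNIV. Psi_low c b X Z1 Z2 * \<theta> b Z3 + Psi_low c b X Z2 Z3 * \<theta> b Z1 + Psi_low c b X Z3 Z1 * \<theta> b Z2)"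
proof -
  have "(\<Sum>a\<in>UNIV. gcomp A g c a b X * wedge21 (Psi A g nab c a X) (\<theta> b) Z1 Z2 Z3) =
    Psi_low c b X Z1 Z2 * \<theta> b Z3 + Psi_low c b X Z2 Z3 * \<theta> b Z1 + Psi_low c b X Z3 Z1 * \<theta> b Z2" for b
    unfolding Psi_low_def sum_distrib_right sum.distrib[symmetric]
    by (intro sum.cong refl) (simp add: wedge21_def gcomp_sym[OF assms, of c b] algebra_simps)
  then show ?thesis by (subst sum.swap) simp
qed

lemma cond_gamma_lower:
  assumes "X \<in> slit A"
  shows "(\<Sum>a\<in>UNIV. \<Sum>b\<in>UNIV. ycoord c b X * gcomp A g c a b X * Psi A g nab c a X Z1 Z2) =
    (\<Sum>b\<in>UNIV. ycoord c b X * Psi_low c b X Z1 Z2)"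
proof -
  have "(\<Sum>a\<in>UNIV. ycoord c b X * gcomp A g c a b X * Psi A g nab c a X Z1 Z2) = ycoord c b X * Psi_low c b X Z1 Z2" for b
    unfolding Psi_low_def sum_distrib_left
    by (intro sum.cong refl) (simp add: gcomp_sym[OF assms, of c b])
  then show ?thesis by (subst sum.swap) simp
qed

end

lemma sum_axis [simp]:
  fixes h :: "'k::finite \<Rightarrow> real"
  shows "(\<Sum>b\<in>UNIV. h b * axis i 1 $ b) = h i" "(\<Sum>b\<in>UNIV. axis i 1 $ b * h b) = h i"
  by (simp_all add: axis_def if_distrib[of "\<lambda>z. z * _"] if_distrib[of "\<lambda>z. _ * z"] cong: if_cong)

context metric_atlas
begin

lemma pd_gcomp_sym:
  assumes "X \<in> slit A" "c \<in> charts_at A (fst X)"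
  shows "pd (lift_chart A c) w (gcomp A g c a b) X = pd (lift_chart A c) w (gcomp A g c b a) X"
  using assms by (intro E.pd_cong[of "lift_chart A c" X "lift_chart A c"] gcomp_sym) auto

end

section \<open>Consequences of (\<beta>) and (\<gamma>), and invariance of the conditions\<close>

context finsler
begin

text \<open>Evaluate (\<beta>) on Z and two coordinate fields. Since dx vanishes on Z, one term
  drops out and the other two say that \<open>Alow\<close> is symmetric on Z; its metric part is
  symmetric anyway, so its antisymmetric part vanishes.\<close>

lemma vertical_olow_sym:
  assumes beta: "cond_beta A g nab" and X: "X \<in> slit A" and c: "c \<in> charts_at A (fst X)"
    and Z: "Z \<in> TE A X" "fst (Z (lift_chart A c)) = 0"
  shows "olow c a b X Z = olow c b a X Z"
proof -
  let ?e = "\<lambda>i. cfield c (axis i 1, 0) X"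
  have dx: "dx_form A c i Z = 0" for i using Z(2) by (simp add: dx_form_def)
  have "(\<Sum>i\<in>UNIV. Psi_low c i X Z (?e b) * axis a 1 $ i + Psi_low c i X (?e a) Z * axis b 1 $ i) = 0"
    using beta[unfolded cond_beta_def, rule_format, OF X c Z(1) cfield_in[of c "(axis b 1, 0)"] cfield_in[of c "(axis a 1, 0)"]]
    by (simp add: wedge21_lower[OF X] dx X c)
  then have "Psi_low c a X Z (?e b) + Psi_low c b X (?e a) Z = 0" by (simp add: sum.distrib)
  moreover have "2 * Psi_low c a X Z (?e b) = Alow c a b X Z" "2 * Psi_low c b X (?e a) Z = - Alow c b a X Z"
    by (simp_all add: Psi_low_eq[OF X c] X c dx)
  ultimately show ?thesis using pd_gcomp_sym[OF X c] by (simp add: Alow_def)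
qed

lemma vertical_derivative_transverse:
  assumes beta: "cond_beta A g nab" and gamma: "cond_gamma A g nab"
    and X: "X \<in> slit A" and c: "c \<in> charts_at A (fst X)"
  shows "(\<Sum>b\<in>UNIV. ycoord c b X * pd (lift_chart A c) (0, w) (gcomp A g c b i) X) = 0"
proof -
  let ?Z = "cfield c (0, w) X" and ?e = "cfield c (axis i 1, 0) X"
  \<comment> \<open>For a vertical vector paired with a coordinate field, the connection forms
    cancel by symmetry and only the derivative of the metric is left.\<close>
  have "2 * Psi_low c b X ?Z ?e = pd (lift_chart A c) (0, w) (gcomp A g c b i) X" for b
    using vertical_olow_sym[OF beta X c cfield_in[of c "(0, w)"], where a = b and b = i] X c
    by (simp add: Psi_low_eq[OF X c] Alow_def)
  then have "(\<Sum>b\<in>UNIV. ycoord c b X * pd (lift_chart A c) (0, w) (gcomp A g c b i) X) =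
      2 * (\<Sum>b\<in>UNIV. ycoord c b X * Psi_low c b X ?Z ?e)"
    unfolding sum_distrib_left by (intro sum.cong refl) (simp only: mult.left_commute[of 2])
  then show ?thesis
    using gamma[unfolded cond_gamma_def, rule_format, OF X c cfield_in cfield_in] by (simp add: cond_gamma_lower[OF X])
qed

lemma invariance:
  assumes "finsler_connection A nab'"
    and diff: "\<And>X c Z a b. X \<in> slit A \<Longrightarrow> c \<in> charts_at A (fst X) \<Longrightarrow> Z \<in> TE A X \<Longrightarrow>
      conn_form A nab' c a b X Z = conn_form A nab c a b X Z + w c a b X Z"
    and sym: "\<And>X c Z a b. X \<in> slit A \<Longrightarrow> c \<in> charts_at A (fst X) \<Longrightarrow> Z \<in> TE A X \<Longrightarrow>
      (\<Sum>d\<in>UNIV. gcomp A g c a d X * w c d b X Z) = (\<Sum>d\<in>UNIV. gcomp A g c b d X * w c d a X Z)"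
    and transverse: "\<And>X c Z a. X \<in> slit A \<Longrightarrow> c \<in> charts_at A (fst X) \<Longrightarrow> Z \<in> TE A X \<Longrightarrow>
      (\<Sum>b\<in>UNIV. (\<Sum>d\<in>UNIV. gcomp A g c a d X * w c d b X Z) * ycoord c b X) = 0"
  shows "X \<in> slit A \<Longrightarrow> Z \<in> TE A X \<Longrightarrow> nab' snd X Z = nab snd X Z"
    and "regular A nab' \<longleftrightarrow> regular A nab" and "cond_beta A g nab' \<longleftrightarrow> cond_beta A g nab"
    and "cond_gamma A g nab' \<longleftrightarrow> cond_gamma A g nab" and "cond_delta A g nab' \<longleftrightarrow> cond_delta A g nab"
    and "cond_epsilon A g nab' \<longleftrightarrow> cond_epsilon A g nab"
proof -
  interpret N: finsler A g nab' by unfold_locales fact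
  let ?W = "\<lambda>c a b X Z. \<Sum>d\<in>UNIV. gcomp A g c a d X * w c d b X Z"
  have olow: "N.olow c a b X Z = olow c a b X Z + ?W c a b X Z"
    if "X \<in> slit A" "c \<in> charts_at A (fst X)" "Z \<in> TE A X" for X c Z a b
    unfolding N.olow_def olow_def sum.distrib[symmetric] using diff[OF that] by (simp add: algebra_simps)
  have Alow: "N.Alow c a b X Z = Alow c a b X Z"
    if "X \<in> slit A" "c \<in> charts_at A (fst X)" "Z \<in> TE A X" for X c Z a b
    unfolding N.Alow_def Alow_def using olow[OF that] sym[OF that] by simp
  have Psi: "N.Psi_low c a X Z1 Z2 = Psi_low c a X Z1 Z2"
    if "X \<in> slit A" "c \<in> charts_at A (fst X)" "Z1 \<in> TE A X" "Z2 \<in> TE A X" for X c Z1 Z2 a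
    using N.Psi_low_eq[OF that(1,2), of a Z1 Z2] Psi_low_eq[OF that(1,2), of a Z1 Z2] Alow that by simp
  \<comment> \<open>Transversality is assumed with the first index lowered; non-degeneracy raises it
    again, and in this form it leaves \<nabla>y unchanged.\<close>
  have wy: "(\<Sum>b\<in>UNIV. w c a b X Z * ycoord c b X) = 0"
    if "X \<in> slit A" "c \<in> charts_at A (fst X)" "Z \<in> TE A X" for X c Z a
  proof (rule lower_inject[OF that(1,2), where k = "\<lambda>_. 0"])
    fix a
    have "(\<Sum>d\<in>UNIV. gcomp A g c a d X * (\<Sum>b\<in>UNIV. w c d b X Z * ycoord c b X)) =
        (\<Sum>b\<in>UNIV. ?W c a b X Z * ycoord c b X)"
      unfolding sum_distrib_left sum_distrib_right by (subst sum.swap) (simp add: mult.assoc)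
    then show "(\<Sum>d\<in>UNIV. gcomp A g c a d X * (\<Sum>b\<in>UNIV. w c d b X Z * ycoord c b X)) = (\<Sum>d\<in>UNIV. gcomp A g c a d X * 0)"
      using transverse[OF that] by simp
  qed
  have bar: "omega_bar nab' c a X Z = omega_bar nab c a X Z"
    if "X \<in> slit A" "c \<in> charts_at A (fst X)" "Z \<in> TE A X" for X c Z a
    using wy[OF that] diff[OF that]
    by (simp add: N.omega_bar_eq[OF that] omega_bar_eq[OF that] algebra_simps sum.distrib)
  have snd: "nab' snd X Z = nab snd X Z" if "X \<in> slit A" "Z \<in> TE A X" for X Z
  proof -
    obtain c where c: "c \<in> charts_at A (fst X)" using chart_exists by blast
    show ?thesis
      by (rule base.tangent_eqI[OF c N.nab_in[OF that(1) section_snd[OF that(1)] that(2)] nab_in[OF that(1) section_snd[OF that(1)] that(2)]])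
        (use bar[OF that(1) c that(2)] in \<open>simp add: vec_eq_iff omega_bar_def\<close>)
  qed
  show "X \<in> slit A \<Longrightarrow> Z \<in> TE A X \<Longrightarrow> nab' snd X Z = nab snd X Z" by (rule snd)
  have "inj_on (nab' snd X) (vertical A X) \<longleftrightarrow> inj_on (nab snd X) (vertical A X)" if "X \<in> slit A" for X
    using snd[OF that] by (intro inj_on_cong) (auto simp: vertical_def)
  then show "regular A nab' \<longleftrightarrow> regular A nab" unfolding regular_def by simp
  show "cond_beta A g nab' \<longleftrightarrow> cond_beta A g nab"
    unfolding cond_beta_def by (simp add: wedge21_lower N.wedge21_lower Psi cong: ball_cong)
  show "cond_gamma A g nab' \<longleftrightarrow> cond_gamma A g nab"
    unfolding cond_gamma_def by (simp add: cond_gamma_lower N.cond_gamma_lower Psi cong: ball_cong)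
  show "cond_delta A g nab' \<longleftrightarrow> cond_delta A g nab"
    unfolding cond_delta_def by (simp add: wedge21_lower N.wedge21_lower Psi bar cong: ball_cong)
  have "(\<Sum>a\<in>UNIV. ycoord c a X * Dg A g nab' c a b X Z) = (\<Sum>a\<in>UNIV. ycoord c a X * Dg A g nab c a b X Z)"
    if "X \<in> slit A" "c \<in> charts_at A (fst X)" "Z \<in> TE A X" for X c Z b
  proof -
    \<comment> \<open>Both connection terms of \<open>Dg\<close> change by the same amount, by
      symmetry of the lowered form.\<close>
    have "Dg A g nab' c a b X Z = Dg A g nab c a b X Z - 2 * ?W c b a X Z" for a
      using sym[OF that] by (simp add: N.Dg_eq[OF that(1)] Dg_eq[OF that(1)] olow[OF that])
    moreover have "(\<Sum>a\<in>UNIV. y a * (D a - 2 * U a)) = (\<Sum>a\<in>UNIV. y a * D a) - 2 * (\<Sum>a\<in>UNIV. U a * y a)"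
      for y D U :: "'n \<Rightarrow> real"
      by (simp add: right_diff_distrib sum_subtractf sum_distrib_left mult_ac)
    ultimately show ?thesis using transverse[OF that] by simp
  qed
  then show "cond_epsilon A g nab' \<longleftrightarrow> cond_epsilon A g nab"
    unfolding cond_epsilon_def by (simp cong: ball_cong)
qed

end

section \<open>The Lagrangian\<close>

text \<open>
  The hypothesis \<open>y\<^sup>a \<partial>g\<^sub>a\<^sub>b/\<partial>y\<^sup>k = 0\<close> is the integrability condition which makes \<open>g\<close> a vertical Hessian.
\<close>

locale hessian_metric = metric_atlas A g
  for A :: "('m::{t2_space, second_countable_topology}, real ^ 'n) chart set" and g :: "('m, 'n) cotensor2" +
  assumes dy_transverse: "X \<in> slit A \<Longrightarrow> c \<in> charts_at A (fst X) \<Longrightarrow>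
    (\<Sum>b\<in>UNIV. ycoord c b X * dy A c k (gcomp A g c b i) X) = 0"
begin

abbreviation "L \<equiv> half_energy g"

lemma lift_at: "X \<in> slit A \<Longrightarrow> c \<in> charts_at A (fst X) \<Longrightarrow> lift_chart A c \<in> charts_at (slit_atlas A) X"
  by simp

lemma pd_cong_chart:
  assumes "X \<in> slit A" "c \<in> charts_at A (fst X)"
    and "\<And>Y. Y \<in> slit A \<Longrightarrow> c \<in> charts_at A (fst Y) \<Longrightarrow> f Y = h Y"
  shows "pd (lift_chart A c) w f X = pd (lift_chart A c) w h X"
  by (rule E.pd_cong[OF lift_at[OF assms(1,2)] lift_at[OF assms(1,2)]]) (simp add: assms(3))

lemma smooth_cong_chart:
  assumes "X \<in> slit A" "c \<in> charts_at A (fst X)"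
    and "\<And>Y. Y \<in> slit A \<Longrightarrow> c \<in> charts_at A (fst Y) \<Longrightarrow> f Y = h Y" "smooth_near (slit_atlas A) f X"
  shows "smooth_near (slit_atlas A) h X"
  by (rule E.smooth_near_cong[OF lift_at[OF assms(1,2)] lift_at[OF assms(1,2)] _ assms(4)]) (simp add: assms(3))

lemma smooth_dx: "X \<in> slit A \<Longrightarrow> c \<in> charts_at A (fst X) \<Longrightarrow> smooth_near (slit_atlas A) f X \<Longrightarrow>
    smooth_near (slit_atlas A) (dx A c k f) X"
  unfolding dx_eq_pd by (rule E.smooth_near_pd[OF lift_at])

lemma smooth_dy: "X \<in> slit A \<Longrightarrow> c \<in> charts_at A (fst X) \<Longrightarrow> smooth_near (slit_atlas A) f X \<Longrightarrow>
    smooth_near (slit_atlas A) (dy A c k f) X"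
  unfolding dy_eq_pd by (rule E.smooth_near_pd[OF lift_at])

lemmas smooth_rules = smooth_dx smooth_dy smooth_gcomp smooth_ginv smooth_ycoord E.smooth_near_sum E.smooth_near_mult
  E.smooth_near_const E.smooth_near_add E.smooth_near_diff

lemma gcomp_chart_sym: "X \<in> slit A \<Longrightarrow> c \<in> charts_at A (fst X) \<Longrightarrow> dx A c k (gcomp A g c a b) X = dx A c k (gcomp A g c b a) X"
  "X \<in> slit A \<Longrightarrow> c \<in> charts_at A (fst X) \<Longrightarrow> dy A c k (gcomp A g c a b) X = dy A c k (gcomp A g c b a) X"
  unfolding dx_eq_pd dy_eq_pd by (rule pd_gcomp_sym; assumption)+

lemma half_energy_eq:
  assumes "X \<in> slit A" "c \<in> charts_at A (fst X)"
  shows "L X = 1/2 * (\<Sum>a\<in>UNIV. \<Sum>b\<in>UNIV. ycoord c a X * ycoord c b X * gcomp A g c a b X)"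
  unfolding half_energy_def ycoord_def using g_expansion[OF assms] slitD(1)[OF assms(1)] by simp

lemma smooth_half_energy:
  assumes "X \<in> slit A"
  shows "smooth_near (slit_atlas A) L X"
proof -
  obtain c where c: "c \<in> charts_at A (fst X)" using chart_exists by blast
  show ?thesis
    by (rule smooth_cong_chart[OF assms c half_energy_eq[symmetric]]) (assumption | intro smooth_rules assms c)+
qed

text \<open>Treats x and y derivatives together. The two factors y contribute equal terms because
  the metric is symmetric, and these absorb the factor 1/2.\<close>

lemma pd_half_energy:
  assumes X: "X \<in> slit A" and c: "c \<in> charts_at A (fst X)"
  shows "pd (lift_chart A c) (u, w) L X =
    1/2 * (\<Sum>a\<in>UNIV. \<Sum>b\<in>UNIV. ycoord c a X * ycoord c b X * pd (lift_chart A c) (u, w) (gcomp A g c a b) X) +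
    (\<Sum>a\<in>UNIV. \<Sum>b\<in>UNIV. w $ a * ycoord c b X * gcomp A g c a b X)"
proof -
  let ?C = "lift_chart A c"
  note C = lift_at[OF X c]
  note sm = smooth_ycoord[OF X c] smooth_gcomp[OF X c] E.smooth_near_sum E.smooth_near_mult
  have "pd ?C (u, w) L X = pd ?C (u, w) (\<lambda>X. 1/2 * (\<Sum>a\<in>UNIV. \<Sum>b\<in>UNIV. ycoord c a X * ycoord c b X * gcomp A g c a b X)) X"
    by (rule pd_cong_chart[OF X c half_energy_eq])
  also have "\<dots> = 1/2 * (\<Sum>a\<in>UNIV. \<Sum>b\<in>UNIV. ycoord c a X * ycoord c b X * pd ?C (u, w) (gcomp A g c a b) X +
      (ycoord c a X * w $ b + w $ a * ycoord c b X) * gcomp A g c a b X)"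
    by (subst E.pd_cmult[OF C]) (intro sm, simp add: E.pd_sum[OF C] E.pd_mult[OF C] sm pd_ycoord[OF X c])
  also have "\<dots> = 1/2 * (\<Sum>a\<in>UNIV. \<Sum>b\<in>UNIV. ycoord c a X * ycoord c b X * pd ?C (u, w) (gcomp A g c a b) X) +
      (1/2 * (\<Sum>a\<in>UNIV. \<Sum>b\<in>UNIV. ycoord c a X * w $ b * gcomp A g c a b X) +
       1/2 * (\<Sum>a\<in>UNIV. \<Sum>b\<in>UNIV. w $ a * ycoord c b X * gcomp A g c a b X))"
    by (simp add: sum.distrib distrib_right distrib_left)
  also have "(\<Sum>a\<in>UNIV. \<Sum>b\<in>UNIV. ycoord c a X * w $ b * gcomp A g c a b X) =
      (\<Sum>a\<in>UNIV. \<Sum>b\<in>UNIV. w $ a * ycoord c b X * gcomp A g c a b X)"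
    by (subst sum.swap) (simp add: mult_ac gcomp_sym[OF X, of c])
  finally show ?thesis by simp
qed

lemma dx_half_energy:
  assumes "X \<in> slit A" "c \<in> charts_at A (fst X)"
  shows "dx A c k L X = 1/2 * (\<Sum>a\<in>UNIV. \<Sum>b\<in>UNIV. ycoord c a X * ycoord c b X * dx A c k (gcomp A g c a b) X)"
  unfolding dx_eq_pd pd_half_energy[OF assms] by simp

lemma dy_transverse_sum:
  assumes "X \<in> slit A" "c \<in> charts_at A (fst X)"
  shows "(\<Sum>b\<in>UNIV. ycoord c b X * dy A c k (gcomp A g c i b) X) = 0"
  using dy_transverse[OF assms, of k i] by (simp add: gcomp_chart_sym(2)[OF assms, of k i])

text \<open>The term with the vertical derivative of the metric contains a contraction with y and so
  vanishes.\<close>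

lemma dy_half_energy:
  assumes X: "X \<in> slit A" and c: "c \<in> charts_at A (fst X)"
  shows "dy A c k L X = (\<Sum>b\<in>UNIV. gcomp A g c k b X * ycoord c b X)"
proof -
  have "dy A c k L X = 1/2 * (\<Sum>a\<in>UNIV. ycoord c a X * (\<Sum>b\<in>UNIV. ycoord c b X * dy A c k (gcomp A g c a b) X)) +
      (\<Sum>a\<in>UNIV. axis k 1 $ a * (\<Sum>b\<in>UNIV. gcomp A g c a b X * ycoord c b X))"
    unfolding dy_eq_pd pd_half_energy[OF X c] by (simp add: sum_distrib_left mult_ac)
  then show ?thesis by (simp add: dy_transverse_sum[OF X c])
qed

text \<open>Differentiating \<open>\<partial>L/\<partial>y\<^sup>b = g\<^sub>b\<^sub>d
  y\<^sup>d\<close> once more, transversality removes the derivative of the metric a second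
  time.\<close>

lemma vertical_hessian_eq:
  assumes X: "X \<in> slit A" and c: "c \<in> charts_at A (fst X)"
  shows "vertical_hessian A L c a b X = gcomp A g c a b X"
proof -
  note C = lift_at[OF X c]
  note sm = smooth_ycoord[OF X c] smooth_gcomp[OF X c] E.smooth_near_sum E.smooth_near_mult
  have "vertical_hessian A L c a b X = pd (lift_chart A c) (0, axis a 1) (dy A c b L) X"
    unfolding vertical_hessian_def dy_eq_pd ..
  also have "\<dots> = pd (lift_chart A c) (0, axis a 1) (\<lambda>X. \<Sum>d\<in>UNIV. gcomp A g c b d X * ycoord c d X) X"
    by (rule pd_cong_chart[OF X c dy_half_energy])
  also have "\<dots> = (\<Sum>d\<in>UNIV. gcomp A g c b d X * axis a 1 $ d + dy A c a (gcomp A g c b d) X * ycoord c d X)"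
    by (simp add: E.pd_sum[OF C] E.pd_mult[OF C] sm pd_ycoord[OF X c] dy_eq_pd)
  also have "\<dots> = gcomp A g c b a X"
    using dy_transverse_sum[OF X c, of a b] by (simp add: sum.distrib mult.commute)
  finally show ?thesis using gcomp_sym[OF X] by simp
qed

lemma hessian_inv_eq:
  assumes "X \<in> slit A" "c \<in> charts_at A (fst X)"
  shows "hessian_inv A L c a b X = ginv A g c a b X"
  unfolding hessian_inv_def ginv_def by (simp add: vertical_hessian_eq[OF assms])

lemma scale_in_slit:
  assumes "X \<in> slit A" "s > 0"
  shows "(fst X, \<lambda>c. s *\<^sub>R snd X c) \<in> slit A"
proof -
  have "(\<lambda>c. s *\<^sub>R snd X c) \<noteq> (\<lambda>_. 0)" using slitD(2)[OF assms(1)] assms(2) by (auto simp: fun_eq_iff)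
  then show ?thesis using scale_in[OF slitD(1)[OF assms(1)], of s] by (simp add: slit_def)
qed

text \<open>Along a ray \<open>s \<mapsto> s y\<close> one has \<open>dL/ds = 2 L / s\<close>, so \<open>L / s\<^sup>2\<close> is constant.\<close>

lemma half_energy_homogeneous:
  assumes X: "X \<in> slit A" and s: "s > 0"
  shows "L (fst X, \<lambda>c. s *\<^sub>R snd X c) = s\<^sup>2 * L X"
proof -
  obtain c where c: "c \<in> charts_at A (fst X)" using chart_exists by blast
  let ?C = "lift_chart A c" and ?X = "\<lambda>s. (fst X, \<lambda>c. s *\<^sub>R snd X c)"
  \<comment> \<open>The energy along the ray, read in the chart, where the ray is a straight line
    and the chain rule applies.\<close>
  define h where "h r = (L \<circ> cinv ?C) (cmap ?C (?X r))" for r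
  have h: "h r = L (?X r)" if "r > 0" for r
    using lift_at[OF scale_in_slit[OF X that]] c unfolding h_def by simp
  have Dh: "(h has_real_derivative 2 * h r / r) (at r)" if r: "r > 0" for r
  proof -
    note Xr = scale_in_slit[OF X r]
    have cr: "c \<in> charts_at A (fst (?X r))" using c by simp
    have y: "ycoord c a (?X r) = r * snd X c $ a" for a by (simp add: ycoord_def)
    have "((\<lambda>s. (cmap c (fst X), s *\<^sub>R snd X c)) has_derivative (\<lambda>t. (0, t *\<^sub>R snd X c))) (at r)"
      by (auto intro!: derivative_eq_intros)
    from has_derivative_compose[OF this, of "L \<circ> cinv ?C" "\<lambda>w. pd ?C w L (?X r)"]
    have "(h has_derivative (\<lambda>t. pd ?C (0, t *\<^sub>R snd X c) L (?X r))) (at r)"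
      using E.has_derivative_pd[OF lift_at[OF Xr cr] smooth_half_energy[OF Xr]]
      unfolding h_def[abs_def] cmap_lift by simp
    moreover have "pd ?C (0, t *\<^sub>R snd X c) L (?X r) = 2 * h r / r * t" for t
    proof -
      have "pd ?C (0, t *\<^sub>R snd X c) L (?X r) =
          (\<Sum>a\<in>UNIV. t * snd X c $ a * (\<Sum>b\<in>UNIV. gcomp A g c a b (?X r) * ycoord c b (?X r)))"
        using pd_expansion[OF Xr cr smooth_half_energy[OF Xr]] by (simp add: dy_half_energy[OF Xr cr])
      also have "\<dots> = (t / r) * (\<Sum>a\<in>UNIV. \<Sum>b\<in>UNIV. ycoord c a (?X r) * ycoord c b (?X r) * gcomp A g c a b (?X r))"
        unfolding sum_distrib_left y using r by (intro sum.cong refl) (simp add: field_simps)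
      also have "\<dots> = (t / r) * (2 * h r)" using half_energy_eq[OF Xr cr] h[OF r] by simp
      finally show ?thesis by simp
    qed
    then have e: "(\<lambda>t. pd ?C (0, t *\<^sub>R snd X c) L (?X r)) = (*) (2 * h r / r)" by (simp add: fun_eq_iff)
    ultimately show "(h has_real_derivative 2 * h r / r) (at r)" unfolding has_field_derivative_def e[symmetric] by simp
  qed
  have "(\<lambda>r. h r / r\<^sup>2) s = (\<lambda>r. h r / r\<^sup>2) 1"
  \<comment> \<open>The bound \<open>s + 2\<close> only has to exceed both \<open>s\<close> and 1,
    the two parameters compared.\<close>
  proof (rule DERIV_isconst3[of 0 "s + 2" s 1 "\<lambda>r. h r / r\<^sup>2"])
    fix r assume "r \<in> {0<..<s + 2}"
    then have r: "r > 0" by simp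
    show "((\<lambda>r. h r / r\<^sup>2) has_real_derivative 0) (at r)"
      using r by (auto intro!: derivative_eq_intros Dh simp: field_simps power2_eq_square)
  qed (use s in auto)
  then show ?thesis using h[OF s] h[of 1] s by (simp add: field_simps)
qed

lemma finsler_lagrangian_half_energy: "finsler_lagrangian A L"
  unfolding finsler_lagrangian_def
  using smooth_half_energy half_energy_homogeneous vertical_hessian_eq invertible_gcomp by simp

lemma vertical_hessian_half_energy: "is_vertical_hessian_of A g L"
  unfolding is_vertical_hessian_of_def using vertical_hessian_eq by simp

end

section \<open>The spray and the notable coefficients\<close>

context hessian_metric
begin

definition Ct :: "('m, real ^ 'n) chart \<Rightarrow> 'n \<Rightarrow> 'n \<Rightarrow> 'n \<Rightarrow> ('m, 'n) tpoint \<Rightarrow> real" where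
  "Ct c a b d X = 1/2 * dy A c d (gcomp A g c a b) X"

lemma smooth_Ct: "X \<in> slit A \<Longrightarrow> c \<in> charts_at A (fst X) \<Longrightarrow> smooth_near (slit_atlas A) (Ct c a b d) X"
  unfolding Ct_def[abs_def] by (intro smooth_rules)

lemma dy_gcomp: "dy A c d (gcomp A g c a b) X = 2 * Ct c a b d X"
  by (simp add: Ct_def)

lemma Ct_sym12: "X \<in> slit A \<Longrightarrow> c \<in> charts_at A (fst X) \<Longrightarrow> Ct c a b d X = Ct c b a d X"
  unfolding Ct_def using gcomp_chart_sym(2) by simp

text \<open>As the metric is the vertical Hessian of L, the Cartan tensor is half a third vertical
  derivative of L, and vertical derivatives commute.\<close>

lemma Ct_sym23:
  assumes X: "X \<in> slit A" and c: "c \<in> charts_at A (fst X)"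
  shows "Ct c a b d X = Ct c a d b X"
proof -
  note C = lift_at[OF X c]
  have e: "dy A c d (gcomp A g c a b) X = dy A c d (dy A c b (dy A c a L)) X" for a b d
    unfolding dy_eq_pd[of c d]
  proof (rule pd_cong_chart[OF X c])
    fix Y assume Y: "Y \<in> slit A" "c \<in> charts_at A (fst Y)"
    show "gcomp A g c a b Y = dy A c b (dy A c a L) Y"
      using vertical_hessian_eq[OF Y, of b a] gcomp_sym[OF Y(1), of c a b] by (simp add: vertical_hessian_def)
  qed
  have "dy A c d (dy A c b (dy A c a L)) X = dy A c b (dy A c d (dy A c a L)) X"
    unfolding dy_eq_pd by (rule E.pd_commute[OF C E.smooth_near_pd[OF C smooth_half_energy[OF X]]])
  then show ?thesis unfolding Ct_def e by simp
qed

lemma Ct_transverse: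
  assumes "X \<in> slit A" "c \<in> charts_at A (fst X)"
  shows "(\<Sum>a\<in>UNIV. ycoord c a X * Ct c a b d X) = 0" "(\<Sum>a\<in>UNIV. ycoord c a X * Ct c b a d X) = 0"
    "(\<Sum>a\<in>UNIV. ycoord c a X * Ct c b d a X) = 0"
proof -
  show 1: "(\<Sum>a\<in>UNIV. ycoord c a X * Ct c a b d X) = 0" for b d
    using dy_transverse[OF assms, of d b] unfolding dy_gcomp by (simp add: mult.left_commute[of _ 2] sum_distrib_left[symmetric])
  show 2: "(\<Sum>a\<in>UNIV. ycoord c a X * Ct c b a d X) = 0" for b d
    using 1[of b d] by (simp add: Ct_sym12[OF assms, of _ b])
  show "(\<Sum>a\<in>UNIV. ycoord c a X * Ct c b d a X) = 0"
    using 2[of b d] by (simp add: Ct_sym23[OF assms, of b _ d])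
qed

lemma pd_Ct_cong:
  assumes "X \<in> slit A" "c \<in> charts_at A (fst X)"
  shows "pd (lift_chart A c) w (Ct c a b d) X = pd (lift_chart A c) w (Ct c b a d) X"
    "pd (lift_chart A c) w (Ct c a b d) X = pd (lift_chart A c) w (Ct c a d b) X"
  by (rule pd_cong_chart[OF assms], rule Ct_sym12; assumption) (rule pd_cong_chart[OF assms], rule Ct_sym23; assumption)

lemma dx_Ct_transverse:
  assumes X: "X \<in> slit A" and c: "c \<in> charts_at A (fst X)"
  shows "(\<Sum>a\<in>UNIV. ycoord c a X * dx A c k (Ct c a b d) X) = 0"
proof -
  note C = lift_at[OF X c]
  have "0 = pd (lift_chart A c) (axis k 1, 0) (\<lambda>X. \<Sum>a\<in>UNIV. ycoord c a X * Ct c a b d X) X"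
    using pd_cong_chart[OF X c, of "\<lambda>X. \<Sum>a\<in>UNIV. ycoord c a X * Ct c a b d X" "\<lambda>_. 0"] Ct_transverse(1) by simp
  also have "\<dots> = (\<Sum>a\<in>UNIV. ycoord c a X * dx A c k (Ct c a b d) X)"
    by (simp add: E.pd_sum[OF C] E.pd_mult[OF C] E.smooth_near_mult smooth_ycoord[OF X c] smooth_Ct[OF X c] pd_ycoord[OF X c] dx_eq_pd)
  finally show ?thesis by simp
qed

text \<open>Vertical differentiation of the identity
  \<open>y\<^sup>a C\<^sub>a\<^sub>b\<^sub>d = 0\<close> also hits the factor y, whence the term on
  the right.\<close>

lemma dy_Ct_transverse:
  assumes X: "X \<in> slit A" and c: "c \<in> charts_at A (fst X)"
  shows "(\<Sum>a\<in>UNIV. ycoord c a X * dy A c k (Ct c a b d) X) = - Ct c k b d X"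
proof -
  note C = lift_at[OF X c]
  have "0 = pd (lift_chart A c) (0, axis k 1) (\<lambda>X. \<Sum>a\<in>UNIV. ycoord c a X * Ct c a b d X) X"
    using pd_cong_chart[OF X c, of "\<lambda>X. \<Sum>a\<in>UNIV. ycoord c a X * Ct c a b d X" "\<lambda>_. 0"] Ct_transverse(1) by simp
  also have "\<dots> = (\<Sum>a\<in>UNIV. ycoord c a X * dy A c k (Ct c a b d) X) + Ct c k b d X"
    by (simp add: E.pd_sum[OF C] E.pd_mult[OF C] E.smooth_near_mult smooth_ycoord[OF X c] smooth_Ct[OF X c] pd_ycoord[OF X c] dy_eq_pd sum.distrib)
  finally show ?thesis by simp
qed

lemma dy_Ct_sym:
  assumes X: "X \<in> slit A" and c: "c \<in> charts_at A (fst X)"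
  shows "dy A c k (Ct c a b d) X = dy A c d (Ct c a b k) X"
proof -
  note C = lift_at[OF X c]
  have "dy A c k (Ct c a b d) X = 1/2 * dy A c k (dy A c d (gcomp A g c a b)) X" for k d
    unfolding dy_eq_pd[of c k] Ct_def[abs_def]
    by (rule E.pd_cmult[OF C]) (intro smooth_rules X c)
  moreover have "dy A c k (dy A c d (gcomp A g c a b)) X = dy A c d (dy A c k (gcomp A g c a b)) X"
    unfolding dy_eq_pd by (rule E.pd_commute[OF C smooth_gcomp[OF X c]])
  ultimately show ?thesis by metis
qed

lemma dy_dx_gcomp:
  assumes X: "X \<in> slit A" and c: "c \<in> charts_at A (fst X)"
  shows "dy A c k (dx A c e (gcomp A g c a b)) X = 2 * dx A c e (Ct c a b k) X"
proof -
  note C = lift_at[OF X c]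
  have "dy A c k (dx A c e (gcomp A g c a b)) X = dx A c e (dy A c k (gcomp A g c a b)) X"
    unfolding dy_eq_pd dx_eq_pd by (rule E.pd_commute[OF C smooth_gcomp[OF X c]])
  also have "\<dots> = dx A c e (\<lambda>X. 2 * Ct c a b k X) X" by (simp add: dy_gcomp[abs_def])
  also have "\<dots> = 2 * dx A c e (Ct c a b k) X" unfolding dx_eq_pd by (rule E.pd_cmult[OF C smooth_Ct[OF X c]])
  finally show ?thesis .
qed

section \<open>Horizontal coordinate derivatives of the metric\<close>

definition gx :: "('m, real ^ 'n) chart \<Rightarrow> 'n \<Rightarrow> 'n \<Rightarrow> 'n \<Rightarrow> ('m, 'n) tpoint \<Rightarrow> real" where
  "gx c a b e = dx A c e (gcomp A g c a b)"

lemma smooth_gx: "X \<in> slit A \<Longrightarrow> c \<in> charts_at A (fst X) \<Longrightarrow> smooth_near (slit_atlas A) (gx c a b e) X"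
  unfolding gx_def by (intro smooth_rules)

lemma gx_sym: "X \<in> slit A \<Longrightarrow> c \<in> charts_at A (fst X) \<Longrightarrow> gx c a b e X = gx c b a e X"
  unfolding gx_def by (rule gcomp_chart_sym)

lemma dy_gx_transverse:
  assumes X: "X \<in> slit A" and c: "c \<in> charts_at A (fst X)"
  shows "(\<Sum>b\<in>UNIV. ycoord c b X * dy A c k (gx c a b e) X) = 0" "(\<Sum>b\<in>UNIV. ycoord c b X * dy A c k (gx c b a e) X) = 0"
proof -
  show *: "(\<Sum>b\<in>UNIV. ycoord c b X * dy A c k (gx c b a e) X) = 0"
    unfolding gx_def dy_dx_gcomp[OF X c] using dx_Ct_transverse[OF X c, of e a k]
    by (simp add: mult.left_commute[of _ 2] sum_distrib_left[symmetric])
  have "dy A c k (gx c a b e) X = dy A c k (gx c b a e) X" for b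
    unfolding dy_eq_pd by (rule pd_cong_chart[OF X c gx_sym])
  then show "(\<Sum>b\<in>UNIV. ycoord c b X * dy A c k (gx c a b e) X) = 0" using * by simp
qed

text \<open>The first Christoffel symbols contracted with \<open>y\<close>.\<close>

definition xi :: "('m, real ^ 'n) chart \<Rightarrow> 'n \<Rightarrow> 'n \<Rightarrow> ('m, 'n) tpoint \<Rightarrow> real" where
  "xi c a k X = 1/2 * (\<Sum>b\<in>UNIV. ycoord c b X * (gx c a k b X + gx c a b k X - gx c b k a X))"

lemma smooth_xi: "X \<in> slit A \<Longrightarrow> c \<in> charts_at A (fst X) \<Longrightarrow> smooth_near (slit_atlas A) (xi c a k) X"
  unfolding xi_def[abs_def] by (intro smooth_rules smooth_gx)

text \<open>A second contraction with y makes the first two Christoffel terms equal up to renaming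
  of indices. What remains is the Euler-Lagrange expression of the energy.\<close>

lemma xi_contract:
  assumes X: "X \<in> slit A" and c: "c \<in> charts_at A (fst X)"
  shows "(\<Sum>k\<in>UNIV. xi c a k X * ycoord c k X) =
    (\<Sum>b\<in>UNIV. \<Sum>k\<in>UNIV. ycoord c b X * ycoord c k X * (gx c a k b X - 1/2 * gx c b k a X))"
proof -
  have "(\<Sum>k\<in>UNIV. xi c a k X * ycoord c k X) =
    (\<Sum>k\<in>UNIV. \<Sum>b\<in>UNIV. 1/2 * (ycoord c b X * ycoord c k X * gx c a k b X) + 1/2 * (ycoord c b X * ycoord c k X * gx c a b k X)
       - 1/2 * (ycoord c b X * ycoord c k X * gx c b k a X))"
    unfolding xi_def sum_distrib_left sum_distrib_right by (intro sum.cong refl) (simp add: algebra_simps)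
  also have "\<dots> = (\<Sum>k\<in>UNIV. \<Sum>b\<in>UNIV. 1/2 * (ycoord c b X * ycoord c k X * gx c a k b X)) +
      (\<Sum>k\<in>UNIV. \<Sum>b\<in>UNIV. 1/2 * (ycoord c b X * ycoord c k X * gx c a b k X)) -
      (\<Sum>k\<in>UNIV. \<Sum>b\<in>UNIV. 1/2 * (ycoord c b X * ycoord c k X * gx c b k a X))"
    by (simp add: sum.distrib sum_subtractf)
  also have "(\<Sum>k\<in>UNIV. \<Sum>b\<in>UNIV. 1/2 * (ycoord c b X * ycoord c k X * gx c a b k X)) =
      (\<Sum>b\<in>UNIV. \<Sum>k\<in>UNIV. 1/2 * (ycoord c b X * ycoord c k X * gx c a k b X))"
    by (intro sum.cong refl) (simp add: mult.commute mult.left_commute)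
  also have "(\<Sum>k\<in>UNIV. \<Sum>b\<in>UNIV. 1/2 * (ycoord c b X * ycoord c k X * gx c a k b X)) =
      (\<Sum>b\<in>UNIV. \<Sum>k\<in>UNIV. 1/2 * (ycoord c b X * ycoord c k X * gx c a k b X))"
    by (rule sum.swap)
  also have "(\<Sum>k\<in>UNIV. \<Sum>b\<in>UNIV. 1/2 * (ycoord c b X * ycoord c k X * gx c b k a X)) =
      (\<Sum>b\<in>UNIV. \<Sum>k\<in>UNIV. 1/2 * (ycoord c b X * ycoord c k X * gx c b k a X))"
    by (rule sum.swap)
  finally show ?thesis
    by (simp add: sum.distrib[symmetric] sum_subtractf[symmetric]) (intro sum.cong refl, simp add: algebra_simps)
qed

section \<open>The spray and the Barthel connection\<close>

abbreviation "sp c a \<equiv> spray A L c a"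
abbreviation "N c \<equiv> barthel A L c"

text \<open>With \<open>\<partial>L/\<partial>y\<^sup>a = g\<^sub>a\<^sub>k y\<^sup>k\<close> the
  bracket in the definition of the spray is the Euler-Lagrange expression of
  \<open>xi_contract\<close>.\<close>

lemma spray_low:
  assumes X: "X \<in> slit A" and c: "c \<in> charts_at A (fst X)"
  shows "2 * (\<Sum>b\<in>UNIV. gcomp A g c a b X * sp c b X) = (\<Sum>k\<in>UNIV. xi c a k X * ycoord c k X)"
proof -
  note C = lift_at[OF X c]
  let ?h = "\<lambda>d. (\<Sum>e\<in>UNIV. dx A c e (dy A c d L) X * ycoord c e X) - dx A c d L X"
  have "sp c b X = (\<Sum>d\<in>UNIV. ginv A g c b d X * (1/2 * ?h d))" for b
    unfolding spray_def hessian_inv_eq[OF X c] sum_distrib_left by (intro sum.cong refl) simp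
  then have "(\<Sum>b\<in>UNIV. gcomp A g c a b X * sp c b X) = 1/2 * ?h a" by (simp only: lower_raise[OF X c])
  then have l: "2 * (\<Sum>b\<in>UNIV. gcomp A g c a b X * sp c b X) = ?h a" by simp
  have dd: "dx A c e (dy A c a L) X = (\<Sum>k\<in>UNIV. gx c a k e X * ycoord c k X)" for e
  proof -
    have "dx A c e (dy A c a L) X = pd (lift_chart A c) (axis e 1, 0) (\<lambda>X. \<Sum>k\<in>UNIV. gcomp A g c a k X * ycoord c k X) X"
      unfolding dx_eq_pd by (rule pd_cong_chart[OF X c dy_half_energy])
    then show ?thesis
      by (simp add: E.pd_sum[OF C] E.pd_mult[OF C] E.smooth_near_mult smooth_ycoord[OF X c] smooth_gcomp[OF X c] pd_ycoord[OF X c] gx_def dx_eq_pd)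
  qed
  have "?h a = (\<Sum>b\<in>UNIV. \<Sum>k\<in>UNIV. ycoord c b X * ycoord c k X * gx c a k b X) -
      (\<Sum>b\<in>UNIV. \<Sum>k\<in>UNIV. 1/2 * (ycoord c b X * ycoord c k X * gx c b k a X))"
    unfolding dd dx_half_energy[OF X c] gx_def[symmetric] sum_distrib_left[symmetric] sum_distrib_right
    by (simp add: mult_ac)
  then show ?thesis unfolding l xi_contract[OF X c]
    by (simp add: sum_subtractf[symmetric] algebra_simps)
qed

lemma smooth_spray:
  assumes X: "X \<in> slit A" and c: "c \<in> charts_at A (fst X)"
  shows "smooth_near (slit_atlas A) (sp c a) X"
proof (rule smooth_cong_chart[OF X c])
  show "smooth_near (slit_atlas A) (\<lambda>X. 1/2 * (\<Sum>d\<in>UNIV. ginv A g c a d X * ((\<Sum>e\<in>UNIV. dx A c e (dy A c d L) X * ycoord c e X) - dx A c d L X))) X"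
    by (intro smooth_rules X c smooth_half_energy)
qed (simp add: spray_def hessian_inv_eq)

lemma smooth_barthel: "X \<in> slit A \<Longrightarrow> c \<in> charts_at A (fst X) \<Longrightarrow> smooth_near (slit_atlas A) (N c a b) X"
  unfolding barthel_def by (intro smooth_rules smooth_spray)

text \<open>Of the three terms in which the vertical derivative hits the metric, two contract y with
  an index of the metric and vanish. In the surviving one y contracts with the index of
  \<partial>/\<partial>x.\<close>

lemma dy_xi:
  assumes X: "X \<in> slit A" and c: "c \<in> charts_at A (fst X)"
  shows "dy A c b (xi c a d) X = 1/2 * (gx c a d b X + gx c a b d X - gx c b d a X) +
    (\<Sum>k\<in>UNIV. ycoord c k X * dx A c k (Ct c a d b) X)"
proof -
  note C = lift_at[OF X c]
  note sm = smooth_ycoord[OF X c] smooth_gx[OF X c] E.smooth_near_sum E.smooth_near_mult E.smooth_near_add E.smooth_near_diff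
  let ?y = "\<lambda>k. ycoord c k X"
  have "dy A c b (xi c a d) X = 1/2 * (\<Sum>k\<in>UNIV. ?y k * (dy A c b (gx c a d k) X + dy A c b (gx c a k d) X - dy A c b (gx c k d a) X)
      + axis b 1 $ k * (gx c a d k X + gx c a k d X - gx c k d a X))"
    unfolding xi_def[abs_def] dy_eq_pd
    by (subst E.pd_cmult[OF C]) (intro sm, simp add: E.pd_sum[OF C] E.pd_mult[OF C] E.pd_add[OF C] E.pd_diff[OF C] sm pd_ycoord[OF X c])
  also have "\<dots> = 1/2 * ((\<Sum>k\<in>UNIV. ?y k * dy A c b (gx c a d k) X) + (\<Sum>k\<in>UNIV. ?y k * dy A c b (gx c a k d) X)
      - (\<Sum>k\<in>UNIV. ?y k * dy A c b (gx c k d a) X) + (gx c a d b X + gx c a b d X - gx c b d a X))"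
    unfolding sum.distrib sum_axis by (simp add: distrib_left right_diff_distrib sum.distrib sum_subtractf)
  also have "(\<Sum>k\<in>UNIV. ?y k * dy A c b (gx c a d k) X) = 2 * (\<Sum>k\<in>UNIV. ?y k * dx A c k (Ct c a d b) X)"
    unfolding gx_def dy_dx_gcomp[OF X c] by (simp add: mult.left_commute[of _ 2] sum_distrib_left[symmetric])
  finally have "dy A c b (xi c a d) X = 1/2 * (2 * (\<Sum>k\<in>UNIV. ?y k * dx A c k (Ct c a d b) X) + 0 - 0 + (gx c a d b X + gx c a b d X - gx c b d a X))"
    unfolding dy_gx_transverse[OF X c] .
  moreover have "1/2 * (2 * S + 0 - 0 + G) = 1/2 * G + S" for S G :: real by simp
  ultimately show ?thesis by metis
qed

text \<open>One copy of \<open>xi\<close> comes from differentiating y. By \<open>dy_xi\<close> the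
  derivative of \<open>xi\<close>, contracted with y, gives a second copy, and its remaining term
  vanishes because y annihilates the Cartan tensor.\<close>

lemma dy_xi_y:
  assumes X: "X \<in> slit A" and c: "c \<in> charts_at A (fst X)"
  shows "dy A c k (\<lambda>X. \<Sum>d\<in>UNIV. xi c a d X * ycoord c d X) X = 2 * xi c a k X"
proof -
  note C = lift_at[OF X c]
  note sm = smooth_ycoord[OF X c] smooth_xi[OF X c] E.smooth_near_sum E.smooth_near_mult
  let ?y = "\<lambda>k. ycoord c k X"
  have z: "(\<Sum>d\<in>UNIV. ?y d * dx A c e (Ct c a d k) X) = 0" for e
    using dx_Ct_transverse[OF X c, of e a k] unfolding dx_eq_pd pd_Ct_cong(1)[OF X c, of _ a] .
  have "dy A c k (\<lambda>X. \<Sum>d\<in>UNIV. xi c a d X * ycoord c d X) X = xi c a k X + (\<Sum>d\<in>UNIV. dy A c k (xi c a d) X * ?y d)"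
    unfolding dy_eq_pd by (simp add: E.pd_sum[OF C] E.pd_mult[OF C] sm pd_ycoord[OF X c] sum.distrib)
  also have "(\<Sum>d\<in>UNIV. dy A c k (xi c a d) X * ?y d) =
      1/2 * (\<Sum>d\<in>UNIV. ?y d * (gx c a d k X + gx c a k d X - gx c k d a X)) +
      (\<Sum>e\<in>UNIV. ?y e * (\<Sum>d\<in>UNIV. ?y d * dx A c e (Ct c a d k) X))"
  proof -
    have "(\<Sum>d\<in>UNIV. (\<Sum>e\<in>UNIV. ?y e * dx A c e (Ct c a d k) X) * ?y d) = (\<Sum>e\<in>UNIV. ?y e * (\<Sum>d\<in>UNIV. ?y d * dx A c e (Ct c a d k) X))"
      unfolding sum_distrib_left sum_distrib_right by (subst sum.swap) (simp add: mult_ac)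
    then show ?thesis
      unfolding dy_xi[OF X c] distrib_right sum.distrib by (simp add: sum_distrib_left mult_ac)
  qed
  also have "1/2 * (\<Sum>d\<in>UNIV. ?y d * (gx c a d k X + gx c a k d X - gx c k d a X)) = xi c a k X"
    unfolding xi_def gx_sym[OF X c, of k] by (intro arg_cong[of _ _ "\<lambda>z. 1/2 * z"] sum.cong refl) simp
  finally show ?thesis unfolding z by simp
qed

text \<open>The vertical derivative of \<open>spray_low\<close>: on the left it falls on the spray,
  giving N, and on the metric, giving the Cartan term.\<close>

lemma barthel_low:
  assumes X: "X \<in> slit A" and c: "c \<in> charts_at A (fst X)"
  shows "(\<Sum>b\<in>UNIV. gcomp A g c a b X * N c b k X) = xi c a k X - 2 * (\<Sum>b\<in>UNIV. Ct c a k b X * sp c b X)"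
proof -
  note C = lift_at[OF X c]
  note sm = smooth_spray[OF X c] smooth_gcomp[OF X c] E.smooth_near_sum E.smooth_near_mult
  have "2 * xi c a k X = dy A c k (\<lambda>X. \<Sum>d\<in>UNIV. xi c a d X * ycoord c d X) X" using dy_xi_y[OF X c] by simp
  also have "\<dots> = dy A c k (\<lambda>X. 2 * (\<Sum>b\<in>UNIV. gcomp A g c a b X * sp c b X)) X"
    unfolding dy_eq_pd by (rule pd_cong_chart[OF X c spray_low[symmetric]])
  also have "\<dots> = 2 * (\<Sum>b\<in>UNIV. gcomp A g c a b X * N c b k X + dy A c k (gcomp A g c a b) X * sp c b X)"
    unfolding dy_eq_pd barthel_def
    by (subst E.pd_cmult[OF C]) (intro sm, simp add: E.pd_sum[OF C] E.pd_mult[OF C] sm)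
  moreover have "(\<Sum>b\<in>UNIV. dy A c k (gcomp A g c a b) X * sp c b X) = 2 * (\<Sum>b\<in>UNIV. Ct c a k b X * sp c b X)"
    unfolding dy_gcomp sum_distrib_left by (intro sum.cong refl) (simp add: Ct_sym23[OF X c, of a k])
  ultimately show ?thesis by (simp add: sum.distrib)
qed

lemma Ct_spray_transverse:
  assumes X: "X \<in> slit A" and c: "c \<in> charts_at A (fst X)"
  shows "(\<Sum>k\<in>UNIV. (\<Sum>b\<in>UNIV. Ct c a k b X * h b) * ycoord c k X) = 0"
proof -
  have "(\<Sum>k\<in>UNIV. (\<Sum>b\<in>UNIV. Ct c a k b X * h b) * ycoord c k X) = (\<Sum>b\<in>UNIV. h b * (\<Sum>k\<in>UNIV. ycoord c k X * Ct c a k b X))"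
    unfolding sum_distrib_left sum_distrib_right by (subst sum.swap) (simp add: mult_ac)
  then show ?thesis by (simp add: Ct_transverse[OF X c])
qed

text \<open>Contraction with y kills the Cartan term whatever \<open>h\<close> is, so the
  contraction of \<open>M\<close> is known even when \<open>h\<close> is not.\<close>

lemma nonlinear_connection_contract:
  assumes X: "X \<in> slit A" and c: "c \<in> charts_at A (fst X)"
    and M: "\<And>a k. (\<Sum>b\<in>UNIV. gcomp A g c a b X * M b k) = xi c a k X - (\<Sum>b\<in>UNIV. Ct c a k b X * h b)"
  shows "(\<Sum>k\<in>UNIV. M b k * ycoord c k X) = 2 * sp c b X"
proof (rule lower_inject[OF X c])
  fix a
  have "(\<Sum>b\<in>UNIV. gcomp A g c a b X * (\<Sum>k\<in>UNIV. M b k * ycoord c k X)) =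
      (\<Sum>k\<in>UNIV. (\<Sum>b\<in>UNIV. gcomp A g c a b X * M b k) * ycoord c k X)"
    unfolding sum_distrib_left sum_distrib_right by (subst sum.swap) (simp add: mult_ac)
  also have "\<dots> = (\<Sum>k\<in>UNIV. xi c a k X * ycoord c k X) - (\<Sum>k\<in>UNIV. (\<Sum>b\<in>UNIV. Ct c a k b X * h b) * ycoord c k X)"
    unfolding M left_diff_distrib sum_subtractf ..
  also have "\<dots> = (\<Sum>b\<in>UNIV. gcomp A g c a b X * (2 * sp c b X))"
    using spray_low[OF X c, of a] by (simp add: Ct_spray_transverse[OF X c] sum_distrib_left mult.left_commute)
  finally show "(\<Sum>b\<in>UNIV. gcomp A g c a b X * (\<Sum>k\<in>UNIV. M b k * ycoord c k X)) = (\<Sum>b\<in>UNIV. gcomp A g c a b X * (2 * sp c b X))" .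
qed

lemma barthel_contract:
  assumes X: "X \<in> slit A" and c: "c \<in> charts_at A (fst X)"
  shows "(\<Sum>k\<in>UNIV. N c b k X * ycoord c k X) = 2 * sp c b X"
  by (rule nonlinear_connection_contract[OF X c, where h = "\<lambda>b. 2 * sp c b X"])
    (simp add: barthel_low[OF X c] sum_distrib_left mult_ac)

text \<open>The equation is implicit, since \<open>M\<close> occurs on both sides; but on the right
  it enters only through its contraction with y, which is already determined.\<close>

lemma barthel_unique:
  assumes X: "X \<in> slit A" and c: "c \<in> charts_at A (fst X)"
    and M: "\<And>a k. (\<Sum>b\<in>UNIV. gcomp A g c a b X * M b k) =
      xi c a k X - (\<Sum>b\<in>UNIV. Ct c a k b X * (\<Sum>d\<in>UNIV. M b d * ycoord c d X))"
  shows "M b k = N c b k X"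
proof (rule lower_inject[OF X c, where h = "\<lambda>b. M b k" and k = "\<lambda>b. N c b k X"])
  fix a
  show "(\<Sum>b\<in>UNIV. gcomp A g c a b X * M b k) = (\<Sum>b\<in>UNIV. gcomp A g c a b X * N c b k X)"
    unfolding M nonlinear_connection_contract[OF X c M] barthel_low[OF X c] by (simp add: sum_distrib_left mult_ac)
qed

section \<open>Christoffel coefficients of a non-linear connection\<close>

text \<open>
  The coefficients \<open>\<Gamma>\<^sub>a\<^sub>b\<^sub>d\<close> for an arbitrary non-linear connection \<open>M\<close>: that the one induced by \<open>\<nabla>\<close> is
  the Barthel connection is only known after the \<open>\<Gamma>\<close> built from it has been compared with \<open>H\<close>.
\<close>

definition Gam :: "('m, real ^ 'n) chart \<Rightarrow> ('n \<Rightarrow> 'n \<Rightarrow> real) \<Rightarrow> 'n \<Rightarrow> 'n \<Rightarrow> 'n \<Rightarrow> ('m, 'n) tpoint \<Rightarrow> real" where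
  "Gam c M a b d X = 1/2 * (gx c a d b X + gx c a b d X - gx c b d a X) -
    ((\<Sum>e\<in>UNIV. M e b * Ct c a d e X) + (\<Sum>e\<in>UNIV. M e d * Ct c a b e X) - (\<Sum>e\<in>UNIV. M e a * Ct c b d e X))"

text \<open>In two of the three correction terms y meets the Cartan tensor and they vanish; in the
  remaining one it meets \<open>M\<close>.\<close>

lemma Gam_contract:
  assumes X: "X \<in> slit A" and c: "c \<in> charts_at A (fst X)"
  shows "(\<Sum>b\<in>UNIV. ycoord c b X * Gam c M a b d X) =
    xi c a d X - (\<Sum>b\<in>UNIV. Ct c a d b X * (\<Sum>e\<in>UNIV. M b e * ycoord c e X))"
proof -
  let ?y = "\<lambda>b. ycoord c b X"
  have "(\<Sum>b\<in>UNIV. ?y b * Gam c M a b d X) = (\<Sum>b\<in>UNIV. 1/2 * (?y b * (gx c a d b X + gx c a b d X - gx c b d a X))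
    - ?y b * (\<Sum>e\<in>UNIV. M e b * Ct c a d e X) - (\<Sum>e\<in>UNIV. Ct c a b e X * M e d) * ?y b + (\<Sum>e\<in>UNIV. Ct c d b e X * M e a) * ?y b)"
    unfolding Gam_def Ct_sym12[OF X c, of _ d] by (intro sum.cong refl) (simp add: algebra_simps)
  also have "\<dots> = xi c a d X - (\<Sum>b\<in>UNIV. ?y b * (\<Sum>e\<in>UNIV. M e b * Ct c a d e X))"
    by (simp add: sum.distrib sum_subtractf Ct_spray_transverse[OF X c] xi_def sum_distrib_left)
  also have "(\<Sum>b\<in>UNIV. ?y b * (\<Sum>e\<in>UNIV. M e b * Ct c a d e X)) = (\<Sum>b\<in>UNIV. Ct c a d b X * (\<Sum>e\<in>UNIV. M b e * ?y e))"
    unfolding sum_distrib_left by (subst sum.swap) (simp add: mult_ac)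
  finally show ?thesis .
qed

lemma Gam_barthel_contract:
  assumes X: "X \<in> slit A" and c: "c \<in> charts_at A (fst X)"
  shows "(\<Sum>b\<in>UNIV. ycoord c b X * Gam c (\<lambda>a b. N c a b X) a b d X) = (\<Sum>b\<in>UNIV. gcomp A g c a b X * N c b d X)"
  unfolding Gam_contract[OF X c] barthel_contract[OF X c] barthel_low[OF X c] by (simp add: sum_distrib_left mult_ac)

lemma Gamma_low:
  assumes X: "X \<in> slit A" and c: "c \<in> charts_at A (fst X)"
  shows "lower3 A g (Gamma_coeff A L) c a b d X = Gam c (\<lambda>a b. N c a b X) a b d X"
proof -
  have v: "dx A c k (vertical_hessian A L c i j) X = gx c i j k X"
    "dy A c k (vertical_hessian A L c i j) X = 2 * Ct c i j k X" for i j k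
    unfolding gx_def dy_gcomp[symmetric] dx_eq_pd dy_eq_pd by (rule pd_cong_chart[OF X c vertical_hessian_eq]; assumption)+
  have d: "delta A L c k (vertical_hessian A L c i j) X = gx c i j k X - 2 * (\<Sum>e\<in>UNIV. N c e k X * Ct c i j e X)" for i j k
    unfolding delta_def v by (simp add: sum_distrib_left mult_ac)
  have "lower3 A g (Gamma_coeff A L) c a b d X =
      (\<Sum>e\<in>UNIV. gcomp A g c a e X * (\<Sum>k\<in>UNIV. ginv A g c e k X * (1/2 * (delta A L c b (vertical_hessian A L c k d) X
      + delta A L c d (vertical_hessian A L c k b) X - delta A L c k (vertical_hessian A L c b d) X))))"
    unfolding lower3_def Gamma_coeff_def hessian_inv_eq[OF X c] by (simp add: sum_distrib_left mult_ac)
  then show ?thesis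
    unfolding lower_raise[OF X c] d Gam_def by (simp add: algebra_simps)
qed

lemma Gam_metric:
  assumes X: "X \<in> slit A" and c: "c \<in> charts_at A (fst X)"
  shows "Gam c M a b d X + Gam c M b a d X = gx c a b d X - 2 * (\<Sum>e\<in>UNIV. M e d * Ct c a b e X)"
  unfolding Gam_def by (simp add: gx_sym[OF X c, of b a] Ct_sym12[OF X c, of b a] field_simps)

text \<open>Write \<delta>g for the derivatives of the metric along \<open>M\<close>. Adding
  \<open>\<delta>\<^sub>d g\<^sub>a\<^sub>b\<close> to both sides makes the right side symmetric in
  b and d, which is the symmetry that (\<delta>) imposes on the connection forms.\<close>

lemma Gam_diff:
  assumes X: "X \<in> slit A" and c: "c \<in> charts_at A (fst X)"
  shows "Gam c M a b d X - Gam c M b a d X =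
    (gx c a d b X - 2 * (\<Sum>e\<in>UNIV. M e b * Ct c a d e X)) - (gx c b d a X - 2 * (\<Sum>e\<in>UNIV. M e a * Ct c b d e X))"
  unfolding Gam_def by (simp add: gx_sym[OF X c, of b a] Ct_sym12[OF X c, of b a] field_simps)

lemma Cartan_low:
  assumes X: "X \<in> slit A" and c: "c \<in> charts_at A (fst X)"
  shows "lower3 A g (Cartan_coeff A L) c a b d X = Ct c a b d X"
proof -
  have "dy A c d (vertical_hessian A L c k b) X = 2 * Ct c k b d X" for k
    unfolding dy_gcomp[symmetric] dy_eq_pd by (rule pd_cong_chart[OF X c vertical_hessian_eq])
  then show ?thesis
    unfolding lower3_def Cartan_coeff_def hessian_inv_eq[OF X c] by (simp add: lower_raise[OF X c])
qed

section \<open>The Landsberg tensor and the Berwald coefficients\<close>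

text \<open>
  The Landsberg tensor, written as the Chern covariant derivative of the Cartan tensor along the
  spray because this exhibits it as a tensor.
\<close>

definition Land :: "('m, real ^ 'n) chart \<Rightarrow> 'n \<Rightarrow> 'n \<Rightarrow> 'n \<Rightarrow> ('m, 'n) tpoint \<Rightarrow> real" where
  "Land c a b d X = (\<Sum>k\<in>UNIV. ycoord c k X * dx A c k (Ct c a b d) X) - 2 * (\<Sum>e\<in>UNIV. sp c e X * dy A c e (Ct c a b d) X)
    - (\<Sum>e\<in>UNIV. N c e a X * Ct c e b d X) - (\<Sum>e\<in>UNIV. N c e b X * Ct c a e d X) - (\<Sum>e\<in>UNIV. N c e d X * Ct c a b e X)"

lemma smooth_Land: "X \<in> slit A \<Longrightarrow> c \<in> charts_at A (fst X) \<Longrightarrow> smooth_near (slit_atlas A) (Land c a b d) X"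
  unfolding Land_def[abs_def] by (intro smooth_rules smooth_Ct smooth_spray smooth_barthel)

lemma Land_sym:
  assumes X: "X \<in> slit A" and c: "c \<in> charts_at A (fst X)"
  shows "Land c a b d X = Land c b a d X"
proof -
  have "dx A c k (Ct c a b d) X = dx A c k (Ct c b a d) X" "dy A c k (Ct c a b d) X = dy A c k (Ct c b a d) X" for k
    unfolding dx_eq_pd dy_eq_pd by (rule pd_Ct_cong(1)[OF X c])+
  moreover have "(\<Sum>e\<in>UNIV. N c e i X * Ct c e j d X) = (\<Sum>e\<in>UNIV. N c e i X * Ct c j e d X)" for i j
    by (intro sum.cong refl) (simp add: Ct_sym12[OF X c, of _ j])
  ultimately show ?thesis by (simp add: Land_def Ct_sym12[OF X c, of a b])
qed

text \<open>Two contributions survive the contraction, one from the vertical derivative of the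
  Cartan tensor and one from \<open>N\<^sup>e\<^sub>a y\<^sup>a = 2 G\<^sup>e\<close>; they
  cancel.\<close>

lemma Land_transverse:
  assumes X: "X \<in> slit A" and c: "c \<in> charts_at A (fst X)"
  shows "(\<Sum>a\<in>UNIV. ycoord c a X * Land c a b d X) = 0"
proof -
  let ?y = "\<lambda>a. ycoord c a X"
  have 1: "(\<Sum>a\<in>UNIV. ?y a * (\<Sum>k\<in>UNIV. ?y k * dx A c k (Ct c a b d) X)) = 0"
  proof -
    have "(\<Sum>a\<in>UNIV. ?y a * (\<Sum>k\<in>UNIV. ?y k * dx A c k (Ct c a b d) X)) = (\<Sum>k\<in>UNIV. ?y k * (\<Sum>a\<in>UNIV. ?y a * dx A c k (Ct c a b d) X))"
      unfolding sum_distrib_left by (subst sum.swap) (simp add: mult_ac)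
    then show ?thesis by (simp add: dx_Ct_transverse[OF X c])
  qed
  have 2: "(\<Sum>a\<in>UNIV. ?y a * (\<Sum>e\<in>UNIV. sp c e X * dy A c e (Ct c a b d) X)) = - (\<Sum>e\<in>UNIV. sp c e X * Ct c e b d X)"
  proof -
    have "(\<Sum>a\<in>UNIV. ?y a * (\<Sum>e\<in>UNIV. sp c e X * dy A c e (Ct c a b d) X)) = (\<Sum>e\<in>UNIV. sp c e X * (\<Sum>a\<in>UNIV. ?y a * dy A c e (Ct c a b d) X))"
      unfolding sum_distrib_left by (subst sum.swap) (simp add: mult_ac)
    then show ?thesis by (simp add: dy_Ct_transverse[OF X c] sum_negf)
  qed
  have 3: "(\<Sum>a\<in>UNIV. ?y a * (\<Sum>e\<in>UNIV. N c e a X * Ct c e b d X)) = 2 * (\<Sum>e\<in>UNIV. sp c e X * Ct c e b d X)"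
  proof -
    have e: "(\<Sum>a\<in>UNIV. ?y a * (\<Sum>e\<in>UNIV. N c e a X * Ct c e b d X)) = (\<Sum>e\<in>UNIV. (\<Sum>a\<in>UNIV. N c e a X * ?y a) * Ct c e b d X)"
      unfolding sum_distrib_left sum_distrib_right by (subst sum.swap) (simp add: mult_ac)
    show ?thesis unfolding e barthel_contract[OF X c] by (simp add: sum_distrib_left mult.assoc)
  qed
  have 4: "(\<Sum>a\<in>UNIV. ?y a * (\<Sum>e\<in>UNIV. h e * Ct c a e j X)) = 0" for h j
    using Ct_spray_transverse[OF X c, of j h] unfolding sum_distrib_left sum_distrib_right
    by (simp add: mult_ac Ct_sym12[OF X c, of j] Ct_sym23[OF X c, of _ j])
  have 5: "(\<Sum>a\<in>UNIV. ?y a * (\<Sum>e\<in>UNIV. h e * Ct c a j e X)) = 0" for h j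
    using 4[of h j] by (simp add: Ct_sym23[OF X c, of _ j])
  have *: "(\<Sum>a\<in>UNIV. y a * (P a - 2 * Q a - R a - S a - T a)) = (\<Sum>a\<in>UNIV. y a * P a) - 2 * (\<Sum>a\<in>UNIV. y a * Q a)
      - (\<Sum>a\<in>UNIV. y a * R a) - (\<Sum>a\<in>UNIV. y a * S a) - (\<Sum>a\<in>UNIV. y a * T a)" for y P Q R S T :: "'n \<Rightarrow> real"
    by (simp add: right_diff_distrib sum_subtractf sum_distrib_left mult.left_commute)
  have "(\<Sum>a\<in>UNIV. ?y a * Land c a b d X) = (\<Sum>a\<in>UNIV. ?y a * (\<Sum>k\<in>UNIV. ?y k * dx A c k (Ct c a b d) X))
     - 2 * (\<Sum>a\<in>UNIV. ?y a * (\<Sum>e\<in>UNIV. sp c e X * dy A c e (Ct c a b d) X))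
     - (\<Sum>a\<in>UNIV. ?y a * (\<Sum>e\<in>UNIV. N c e a X * Ct c e b d X))
     - (\<Sum>a\<in>UNIV. ?y a * (\<Sum>e\<in>UNIV. N c e b X * Ct c a e d X)) - (\<Sum>a\<in>UNIV. ?y a * (\<Sum>e\<in>UNIV. N c e d X * Ct c a b e X))"
    unfolding Land_def by (rule *)
  then show ?thesis unfolding 1 2 3 4 5 by simp
qed

text \<open>The vertical derivative of \<open>barthel_low\<close> contains the lowered second
  derivatives of the spray. Solving for them, with \<open>dy_xi\<close> and the total symmetry of
  the Cartan tensor and of its vertical derivative, the other terms group into \<Gamma> and the
  Landsberg tensor.\<close>

lemma Berwald_low:
  assumes X: "X \<in> slit A" and c: "c \<in> charts_at A (fst X)"
  shows "lower3 A g (Berwald_coeff A L) c a b d X = Gam c (\<lambda>a b. N c a b X) a b d X + Land c a b d X"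
proof -
  note C = lift_at[OF X c]
  note sm = smooth_spray[OF X c] smooth_gcomp[OF X c] smooth_barthel[OF X c] smooth_Ct[OF X c] smooth_xi[OF X c]
    E.smooth_near_sum E.smooth_near_mult E.smooth_near_diff E.smooth_near_const
  have bb: "dy A c b (N c e d) X = Berwald_coeff A L c e b d X" for e by (simp add: barthel_def Berwald_coeff_def)
  have c1: "dy A c b (Ct c a d e) X = dy A c e (Ct c a b d) X" for e
    using dy_Ct_sym[OF X c, where k = b and a = a and b = d and d = e] unfolding dy_eq_pd pd_Ct_cong(2)[OF X c, of _ a d b] .
  have c2: "dx A c e (Ct c a d b) X = dx A c e (Ct c a b d) X" for e
    unfolding dx_eq_pd pd_Ct_cong(2)[OF X c, of _ a d b] ..
  have "dy A c b (\<lambda>X. \<Sum>e\<in>UNIV. gcomp A g c a e X * N c e d X) X =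
      lower3 A g (Berwald_coeff A L) c a b d X + (\<Sum>e\<in>UNIV. dy A c b (gcomp A g c a e) X * N c e d X)"
    unfolding lower3_def bb[symmetric] dy_eq_pd[of c b]
    by (simp add: E.pd_sum[OF C] E.pd_mult[OF C] sm sum.distrib)
  also have "(\<Sum>e\<in>UNIV. dy A c b (gcomp A g c a e) X * N c e d X) = 2 * (\<Sum>e\<in>UNIV. N c e d X * Ct c a b e X)"
    unfolding dy_gcomp sum_distrib_left by (intro sum.cong refl) (simp add: Ct_sym23[OF X c, of a b])
  finally have 1: "dy A c b (\<lambda>X. \<Sum>e\<in>UNIV. gcomp A g c a e X * N c e d X) X =
      lower3 A g (Berwald_coeff A L) c a b d X + 2 * (\<Sum>e\<in>UNIV. N c e d X * Ct c a b e X)" .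
  have "dy A c b (\<lambda>X. \<Sum>e\<in>UNIV. gcomp A g c a e X * N c e d X) X =
      dy A c b (\<lambda>X. xi c a d X - 2 * (\<Sum>e\<in>UNIV. Ct c a d e X * sp c e X)) X"
    unfolding dy_eq_pd by (rule pd_cong_chart[OF X c barthel_low])
  also have "\<dots> = dy A c b (xi c a d) X - 2 * (\<Sum>e\<in>UNIV. Ct c a d e X * N c e b X + dy A c b (Ct c a d e) X * sp c e X)"
    unfolding dy_eq_pd barthel_def
    by (subst E.pd_diff[OF C], intro sm, intro sm, subst E.pd_cmult[OF C], intro sm) (simp add: E.pd_sum[OF C] E.pd_mult[OF C] sm)
  also have "(\<Sum>e\<in>UNIV. Ct c a d e X * N c e b X + dy A c b (Ct c a d e) X * sp c e X) =
      (\<Sum>e\<in>UNIV. N c e b X * Ct c a d e X) + (\<Sum>e\<in>UNIV. sp c e X * dy A c e (Ct c a b d) X)"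
    unfolding c1 sum.distrib by (simp only: mult.commute)
  finally have 2: "dy A c b (\<lambda>X. \<Sum>e\<in>UNIV. gcomp A g c a e X * N c e d X) X = dy A c b (xi c a d) X -
      2 * ((\<Sum>e\<in>UNIV. N c e b X * Ct c a d e X) + (\<Sum>e\<in>UNIV. sp c e X * dy A c e (Ct c a b d) X))" .
  have 3: "(\<Sum>e\<in>UNIV. N c e a X * Ct c e b d X) = (\<Sum>e\<in>UNIV. N c e a X * Ct c b d e X)"
    by (intro sum.cong refl) (simp add: Ct_sym12[OF X c, of _ b] Ct_sym23[OF X c, of b _ d])
  have 4: "(\<Sum>e\<in>UNIV. N c e b X * Ct c a e d X) = (\<Sum>e\<in>UNIV. N c e b X * Ct c a d e X)"
    by (intro sum.cong refl) (simp add: Ct_sym23[OF X c, of a _ d])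
  show ?thesis
    using 1 2 unfolding dy_xi[OF X c] Gam_def Land_def c2 3 4 by argo
qed

end

section \<open>Endomorphism-valued forms\<close>

lemma tlin_apply: "tlin r u q v i = r *\<^sub>R u i + q *\<^sub>R v i"
  by (simp add: tlin_def)

context manifold_atlas
begin

lemma cfield_linear: "cfield c (r *\<^sub>R v + q *\<^sub>R w) X = tlin r (cfield c v X) q (cfield c w X)"
  unfolding cfield_def by (rule E.tvec_of_linear)

lemma linear_cfield:
  assumes "\<And>Z W r q. Z \<in> TE A X \<Longrightarrow> W \<in> TE A X \<Longrightarrow> f (tlin r Z q W) = r * f Z + q * (f W :: real)"
  shows "linear (\<lambda>w. f (cfield c w X))"
proof
  fix v w :: "(real ^ 'n) \<times> (real ^ 'n)" and r :: real
  show "f (cfield c (v + w) X) = f (cfield c v X) + f (cfield c w X)"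
    using assms[OF cfield_in cfield_in, of 1 c v 1 c w] cfield_linear[of c 1 v 1 w] by simp
  show "f (cfield c (r *\<^sub>R v) X) = r *\<^sub>R f (cfield c v X)"
    using assms[OF cfield_in cfield_in, of r c v 0 c v] cfield_linear[of c r v 0 v] by simp
qed

lemma linear_pair_expansion:
  fixes f :: "(real ^ 'n) \<times> (real ^ 'n) \<Rightarrow> real"
  assumes l: "linear f"
  shows "f (u, w) = (\<Sum>d\<in>UNIV. u $ d * f (axis d 1, 0)) + (\<Sum>d\<in>UNIV. w $ d * f (0, axis d 1))"
proof -
  have "f (u, w) = f (u, 0) + f (0, w)" using linear_add[OF l, of "(u, 0)" "(0, w)"] by simp
  moreover have "linear (\<lambda>u. f (u, 0))" "linear (\<lambda>w. f (0, w))"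
    using linear_compose[OF _ l, of "\<lambda>u. (u, 0)"] linear_compose[OF _ l, of "\<lambda>w. (0, w)"]
    by (auto simp: comp_def linear_iff)
  ultimately show ?thesis using linear_axis_expansion[of "\<lambda>u. f (u, 0)" u] linear_axis_expansion[of "\<lambda>w. f (0, w)" w]
    by simp
qed

lemma zero_in_TE: "(\<lambda>_. 0) \<in> TE A X"
  by (rule E.zero_in)

end

section \<open>Coefficients, sums and differences of connections\<close>

context connection_atlas
begin

text \<open>The definite description needs existence and uniqueness. Regularity makes the forms dx
  and the components of \<nabla>y a coframe, and the coefficients are the values of the connection
  forms on the dual frame.\<close>

lemma conn_coeffs_spec:
  assumes reg: "regular A nab" and X: "X \<in> slit A" and c: "c \<in> charts_at A (fst X)" and Z: "Z \<in> TE A X"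
  shows "conn_form A nab c a b X Z = (\<Sum>d\<in>UNIV. Hcoeff A nab c a b d X * dx_form A c d Z) +
    (\<Sum>d\<in>UNIV. Vcoeff A nab c a b d X * omega_bar nab c d X Z)"
proof -
  \<comment> \<open>The would-be coframe as an endomorphism of the model space. A vector in its
    kernel is vertical and annihilated by \<nabla>y, hence zero; equal dimensions give
    bijectivity.\<close>
  define F where "F w = (fst w, \<chi> a. omega_bar nab c a X (cfield c w X))" for w :: "(real ^ 'n) \<times> (real ^ 'n)"
  have lb: "linear (\<lambda>w. omega_bar nab c a X (cfield c w X))" for a
    by (rule linear_cfield) (rule omega_bar_tlin[OF X])
  have lF: "linear F"
    by (rule linearI) (simp_all add: F_def prod_eq_iff vec_eq_iff linear_add[OF lb] linear_scale[OF lb])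
  have inj: "inj F" unfolding linear_injective_0[OF lF]
  proof (intro allI impI)
    fix w assume F0: "F w = 0"
    let ?Z = "cfield c w X"
    have w: "fst w = 0" "omega_bar nab c a X ?Z = 0" for a
      using F0 by (simp_all add: F_def prod_eq_iff vec_eq_iff)
    have v: "?Z \<in> vertical A X" "(\<lambda>_. 0) \<in> vertical A X"
      using w by (simp_all add: vertical_iff[OF X c] cfield_in zero_in_TE X c)
    note n = nab_in[OF X section_snd[OF X]]
    have z: "nab snd X (\<lambda>_. 0) = (\<lambda>_. 0)"
      using nab_tlin[OF X section_snd[OF X] zero_in_TE zero_in_TE, of 0 0] by (simp add: tlin_def)
    have "nab snd X ?Z = nab snd X (\<lambda>_. 0)" unfolding z
      by (rule base.tangent_eqI[OF c n[OF cfield_in] base.zero_in]) (use w(2) in \<open>simp add: omega_bar_def vec_eq_iff\<close>)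
    then have "?Z = (\<lambda>_. 0)" using reg X v unfolding regular_def by (auto dest: inj_onD)
    then have "?Z (lift_chart A c) = 0" by simp
    then show "w = 0" using X c by simp
  qed
  have surj: "surj F" using linear_injective_imp_surjective[OF lF inj] by simp
  define G where "G = inv F"
  have FG: "F (G w) = w" for w unfolding G_def using surj by (rule surj_f_inv_f)
  have GF: "G (F w) = w" for w unfolding G_def using inj by simp
  have lG: "linear G" by (rule linearI) (metis FG GF linear_add[OF lF], metis FG GF linear_scale[OF lF])
  let ?f = "\<lambda>a b w. conn_form A nab c a b X (cfield c (G w) X)"
  have lf: "linear (?f a b)" for a b
    using linear_compose[OF lG linear_cfield[where f = "conn_form A nab c a b X"], OF conn_form_tlin[OF X c]]
    by (simp add: comp_def)
  let ?P = "\<lambda>HV. \<forall>a b. \<forall>Z\<in>TE A X. conn_form A nab c a b X Z =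
       (\<Sum>d\<in>UNIV. fst HV a b d * dx_form A c d Z + snd HV a b d * omega_bar nab c d X Z)"
  define h where "h a b d = ?f a b (axis d 1, 0)" for a b d
  define v where "v a b d = ?f a b (0, axis d 1)" for a b d
  have ex: "?P (h, v)"
  proof (intro allI ballI)
    fix a b Z assume Z: "Z \<in> TE A X"
    let ?w = "Z (lift_chart A c)"
    have eZ: "cfield c ?w X = Z" using eq_cfield[OF X c Z] by simp
    have "conn_form A nab c a b X Z = ?f a b (F ?w)" by (simp only: GF eZ)
    also have "F ?w = (\<chi> d. dx_form A c d Z, \<chi> d. omega_bar nab c d X Z)"
      unfolding F_def eZ by (simp add: dx_form_def vec_eq_iff)
    also have "?f a b \<dots> = (\<Sum>d\<in>UNIV. dx_form A c d Z * h a b d) + (\<Sum>d\<in>UNIV. omega_bar nab c d X Z * v a b d)"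
      unfolding h_def v_def by (subst linear_pair_expansion[OF lf]) simp
    finally show "conn_form A nab c a b X Z = (\<Sum>d\<in>UNIV. fst (h, v) a b d * dx_form A c d Z + snd (h, v) a b d * omega_bar nab c d X Z)"
      by (simp add: sum.distrib mult.commute)
  qed
  have uniq: "HV = HV'" if p: "?P HV" "?P HV'" for HV HV'
  proof -
    have *: "omega_bar nab c d X (cfield c (G w) X) = snd w $ d" "dx_form A c d (cfield c (G w) X) = fst w $ d" for d w
    proof -
      have "snd (F (G w)) $ d = snd w $ d" "fst (F (G w)) $ d = fst w $ d" unfolding FG by simp_all
      then show "omega_bar nab c d X (cfield c (G w) X) = snd w $ d" "dx_form A c d (cfield c (G w) X) = fst w $ d"
        by (simp_all add: F_def X c)
    qed
    have "fst HV a b d = fst HV' a b d" for a b d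
      using p(1)[rule_format, OF cfield_in, of a b c "G (axis d 1, 0)"] p(2)[rule_format, OF cfield_in, of a b c "G (axis d 1, 0)"]
      by (simp add: *)
    moreover have "snd HV a b d = snd HV' a b d" for a b d
      using p(1)[rule_format, OF cfield_in, of a b c "G (0, axis d 1)"] p(2)[rule_format, OF cfield_in, of a b c "G (0, axis d 1)"]
      by (simp add: *)
    ultimately show ?thesis by (simp add: prod_eq_iff fun_eq_iff)
  qed
  have "?P (conn_coeffs A nab c X)" unfolding conn_coeffs_def
    by (rule theI[of ?P, OF ex]) (rule uniq[OF _ ex])
  then show ?thesis using Z by (simp add: Hcoeff_def Vcoeff_def sum.distrib)
qed

lemma connection_add:
  assumes W: "pullback_endo_form A W"
  shows "finsler_connection A (\<lambda>s X Z. tlin 1 (nab s X Z) 1 (W X Z (s X)))" (is "finsler_connection A ?n")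
  unfolding finsler_connection_def
proof (intro ballI conjI allI impI)
  fix X s assume X: "X \<in> slit A" and s: "smooth_section_near A s X"
  note sX = smooth_section_nearD(1)[OF s X]
  have W2: "linear_map_on (TE A X) (fibre A X) (\<lambda>Z. W X Z (s X))"
    using W X sX unfolding pullback_endo_form_def by blast
  show "linear_map_on (TE A X) (fibre A X) (?n s X)" unfolding linear_map_on_def
  proof (intro conjI ballI allI)
    fix Z assume "Z \<in> TE A X"
    then show "?n s X Z \<in> fibre A X" using W2 nab_in[OF X s] base.tlin_in unfolding linear_map_on_def by blast
  next
    fix Z Z' r q assume Z: "Z \<in> TE A X" "Z' \<in> TE A X"
    then have "W X (tlin r Z q Z') (s X) = tlin r (W X Z (s X)) q (W X Z' (s X))" using W2 unfolding linear_map_on_def by blast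
    then show "?n s X (tlin r Z q Z') = tlin r (?n s X Z) q (?n s X Z')"
      by (simp add: nab_tlin[OF X s Z]) (simp add: tlin_def fun_eq_iff algebra_simps)
  qed
next
  fix X s t Z assume X: "X \<in> slit A" and s: "smooth_section_near A s X" and t: "smooth_section_near A t X" and Z: "Z \<in> TE A X"
  have "linear_map_on (fibre A X) (fibre A X) (W X Z)" using W X Z unfolding pullback_endo_form_def by blast
  then have "W X Z (tlin 1 (s X) 1 (t X)) = tlin 1 (W X Z (s X)) 1 (W X Z (t X))"
    using smooth_section_nearD(1)[OF s X] smooth_section_nearD(1)[OF t X] unfolding linear_map_on_def by blast
  then show "?n (\<lambda>Y. tlin 1 (s Y) 1 (t Y)) X Z = tlin 1 (?n s X Z) 1 (?n t X Z)"
    by (simp add: nab_add[OF X s t Z]) (simp add: tlin_def fun_eq_iff)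
next
  fix X and f :: "('m, 'n) tpoint \<Rightarrow> real" and s Z C
  assume X: "X \<in> slit A" and f: "smooth_near (slit_atlas A) f X" and s: "smooth_section_near A s X"
    and Z: "Z \<in> TE A X" and C: "C \<in> charts_at (slit_atlas A) X"
  obtain c where c: "C = lift_chart A c" "c \<in> charts_at A (fst X)" using chart_atE[OF C] by metis
  have "linear_map_on (fibre A X) (fibre A X) (W X Z)" using W X Z unfolding pullback_endo_form_def by blast
  then have "W X Z (tlin (f X) (s X) 0 (s X)) = tlin (f X) (W X Z (s X)) 0 (W X Z (s X))"
    using smooth_section_nearD(1)[OF s X] unfolding linear_map_on_def by blast
  then have "W X Z (\<lambda>c. f X *\<^sub>R s X c) = (\<lambda>c. f X *\<^sub>R W X Z (s X) c)" by (simp add: tlin_def)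
  then show "?n (\<lambda>Y c. f Y *\<^sub>R s Y c) X Z = tlin (dir_deriv C f X Z) (s X) (f X) (?n s X Z)"
    by (simp add: nab_leibniz[OF X c(2) f s Z] c(1) dir_deriv_eq_pd) (simp add: tlin_def fun_eq_iff algebra_simps)
next
  fix X s Z c assume X: "X \<in> slit A" and s: "smooth_section_near A s X" and Z: "smooth_field_near A Z X"
    and c: "c \<in> charts_at A (fst X)"
  have C: "lift_chart A c \<in> charts_at (slit_atlas A) X" using X c by simp
  have w: "smooth_near (slit_atlas A) (\<lambda>Y. wcomp A W c a b Y (Z Y)) X" for a b
    using W X Z c unfolding pullback_endo_form_def by blast
  have 1: "smooth_near (slit_atlas A) (\<lambda>Y. \<Sum>b\<in>UNIV. s Y c $ b * wcomp A W c a b Y (Z Y)) X" for a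
    by (intro E.smooth_near_sum E.smooth_near_mult w smooth_section_nearD(3)[OF s c])
  have 2: "(\<Sum>b\<in>UNIV. s Y c $ b * wcomp A W c a b Y (Z Y)) = W Y (Z Y) (s Y) c $ a"
    if Y: "Y \<in> slit A" "c \<in> charts_at A (fst Y)" for Y a
  proof -
    have "linear_map_on (fibre A Y) (fibre A Y) (W Y (Z Y))"
      using W Y Z unfolding pullback_endo_form_def smooth_field_near_def by blast
    then have "linear_form_on (fibre A Y) (\<lambda>u. W Y (Z Y) u c $ a)"
      unfolding linear_map_on_def linear_form_on_def by (simp add: tlin_def)
    from linear_form_expansion[OF Y(2) this smooth_section_nearD(1)[OF s Y(1)]] show ?thesis by (simp add: wcomp_def)
  qed
  have "smooth_near (slit_atlas A) (\<lambda>Y. W Y (Z Y) (s Y) c $ a) X" for a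
    by (rule E.smooth_near_cong[OF C C _ 1[of a]]) (simp add: 2)
  then have "smooth_near (slit_atlas A) (\<lambda>Y. W Y (Z Y) (s Y) c) X" by (rule E.smooth_near_vec)
  then show "smooth_near (slit_atlas A) (\<lambda>Y. ?n s Y (Z Y) c) X"
    using smooth_nab[OF X s Z c] by (simp add: tlin_def E.smooth_near_add)
qed

lemma connection_difference:
  assumes "finsler_connection A nab'"
  obtains W where "pullback_endo_form A W"
    and "\<And>X c Z a b. X \<in> slit A \<Longrightarrow> c \<in> charts_at A (fst X) \<Longrightarrow>
      wcomp A W c a b X Z = conn_form A nab' c a b X Z - conn_form A nab c a b X Z"
proof -
  interpret N': connection_atlas A nab' by unfold_locales fact
  define W where "W X Z u = (\<lambda>c. if c \<in> charts_at A (fst X) then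
    (\<chi> a. \<Sum>b\<in>UNIV. (conn_form A nab' c a b X Z - conn_form A nab c a b X Z) * u c $ b) else 0)" for X Z u
  have comp: "wcomp A W c a b X Z = conn_form A nab' c a b X Z - conn_form A nab c a b X Z"
    if "X \<in> slit A" "c \<in> charts_at A (fst X)" for X c Z a b
    using that by (simp add: wcomp_def W_def)
  have Win: "W X Z u \<in> fibre A X" if X: "X \<in> slit A" and Z: "Z \<in> TE A X" and u: "u \<in> fibre A X" for X Z u
  proof -
    obtain c where c: "c \<in> charts_at A (fst X)" using chart_exists by blast
    \<comment> \<open>A section through \<open>u\<close>. In the difference of its two covariant
      derivatives the derivatives of its components cancel in every chart, so \<open>W X Z u\<close>
      is that difference and therefore a tangent vector.\<close>
    define s where "s Y = tvec_of A c (fst Y) (u c)" for Y :: "('m, 'n) tpoint"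
    have s: "smooth_section_near A s X" unfolding s_def using section_tvec_of[OF c] .
    have sX: "s X = u" unfolding s_def using base.tangent_eq_tvec_of[OF c u] by simp
    note n = nab_in[OF X s Z] and n' = N'.nab_in[OF X s Z]
    have "W X Z u = tlin 1 (nab' s X Z) (-1) (nab s X Z)"
    proof
      fix d show "W X Z u d = tlin 1 (nab' s X Z) (-1) (nab s X Z) d"
      proof (cases "d \<in> charts_at A (fst X)")
        case True
        then show ?thesis
          by (simp add: W_def tlin_def vec_eq_iff nab_component[OF X True s Z] N'.nab_component[OF X True s Z] sX
              left_diff_distrib sum_subtractf)
      next
        case False
        then show ?thesis using base.tangent_outside[OF n False] base.tangent_outside[OF n' False] by (simp add: W_def tlin_def)
      qed
    qed
    then show ?thesis using base.tlin_in[OF n' n] by simp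
  qed
  have "pullback_endo_form A W" unfolding pullback_endo_form_def
  proof (intro ballI conjI allI impI)
    fix X Z assume X: "X \<in> slit A" and Z: "Z \<in> TE A X"
    show "linear_map_on (fibre A X) (fibre A X) (W X Z)"
      unfolding linear_map_on_def using Win[OF X Z]
      by (auto simp: W_def tlin_def fun_eq_iff vec_eq_iff sum_distrib_left algebra_simps sum.distrib sum_subtractf)
  next
    fix X u assume X: "X \<in> slit A" and u: "u \<in> fibre A X"
    show "linear_map_on (TE A X) (fibre A X) (\<lambda>Z. W X Z u)"
      unfolding linear_map_on_def
    proof (intro ballI conjI allI)
      fix Z Z' r q assume Z: "Z \<in> TE A X" "Z' \<in> TE A X"
      show "W X (tlin r Z q Z') u = tlin r (W X Z u) q (W X Z' u)"
        by (auto simp: W_def tlin_apply fun_eq_iff vec_eq_iff conn_form_tlin[OF X _ Z] N'.conn_form_tlin[OF X _ Z]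
            sum_distrib_left algebra_simps sum.distrib sum_subtractf)
    qed (rule Win[OF X _ u])
  next
    fix X Z c a b assume X: "X \<in> slit A" and Z: "smooth_field_near A Z X" and c: "c \<in> charts_at A (fst X)"
    then have C: "lift_chart A c \<in> charts_at (slit_atlas A) X" by simp
    show "smooth_near (slit_atlas A) (\<lambda>Y. wcomp A W c a b Y (Z Y)) X"
      by (rule E.smooth_near_cong[OF C C _ E.smooth_near_diff[OF N'.smooth_conn_form[OF X c Z] smooth_conn_form[OF X c Z]]])
        (simp add: comp)
  qed
  then show thesis using that comp by blast
qed

end

section \<open>Endomorphism-valued forms given with a lowered index\<close>

context metric_atlas
begin

text \<open>The vectors obtained by raising the index in two charts have the same product with every
  \<open>v\<close>, by the invariance of \<beta>, so they agree by non-degeneracy. The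
  transformation law of the inverse metric is thereby avoided.\<close>

lemma endo_form_of_lowered:
  assumes lin: "\<And>X c a b Z Z' r q. X \<in> slit A \<Longrightarrow> c \<in> charts_at A (fst X) \<Longrightarrow> Z \<in> TE A X \<Longrightarrow> Z' \<in> TE A X \<Longrightarrow>
      \<beta> c a b X (tlin r Z q Z') = r * \<beta> c a b X Z + q * \<beta> c a b X Z'"
    and smooth: "\<And>X c a b Z. X \<in> slit A \<Longrightarrow> c \<in> charts_at A (fst X) \<Longrightarrow> smooth_field_near A Z X \<Longrightarrow>
      smooth_near (slit_atlas A) (\<lambda>Y. \<beta> c a b Y (Z Y)) X"
    and change: "\<And>X c d Z u v. X \<in> slit A \<Longrightarrow> c \<in> charts_at A (fst X) \<Longrightarrow> d \<in> charts_at A (fst X) \<Longrightarrow> Z \<in> TE A X \<Longrightarrow>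
      u \<in> fibre A X \<Longrightarrow> v \<in> fibre A X \<Longrightarrow>
      (\<Sum>a\<in>UNIV. \<Sum>b\<in>UNIV. u c $ a * v c $ b * \<beta> c a b X Z) = (\<Sum>a\<in>UNIV. \<Sum>b\<in>UNIV. u d $ a * v d $ b * \<beta> d a b X Z)"
  obtains W where "pullback_endo_form A W"
    and "\<And>X c Z a b. X \<in> slit A \<Longrightarrow> c \<in> charts_at A (fst X) \<Longrightarrow>
      wcomp A W c a b X Z = (\<Sum>d\<in>UNIV. ginv A g c a d X * \<beta> c d b X Z)"
proof -
  define r where "r c X Z u = (\<chi> a. \<Sum>b\<in>UNIV. (\<Sum>d\<in>UNIV. ginv A g c a d X * \<beta> c d b X Z) * u c $ b)"
    for c X Z and u :: "('m, real ^ 'n) tvec"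
  define W where "W X Z u = (\<lambda>c. if c \<in> charts_at A (fst X) then r c X Z u else 0)" for X Z u
  have comp: "wcomp A W c a b X Z = (\<Sum>d\<in>UNIV. ginv A g c a d X * \<beta> c d b X Z)"
    if "X \<in> slit A" "c \<in> charts_at A (fst X)" for X c Z a b
    using that by (simp add: wcomp_def W_def r_def)
  have gr: "g X v (tvec_of A c (fst X) (r c X Z u)) = (\<Sum>a\<in>UNIV. \<Sum>b\<in>UNIV. v c $ a * u c $ b * \<beta> c a b X Z)"
    if X: "X \<in> slit A" and c: "c \<in> charts_at A (fst X)" and v: "v \<in> fibre A X" for X c Z u v
  proof -
    have e: "r c X Z u $ a = (\<Sum>d\<in>UNIV. ginv A g c a d X * (\<Sum>b\<in>UNIV. \<beta> c d b X Z * u c $ b))" for a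
      unfolding r_def vec_lambda_beta sum_distrib_left sum_distrib_right by (subst sum.swap) (simp add: mult.assoc)
    have "g X v (tvec_of A c (fst X) (r c X Z u)) = (\<Sum>a\<in>UNIV. v c $ a * (\<Sum>b\<in>UNIV. gcomp A g c a b X * r c X Z u $ b))"
      by (simp add: g_expansion[OF X c v base.tvec_of_in] c sum_distrib_left mult_ac)
    then show ?thesis unfolding e lower_raise[OF X c] by (simp add: sum_distrib_left mult_ac)
  qed
  have Weq: "W X Z u = tvec_of A c (fst X) (r c X Z u)"
    if X: "X \<in> slit A" and c: "c \<in> charts_at A (fst X)" and Z: "Z \<in> TE A X" and u: "u \<in> fibre A X" for X c Z u
  proof
    fix d show "W X Z u d = tvec_of A c (fst X) (r c X Z u) d"
    proof (cases "d \<in> charts_at A (fst X)")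
      case d: True
      let ?x = "tvec_of A c (fst X) (r c X Z u)" and ?y = "tvec_of A d (fst X) (r d X Z u)"
      let ?z = "tlin 1 ?x (-1) ?y"
      have z: "?z \<in> fibre A X" by (intro base.tlin_in base.tvec_of_in)
      have "g X ?z v = 0" if v: "v \<in> fibre A X" for v
      proof -
        have "g X ?z v = g X v ?z" using g_sym[OF X z v] .
        also have "\<dots> = g X v ?x - g X v ?y"
          using g_linear[OF X v] base.tvec_of_in[of c "fst X"] base.tvec_of_in[of d "fst X"]
          unfolding linear_form_on_def by simp
        finally show ?thesis using gr[OF X c v] gr[OF X d v] change[OF X c d Z v u] by simp
      qed
      then have "?z = (\<lambda>_. 0)" using metric X z unfolding pullback_metric_def by blast
      from fun_cong[OF this, of d] have "?x d = ?y d" by (simp add: tlin_def)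
      then show ?thesis using d by (simp add: W_def)
    next
      case False then show ?thesis by (simp add: W_def tvec_of_def)
    qed
  qed
  have Win: "W X Z u \<in> fibre A X" if "X \<in> slit A" "Z \<in> TE A X" "u \<in> fibre A X" for X Z u
  proof -
    obtain c where c: "c \<in> charts_at A (fst X)" using chart_exists by blast
    show ?thesis unfolding Weq[OF that(1) c that(2,3)] by (rule base.tvec_of_in)
  qed
  have "pullback_endo_form A W" unfolding pullback_endo_form_def
  proof (intro ballI conjI allI impI)
    fix X Z assume X: "X \<in> slit A" and Z: "Z \<in> TE A X"
    show "linear_map_on (fibre A X) (fibre A X) (W X Z)"
      unfolding linear_map_on_def using Win[OF X Z]
      by (auto simp: W_def r_def tlin_def fun_eq_iff vec_eq_iff sum_distrib_left algebra_simps sum.distrib)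
  next
    fix X u assume X: "X \<in> slit A" and u: "u \<in> fibre A X"
    show "linear_map_on (TE A X) (fibre A X) (\<lambda>Z. W X Z u)"
      unfolding linear_map_on_def
    proof (intro ballI conjI allI)
      fix Z Z' p q assume Z: "Z \<in> TE A X" "Z' \<in> TE A X"
      show "W X (tlin p Z q Z') u = tlin p (W X Z u) q (W X Z' u)"
      proof
        fix d
        show "W X (tlin p Z q Z') u d = tlin p (W X Z u) q (W X Z' u) d"
          using lin[OF X _ Z, of d]
          by (cases "d \<in> charts_at A (fst X)")
            (simp_all add: W_def r_def tlin_apply vec_eq_iff sum_distrib_left algebra_simps sum.distrib)
      qed
    qed (rule Win[OF X _ u])
  next
    fix X Z c a b assume X: "X \<in> slit A" and Z: "smooth_field_near A Z X" and c: "c \<in> charts_at A (fst X)"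
    then have C: "lift_chart A c \<in> charts_at (slit_atlas A) X" by simp
    have "smooth_near (slit_atlas A) (\<lambda>Y. \<Sum>d\<in>UNIV. ginv A g c a d Y * \<beta> c d b Y (Z Y)) X"
      by (intro E.smooth_near_sum E.smooth_near_mult smooth_ginv[OF X c] smooth[OF X c Z])
    then show "smooth_near (slit_atlas A) (\<lambda>Y. wcomp A W c a b Y (Z Y)) X"
      by (rule E.smooth_near_cong[OF C C, rotated]) (simp add: comp)
  qed
  then show thesis using that comp by blast
qed

end

section \<open>Characterization by symmetry and transversality\<close>

text \<open>Six alternating transpositions lead back to the original order of indices, and three of
  them change the sign.\<close>

lemma antisym_sym_zero:
  fixes J :: "'i \<Rightarrow> 'i \<Rightarrow> 'i \<Rightarrow> real"
  assumes "\<And>a b d. J a b d = - J b a d" "\<And>a b d. J a b d = J a d b"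
  shows "J a b d = 0"
  using assms(1)[of a b d] assms(2)[of b a d] assms(1)[of b d a] assms(2)[of d b a] assms(1)[of d a b] assms(2)[of a d b]
  by simp

section \<open>The frame adapted to the Barthel connection\<close>

context hessian_metric
begin

text \<open>The vectors \<open>\<delta>/\<delta>x\<^sup>d\<close>. Together with
  \<open>vfield\<close> they form the frame dual to the coframe of \<open>dx_form\<close> and
  \<open>barthel_form\<close>.\<close>

definition hfield :: "('m, real ^ 'n) chart \<Rightarrow> 'n \<Rightarrow> ('m, 'n) tpoint \<Rightarrow> ('m, 'n) etvec" where
  "hfield c d X = cfield c (axis d 1, - (\<chi> a. N c a d X)) X"

definition vfield :: "('m, real ^ 'n) chart \<Rightarrow> 'n \<Rightarrow> ('m, 'n) tpoint \<Rightarrow> ('m, 'n) etvec" where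
  "vfield c d X = cfield c (0, axis d 1) X"

definition barthel_form :: "('m, real ^ 'n) chart \<Rightarrow> 'n \<Rightarrow> ('m, 'n) tpoint \<Rightarrow> ('m, 'n) etvec \<Rightarrow> real" where
  "barthel_form c a X Z = dy_form A c a Z + (\<Sum>d\<in>UNIV. N c a d X * dx_form A c d Z)"

abbreviation "Gam_barthel c a b d X \<equiv> Gam c (\<lambda>a b. N c a b X) a b d X"

lemma hfield_in: "hfield c d X \<in> TE A X" and vfield_in: "vfield c d X \<in> TE A X"
  by (simp_all add: hfield_def vfield_def cfield_in)

lemma forms_hfield:
  assumes "X \<in> slit A" "c \<in> charts_at A (fst X)"
  shows "dx_form A c a (hfield c d X) = axis d 1 $ a" "barthel_form c a X (hfield c d X) = 0"
    "dx_form A c a (vfield c d X) = 0" "barthel_form c a X (vfield c d X) = axis d 1 $ a"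
  using assms by (simp_all add: hfield_def vfield_def barthel_form_def)

lemma adapted_expansion:
  assumes X: "X \<in> slit A" and c: "c \<in> charts_at A (fst X)" and Z: "Z \<in> TE A X"
    and f: "\<And>Z W r q. Z \<in> TE A X \<Longrightarrow> W \<in> TE A X \<Longrightarrow> f (tlin r Z q W) = r * f Z + q * (f W :: real)"
  shows "f Z = (\<Sum>d\<in>UNIV. dx_form A c d Z * f (hfield c d X)) + (\<Sum>d\<in>UNIV. barthel_form c d X Z * f (vfield c d X))"
proof -
  let ?h = "\<lambda>w. f (cfield c w X)"
  have l: "linear ?h" by (rule linear_cfield[OF f])
  let ?u = "\<lambda>d. dx_form A c d Z" and ?w = "\<lambda>d. dy_form A c d Z"
  have exp: "?h (u, w) = (\<Sum>d\<in>UNIV. u $ d * ?h (axis d 1, 0)) + (\<Sum>d\<in>UNIV. w $ d * f (vfield c d X))" for u w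
    unfolding vfield_def by (rule linear_pair_expansion[OF l])
  have h0: "?h (axis d 1, 0) = f (hfield c d X) + (\<Sum>a\<in>UNIV. N c a d X * f (vfield c a X))" for d
    using exp[of "axis d 1" "- (\<chi> a. N c a d X)"] unfolding hfield_def by (simp add: sum_negf)
  have "f Z = ?h (fst (Z (lift_chart A c)), snd (Z (lift_chart A c)))" using eq_cfield[OF X c Z] by simp
  also have "\<dots> = (\<Sum>d\<in>UNIV. ?u d * ?h (axis d 1, 0)) + (\<Sum>d\<in>UNIV. ?w d * f (vfield c d X))"
    unfolding dx_form_def dy_form_def by (rule exp)
  also have "\<dots> = (\<Sum>d\<in>UNIV. ?u d * (f (hfield c d X) + (\<Sum>a\<in>UNIV. N c a d X * f (vfield c a X)))) + (\<Sum>d\<in>UNIV. ?w d * f (vfield c d X))"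
    by (simp only: h0)
  also have "(\<Sum>d\<in>UNIV. ?u d * (f (hfield c d X) + (\<Sum>a\<in>UNIV. N c a d X * f (vfield c a X)))) =
      (\<Sum>d\<in>UNIV. ?u d * f (hfield c d X)) + (\<Sum>a\<in>UNIV. (\<Sum>d\<in>UNIV. N c a d X * ?u d) * f (vfield c a X))"
  proof -
    have "(\<Sum>d\<in>UNIV. ?u d * (\<Sum>a\<in>UNIV. N c a d X * f (vfield c a X))) = (\<Sum>a\<in>UNIV. (\<Sum>d\<in>UNIV. N c a d X * ?u d) * f (vfield c a X))"
      unfolding sum_distrib_left sum_distrib_right by (subst sum.swap) (simp add: mult_ac)
    then show ?thesis by (simp add: distrib_left sum.distrib)
  qed
  finally show ?thesis by (simp add: barthel_form_def distrib_right sum.distrib)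
qed

lemma pd_hfield_gcomp:
  assumes X: "X \<in> slit A" and c: "c \<in> charts_at A (fst X)"
  shows "pd (lift_chart A c) (hfield c d X (lift_chart A c)) (gcomp A g c a b) X = gx c a b d X - 2 * (\<Sum>e\<in>UNIV. N c e d X * Ct c a b e X)"
  using pd_expansion[OF X c smooth_gcomp[OF X c], of "axis d 1" "- (\<chi> a. N c a d X)" a b] X c
  by (simp add: hfield_def gx_def dy_gcomp sum_negf sum_distrib_left mult.left_commute)

end

section \<open>Canonical connections\<close>

locale hessian_finsler = finsler A g nab + hessian_metric A g
  for A :: "('m::{t2_space, second_countable_topology}, real ^ 'n) chart set"
    and g :: "('m, 'n) cotensor2" and nab :: "('m, 'n) connection"
begin

lemma olow_tlin:
  assumes "X \<in> slit A" "c \<in> charts_at A (fst X)" "Z \<in> TE A X" "W \<in> TE A X"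
  shows "olow c a b X (tlin r Z q W) = r * olow c a b X Z + q * olow c a b X W"
  unfolding olow_def conn_form_tlin[OF assms]
  by (simp add: distrib_left sum.distrib sum_distrib_left mult.left_commute)

text \<open>Symmetry and transversality of \<open>V\<^sub>a\<^sub>b\<^sub>d\<close> and of \<open>H\<^sub>a\<^sub>b\<^sub>d - \<Gamma>\<^sub>a\<^sub>b\<^sub>d\<close>, in terms of the connection forms.\<close>

definition canonical :: bool where
  "canonical \<longleftrightarrow> (\<forall>X\<in>slit A. \<forall>c\<in>charts_at A (fst X). \<forall>b d.
     (\<forall>a. olow c a b X (vfield c d X) = olow c b a X (vfield c d X)) \<and>
     (\<Sum>a\<in>UNIV. ycoord c a X * olow c a b X (vfield c d X)) = 0 \<and>
     (\<forall>a. olow c a b X (hfield c d X) - Gam_barthel c a b d X = olow c b a X (hfield c d X) - Gam_barthel c b a d X) \<and>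
     (\<Sum>a\<in>UNIV. ycoord c a X * (olow c a b X (hfield c d X) - Gam_barthel c a b d X)) = 0)"

lemma canonicalD:
  assumes "canonical" "X \<in> slit A" "c \<in> charts_at A (fst X)"
  shows "olow c a b X (vfield c d X) = olow c b a X (vfield c d X)"
    and "(\<Sum>a\<in>UNIV. ycoord c a X * olow c a b X (vfield c d X)) = 0"
    and "olow c a b X (hfield c d X) - Gam_barthel c a b d X = olow c b a X (hfield c d X) - Gam_barthel c b a d X"
    and "(\<Sum>a\<in>UNIV. ycoord c a X * (olow c a b X (hfield c d X) - Gam_barthel c a b d X)) = 0"
  using assms unfolding canonical_def by blast+

lemma omega_bar_barthel:
  assumes X: "X \<in> slit A" and c: "c \<in> charts_at A (fst X)" and Z: "Z \<in> TE A X"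
    and low: "\<And>a. (\<Sum>b\<in>UNIV. olow c a b X Z * ycoord c b X) = (\<Sum>d\<in>UNIV. (\<Sum>b\<in>UNIV. gcomp A g c a b X * N c b d X) * dx_form A c d Z)"
  shows "omega_bar nab c a X Z = barthel_form c a X Z"
proof -
  have "(\<Sum>b\<in>UNIV. conn_form A nab c a b X Z * ycoord c b X) = (\<Sum>d\<in>UNIV. N c a d X * dx_form A c d Z)"
  proof (rule lower_inject[OF X c, where h = "\<lambda>a. \<Sum>b\<in>UNIV. conn_form A nab c a b X Z * ycoord c b X"
        and k = "\<lambda>a. \<Sum>d\<in>UNIV. N c a d X * dx_form A c d Z"])
    fix a
    have "(\<Sum>e\<in>UNIV. gcomp A g c a e X * (\<Sum>b\<in>UNIV. conn_form A nab c e b X Z * ycoord c b X)) = (\<Sum>b\<in>UNIV. olow c a b X Z * ycoord c b X)"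
      unfolding olow_def sum_distrib_left sum_distrib_right by (subst sum.swap) (simp add: mult_ac)
    also have "\<dots> = (\<Sum>e\<in>UNIV. gcomp A g c a e X * (\<Sum>d\<in>UNIV. N c e d X * dx_form A c d Z))"
      unfolding low sum_distrib_left sum_distrib_right by (subst sum.swap) (simp add: mult_ac)
    finally show "(\<Sum>e\<in>UNIV. gcomp A g c a e X * (\<Sum>b\<in>UNIV. conn_form A nab c e b X Z * ycoord c b X)) =
        (\<Sum>e\<in>UNIV. gcomp A g c a e X * (\<Sum>d\<in>UNIV. N c e d X * dx_form A c d Z))" .
  qed
  then show ?thesis unfolding omega_bar_eq[OF X c Z] barthel_form_def by simp
qed

text \<open>Symmetry moves the contraction with y from the first to the second index, so the
  deviation from \<Gamma> contributes nothing, while \<Gamma> itself contracts to N. Strong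
  regularity and the form of the horizontal distribution are consequences of this identity.\<close>

lemma canonical_omega_bar:
  assumes can: "canonical" and X: "X \<in> slit A" and c: "c \<in> charts_at A (fst X)" and Z: "Z \<in> TE A X"
  shows "omega_bar nab c a X Z = barthel_form c a X Z"
proof (rule omega_bar_barthel[OF X c Z])
  fix a
  let ?f = "\<lambda>Z. \<Sum>b\<in>UNIV. olow c a b X Z * ycoord c b X"
  have v0: "?f (vfield c d X) = 0" for d
    using canonicalD(2)[OF can X c, of a d] by (simp add: canonicalD(1)[OF can X c, of a] mult.commute)
  have h0: "?f (hfield c d X) = (\<Sum>b\<in>UNIV. gcomp A g c a b X * N c b d X)" for d
  proof -
    have "olow c a b X (hfield c d X) * ycoord c b X = ycoord c b X * (olow c b a X (hfield c d X) - Gam_barthel c b a d X) +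
        ycoord c b X * Gam_barthel c a b d X" for b
      using canonicalD(3)[OF can X c, of a b d] by (simp add: distrib_left[symmetric])
    then show ?thesis using canonicalD(4)[OF can X c, of a d] Gam_barthel_contract[OF X c, of a d] by (simp add: sum.distrib)
  qed
  have "?f Z = (\<Sum>d\<in>UNIV. dx_form A c d Z * ?f (hfield c d X)) + (\<Sum>d\<in>UNIV. barthel_form c d X Z * ?f (vfield c d X))"
    by (rule adapted_expansion[OF X c Z])
      (simp add: olow_tlin[OF X c] distrib_right sum.distrib sum_distrib_left mult.assoc)
  then show "?f Z = (\<Sum>d\<in>UNIV. (\<Sum>b\<in>UNIV. gcomp A g c a b X * N c b d X) * dx_form A c d Z)"
    unfolding h0 v0 by (simp add: mult.commute)
qed

lemma canonical_strongly_regular: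
  assumes can: "canonical"
  shows "strongly_regular A nab"
  unfolding strongly_regular_def
proof (intro ballI allI)
  fix X Z c a assume X: "X \<in> slit A" and Z: "Z \<in> vertical A X" and c: "c \<in> charts_at A (fst X)"
  then have "Z \<in> TE A X" "\<And>d. dx_form A c d Z = 0" by (auto simp: vertical_def)
  then show "nab snd X Z c $ a = dy_form A c a Z"
    using canonical_omega_bar[OF can X c, of Z a] by (simp add: omega_bar_def barthel_form_def)
qed

lemma strongly_regular_regular:
  assumes "strongly_regular A nab"
  shows "regular A nab"
  unfolding regular_def
proof (intro ballI inj_onI)
  fix X Z W assume X: "X \<in> slit A" and Z: "Z \<in> vertical A X" "W \<in> vertical A X" and eq: "nab snd X Z = nab snd X W"
  obtain c where c: "c \<in> charts_at A (fst X)" using chart_exists by blast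
  have T: "Z \<in> TE A X" "W \<in> TE A X" using Z by (auto simp: vertical_def)
  have "dy_form A c a Z = dy_form A c a W" for a
    using assms X Z c eq unfolding strongly_regular_def by metis
  then have "snd (Z (lift_chart A c)) = snd (W (lift_chart A c))" by (simp add: dy_form_def vec_eq_iff)
  moreover have "fst (Z (lift_chart A c)) = fst (W (lift_chart A c))" using Z T vertical_iff[OF X c] by simp
  ultimately have "Z (lift_chart A c) = W (lift_chart A c)" by (rule prod_eqI[rotated])
  then show "Z = W" using E.tangent_eqI[of "lift_chart A c" X Z W] X c T by simp
qed

lemma canonical_horizontal:
  assumes can: "canonical" and X: "X \<in> slit A"
  shows "horizontal A nab X = barthel_horizontal A L X"
proof -
  have "nab snd X Z = (\<lambda>_. 0) \<longleftrightarrow> (\<forall>c\<in>charts_at A (fst X). \<forall>a. barthel_form c a X Z = 0)" if Z: "Z \<in> TE A X" for Z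
  proof
    assume z: "nab snd X Z = (\<lambda>_. 0)"
    then show "\<forall>c\<in>charts_at A (fst X). \<forall>a. barthel_form c a X Z = 0"
      using canonical_omega_bar[OF can X _ Z] by (simp add: omega_bar_def)
  next
    assume z: "\<forall>c\<in>charts_at A (fst X). \<forall>a. barthel_form c a X Z = 0"
    obtain c where c: "c \<in> charts_at A (fst X)" using chart_exists by blast
    show "nab snd X Z = (\<lambda>_. 0)"
      by (rule base.tangent_eqI[OF c nab_in[OF X section_snd[OF X] Z] base.zero_in])
        (use z c canonical_omega_bar[OF can X c Z] in \<open>simp add: vec_eq_iff omega_bar_def\<close>)
  qed
  then show ?thesis
    unfolding horizontal_def barthel_horizontal_def barthel_form_def by (auto simp: eq_neg_iff_add_eq_0)
qed

text \<open>\<nabla>y is the Barthel form, so \<open>hfield\<close> and \<open>vfield\<close> are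
  dual to the coframe in which H and V are defined, and the coefficients are values on this
  frame.\<close>

lemma canonical_coeffs:
  assumes can: "canonical" and X: "X \<in> slit A" and c: "c \<in> charts_at A (fst X)"
  shows "Hcoeff A nab c a b d X = conn_form A nab c a b X (hfield c d X)"
    and "Vcoeff A nab c a b d X = conn_form A nab c a b X (vfield c d X)"
    and "lower3 A g (Hcoeff A nab) c a b d X = olow c a b X (hfield c d X)"
    and "lower3 A g (Vcoeff A nab) c a b d X = olow c a b X (vfield c d X)"
proof -
  have reg: "regular A nab" using can canonical_strongly_regular strongly_regular_regular by blast
  note spec = conn_coeffs_spec[OF reg X c, unfolded canonical_omega_bar[OF can X c]]
  show h: "Hcoeff A nab c a b d X = conn_form A nab c a b X (hfield c d X)" for a
    using conn_coeffs_spec[OF reg X c hfield_in, of a b c d]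
    by (simp add: canonical_omega_bar[OF can X c hfield_in] forms_hfield[OF X c])
  show v: "Vcoeff A nab c a b d X = conn_form A nab c a b X (vfield c d X)" for a
    using conn_coeffs_spec[OF reg X c vfield_in, of a b c d]
    by (simp add: canonical_omega_bar[OF can X c vfield_in] forms_hfield[OF X c])
  show "lower3 A g (Hcoeff A nab) c a b d X = olow c a b X (hfield c d X)"
    "lower3 A g (Vcoeff A nab) c a b d X = olow c a b X (vfield c d X)"
    by (simp_all add: lower3_def olow_def h v)
qed

text \<open>The coefficients refer to \<nabla>y, whereas \<open>canonical\<close> refers to the
  Barthel frame. The contraction with y identifies the two, and only afterwards can H and V be read
  off on that frame.\<close>

lemma canonical_of_coeffs:
  assumes reg: "regular A nab"
    and H: "\<And>X c a b d. X \<in> slit A \<Longrightarrow> c \<in> charts_at A (fst X) \<Longrightarrow>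
      lower3 A g (Hcoeff A nab) c a b d X = Gam_barthel c a b d X + S c a b d X"
    and S: "sym_transverse A S" and V: "sym_transverse A (lower3 A g (Vcoeff A nab))"
  shows "canonical"
proof -
  have low: "olow c a b X Z = (\<Sum>d\<in>UNIV. lower3 A g (Hcoeff A nab) c a b d X * dx_form A c d Z) +
      (\<Sum>d\<in>UNIV. lower3 A g (Vcoeff A nab) c a b d X * omega_bar nab c d X Z)"
    if X: "X \<in> slit A" and c: "c \<in> charts_at A (fst X)" and Z: "Z \<in> TE A X" for X c Z a b
  proof -
    have sw: "(\<Sum>e\<in>UNIV. gcomp A g c a e X * (\<Sum>d\<in>UNIV. K e d * \<theta> d)) = (\<Sum>d\<in>UNIV. (\<Sum>e\<in>UNIV. gcomp A g c a e X * K e d) * \<theta> d)"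
      for K :: "'n \<Rightarrow> 'n \<Rightarrow> real" and \<theta>
      unfolding sum_distrib_left sum_distrib_right by (subst sum.swap) (simp add: mult_ac)
    show ?thesis
      unfolding olow_def conn_coeffs_spec[OF reg X c Z] distrib_left sum.distrib sw lower3_def ..
  qed
  have Ssym: "S c a b d X = S c b a d X" and Str: "(\<Sum>a\<in>UNIV. ycoord c a X * S c a b d X) = 0"
    and Vsym: "lower3 A g (Vcoeff A nab) c a b d X = lower3 A g (Vcoeff A nab) c b a d X"
    and Vtr: "(\<Sum>a\<in>UNIV. ycoord c a X * lower3 A g (Vcoeff A nab) c a b d X) = 0"
    if "X \<in> slit A" "c \<in> charts_at A (fst X)" for X c a b d
    using S V that unfolding sym_transverse_def by blast+
  have bar: "omega_bar nab c a X Z = barthel_form c a X Z"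
    if X: "X \<in> slit A" and c: "c \<in> charts_at A (fst X)" and Z: "Z \<in> TE A X" for X c Z a
  proof (rule omega_bar_barthel[OF X c Z])
    fix a
    let ?y = "\<lambda>b. ycoord c b X"
    have sw: "(\<Sum>b\<in>UNIV. (\<Sum>d\<in>UNIV. K b d * \<theta> d) * ?y b) = (\<Sum>d\<in>UNIV. (\<Sum>b\<in>UNIV. ?y b * K b d) * \<theta> d)"
      for K :: "'n \<Rightarrow> 'n \<Rightarrow> real" and \<theta>
      unfolding sum_distrib_left sum_distrib_right by (subst sum.swap) (simp add: mult_ac)
    have v: "(\<Sum>b\<in>UNIV. ?y b * lower3 A g (Vcoeff A nab) c a b d X) = 0" for d
      using Vtr[OF X c, of a d] by (simp add: Vsym[OF X c, of a])
    have h: "(\<Sum>b\<in>UNIV. ?y b * lower3 A g (Hcoeff A nab) c a b d X) = (\<Sum>b\<in>UNIV. gcomp A g c a b X * N c b d X)" for d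
      using Str[OF X c, of a d] Gam_barthel_contract[OF X c, of a d]
      by (simp add: H[OF X c] distrib_left sum.distrib Ssym[OF X c, of a])
    show "(\<Sum>b\<in>UNIV. olow c a b X Z * ?y b) = (\<Sum>d\<in>UNIV. (\<Sum>b\<in>UNIV. gcomp A g c a b X * N c b d X) * dx_form A c d Z)"
      unfolding low[OF X c Z] distrib_right sum.distrib sw v h by simp
  qed
  have hv: "olow c a b X (hfield c d X) = Gam_barthel c a b d X + S c a b d X"
    "olow c a b X (vfield c d X) = lower3 A g (Vcoeff A nab) c a b d X"
    if "X \<in> slit A" "c \<in> charts_at A (fst X)" for X c a b d
    using low[OF that hfield_in, of a b c d] low[OF that vfield_in, of a b c d]
    by (simp_all add: bar[OF that hfield_in] bar[OF that vfield_in] forms_hfield[OF that] H[OF that])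
  show ?thesis
    unfolding canonical_def using hv Ssym Str Vsym Vtr by simp
qed

lemma conds_imp_canonical:
  assumes conds: "conds_alpha_epsilon A g nab"
  shows "canonical"
proof -
  have beta: "cond_beta A g nab" and delta: "cond_delta A g nab" and eps: "cond_epsilon A g nab"
    using conds by (simp_all add: conds_alpha_epsilon_def)
  have can: "(\<forall>a. olow c a b X (vfield c d X) = olow c b a X (vfield c d X)) \<and>
     (\<Sum>a\<in>UNIV. ycoord c a X * olow c a b X (vfield c d X)) = 0 \<and>
     (\<forall>a. olow c a b X (hfield c d X) - Gam_barthel c a b d X = olow c b a X (hfield c d X) - Gam_barthel c b a d X) \<and>
     (\<Sum>a\<in>UNIV. ycoord c a X * (olow c a b X (hfield c d X) - Gam_barthel c a b d X)) = 0"
    if X: "X \<in> slit A" and c: "c \<in> charts_at A (fst X)" for X c b d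
  proof -
    let ?y = "\<lambda>a. ycoord c a X"
    let ?\<omega> = "\<lambda>a b. conn_form A nab c a b X"
    have Vsym: "olow c a b X (cfield c (0, w) X) = olow c b a X (cfield c (0, w) X)" for a b w
      by (rule vertical_olow_sym[OF beta X c cfield_in]) (simp add: X c)
    have eps': "(\<Sum>a\<in>UNIV. ?y a * Dg A g nab c a b X Z) = 0" if "Z \<in> TE A X" for b Z
      using eps X c that unfolding cond_epsilon_def by blast
    \<comment> \<open>In (\<epsilon>) on a vertical vector the derivative of the metric is killed by
      y, and the two connection terms coincide by symmetry.\<close>
    have Vtr: "(\<Sum>a\<in>UNIV. ?y a * olow c a b X (cfield c (0, w) X)) = 0" for b w
    proof -
      have "(\<Sum>a\<in>UNIV. ?y a * pd (lift_chart A c) (0, w) (gcomp A g c a b) X) =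
          (\<Sum>k\<in>UNIV. w $ k * (\<Sum>a\<in>UNIV. ?y a * dy A c k (gcomp A g c a b) X))"
        unfolding pd_expansion[OF X c smooth_gcomp[OF X c]] sum_distrib_left
        by (subst sum.swap) (simp add: sum_distrib_left mult_ac)
      then have "(\<Sum>a\<in>UNIV. ?y a * pd (lift_chart A c) (0, w) (gcomp A g c a b) X) = 0"
        by (simp add: dy_transverse[OF X c])
      moreover have "(\<Sum>a\<in>UNIV. ?y a * Dg A g nab c a b X (cfield c (0, w) X)) =
          (\<Sum>a\<in>UNIV. ?y a * pd (lift_chart A c) (0, w) (gcomp A g c a b) X) - 2 * (\<Sum>a\<in>UNIV. ?y a * olow c a b X (cfield c (0, w) X))"
        by (simp add: Dg_eq[OF X] Vsym[of b] X c right_diff_distrib sum_subtractf) (simp add: sum_distrib_left mult.left_commute)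
      ultimately show ?thesis using eps'[OF cfield_in[of c "(0, w)" X], of b] by simp
    qed
    have Vy: "(\<Sum>b\<in>UNIV. ?\<omega> a b (cfield c (0, w) X) * ?y b) = 0" for a w
    proof (rule lower_inject[OF X c, where h = "\<lambda>a. \<Sum>b\<in>UNIV. ?\<omega> a b (cfield c (0, w) X) * ?y b" and k = "\<lambda>_. 0"])
      fix a
      have "(\<Sum>e\<in>UNIV. gcomp A g c a e X * (\<Sum>b\<in>UNIV. ?\<omega> e b (cfield c (0, w) X) * ?y b)) = (\<Sum>b\<in>UNIV. ?y b * olow c a b X (cfield c (0, w) X))"
        unfolding olow_def sum_distrib_left by (subst sum.swap) (simp add: mult_ac)
      also have "\<dots> = 0" using Vtr[of a w] by (simp add: Vsym[of a])
      finally show "(\<Sum>e\<in>UNIV. gcomp A g c a e X * (\<Sum>b\<in>UNIV. ?\<omega> e b (cfield c (0, w) X) * ?y b)) = (\<Sum>d\<in>UNIV. gcomp A g c a d X * 0)" by simp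
    qed
    \<comment> \<open>The coefficients of the non-linear connection induced by \<nabla>. They may be
      read off on \<partial>/\<partial>x instead of on the horizontal vectors \<open>h\<close>,
      because the forms contracted with y vanish on vertical vectors.\<close>
    define M where "M a d = (\<Sum>b\<in>UNIV. ?\<omega> a b (cfield c (axis d 1, 0) X) * ?y b)" for a d
    define h where "h d = cfield c (axis d 1, - (\<chi> a. M a d)) X" for d
    have hT: "h d \<in> TE A X" for d by (simp add: h_def cfield_in)
    have \<omega>h: "(\<Sum>b\<in>UNIV. ?\<omega> a b (h d) * ?y b) = M a d" for a d
    proof -
      have "h d = tlin 1 (cfield c (axis d 1, 0) X) 1 (cfield c (0, - (\<chi> a. M a d)) X)"
        unfolding h_def cfield_linear[symmetric] by simp
      then show ?thesis
        using Vy[of a "- (\<chi> a. M a d)"]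
        by (simp add: conn_form_tlin[OF X c cfield_in cfield_in] distrib_right sum.distrib M_def)
    qed
    have bar: "omega_bar nab c a X (h d) = 0" "omega_bar nab c a X (cfield c (0, w) X) = w $ a" for a d w
      unfolding omega_bar_eq[OF X c hT] omega_bar_eq[OF X c cfield_in] \<omega>h Vy by (simp_all add: h_def X c)
    have dxh: "dx_form A c a (h d) = axis d 1 $ a" for a d by (simp add: h_def X c)
    \<comment> \<open>(\<delta>) on two horizontal vectors and one vertical vector: \<nabla>y
      vanishes on the former and is dual to the latter, so a single value of \<Psi>
      survives.\<close>
    have As: "Alow c k j X (h i) = Alow c k i X (h j)" for i j k
    proof -
      have "(\<Sum>b\<in>UNIV. Psi_low c b X (h i) (h j) * axis k 1 $ b) = 0"
        using delta[unfolded cond_delta_def, rule_format, OF X c hT[of i] hT[of j] cfield_in[of c "(0, axis k 1)"]]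
        by (simp add: wedge21_lower[OF X] bar)
      then show ?thesis using Psi_low_eq[OF X c, of k "h i" "h j"] by (simp add: dxh)
    qed
    let ?dg = "\<lambda>a b d. gx c a b d X - 2 * (\<Sum>e\<in>UNIV. M e d * Ct c a b e X)"
    have dg: "pd (lift_chart A c) (h d (lift_chart A c)) (gcomp A g c a b) X = ?dg a b d" for a b d
      using pd_expansion[OF X c smooth_gcomp[OF X c], of "axis d 1" "- (\<chi> a. M a d)" a b] X c
      by (simp add: h_def gx_def dy_gcomp sum_negf sum_distrib_left mult.left_commute)
    have dgsym: "?dg a b d = ?dg b a d" for a b d
      by (simp add: gx_sym[OF X c, of b a] Ct_sym12[OF X c, of b a])
    let ?K = "\<lambda>a b d. olow c a b X (h d) - olow c b a X (h d)"
    let ?G = "\<lambda>a b d. Gam c M a b d X"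
    have "(?K a b d - (?G a b d - ?G b a d)) = 0" for a b d
    proof (rule antisym_sym_zero[where J = "\<lambda>a b d. ?K a b d - (?G a b d - ?G b a d)"])
      fix a b d
      show "?K a b d - (?G a b d - ?G b a d) = - (?K b a d - (?G b a d - ?G a b d))" by simp
      have "?dg a b d + ?K a b d = ?dg a d b + ?K a d b" using As[of a b d] unfolding Alow_def dg by simp
      then show "?K a b d - (?G a b d - ?G b a d) = ?K a d b - (?G a d b - ?G d a b)"
        unfolding Gam_diff[OF X c] using dgsym[of d b a] by simp
    qed
    then have Hsym: "olow c a b X (h d) - ?G a b d = olow c b a X (h d) - ?G b a d" for a b d
      by (simp add: algebra_simps)
    have Htr: "(\<Sum>a\<in>UNIV. ?y a * (olow c a b X (h d) - ?G a b d)) = 0" for b d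
    proof -
      have D: "Dg A g nab c a b X (h d) = - 2 * (olow c a b X (h d) - ?G a b d)" for a
        using Gam_metric[OF X c, of M a b d] Hsym[of a b d] unfolding Dg_eq[OF X] dg by simp
      have e: "(\<Sum>a\<in>UNIV. ?y a * (- 2 * U a)) = - 2 * (\<Sum>a\<in>UNIV. ?y a * U a)" for U
        by (simp add: sum_distrib_left mult.left_commute sum_negf)
      from eps'[OF hT[of d], of b] have "- 2 * (\<Sum>a\<in>UNIV. ?y a * (olow c a b X (h d) - ?G a b d)) = 0"
        unfolding D e .
      then show ?thesis by simp
    qed
    \<comment> \<open>Lowered, \<open>M\<close> is a connection form contracted with y. Its
      deviation from the \<Gamma> built with \<open>M\<close> drops out, which leaves the implicit
      equation of \<open>barthel_unique\<close>.\<close>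
    have "(\<Sum>b\<in>UNIV. gcomp A g c a b X * M b k) = xi c a k X - (\<Sum>b\<in>UNIV. Ct c a k b X * (\<Sum>d\<in>UNIV. M b d * ?y d))" for a k
    proof -
      have "(\<Sum>e\<in>UNIV. gcomp A g c a e X * M e k) = (\<Sum>b\<in>UNIV. ?y b * olow c a b X (h k))"
        unfolding \<omega>h[symmetric] olow_def sum_distrib_left by (subst sum.swap) (simp add: mult_ac)
      also have "\<dots> = (\<Sum>b\<in>UNIV. ?y b * (olow c b a X (h k) - ?G b a k) + ?y b * ?G a b k)"
      proof (rule sum.cong[OF refl])
        fix b
        have "olow c a b X (h k) = (olow c b a X (h k) - ?G b a k) + ?G a b k" using Hsym[of a b k] by linarith
        then show "?y b * olow c a b X (h k) = ?y b * (olow c b a X (h k) - ?G b a k) + ?y b * ?G a b k"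
          by (simp only: distrib_left)
      qed
      finally show ?thesis unfolding sum.distrib Htr Gam_contract[OF X c] by simp
    qed
    then have M: "M b k = N c b k X" for b k by (rule barthel_unique[OF X c])
    have hh: "h d = hfield c d X" for d by (simp add: h_def hfield_def M)
    have MN: "M = (\<lambda>a b. N c a b X)" by (simp add: fun_eq_iff M)
    show ?thesis using Vsym Vtr Hsym[unfolded hh MN] Htr[unfolded hh MN] unfolding vfield_def by blast
  qed
  then show ?thesis unfolding canonical_def by blast
qed

text \<open>Both connections are compared on the same Barthel frame, so the non-tensorial \<Gamma>
  terms cancel and differences of symmetric transverse arrays remain.\<close>

lemma canonical_difference:
  assumes can: "canonical" and "finsler_connection A nab'" and can': "hessian_finsler.canonical A g nab'"
  shows "nab' \<in> conn_class A g nab"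
proof -
  interpret N': hessian_finsler A g nab' by unfold_locales fact
  obtain W where W: "pullback_endo_form A W" and comp: "\<And>X c Z a b. X \<in> slit A \<Longrightarrow> c \<in> charts_at A (fst X) \<Longrightarrow>
      wcomp A W c a b X Z = conn_form A nab' c a b X Z - conn_form A nab c a b X Z"
    using connection_difference[OF assms(2)] by blast
  have "sym_transverse_form A g W" unfolding sym_transverse_form_def Let_def
  proof (intro ballI conjI allI)
    fix X c Z assume X: "X \<in> slit A" and c: "c \<in> charts_at A (fst X)" and Z: "Z \<in> TE A X"
    let ?w = "\<lambda>a b Z. N'.olow c a b X Z - olow c a b X Z"
    have low: "(\<Sum>d\<in>UNIV. gcomp A g c a d X * wcomp A W c d b X Z) = ?w a b Z" for a b
      unfolding comp[OF X c] N'.olow_def olow_def right_diff_distrib sum_subtractf ..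
    have exp: "?w a b Z = (\<Sum>d\<in>UNIV. dx_form A c d Z * ?w a b (hfield c d X)) + (\<Sum>d\<in>UNIV. barthel_form c d X Z * ?w a b (vfield c d X))" for a b
      by (rule adapted_expansion[OF X c Z]) (simp add: olow_tlin[OF X c] N'.olow_tlin[OF X c] algebra_simps)
    note D = canonicalD[OF can X c] and D' = N'.canonicalD[OF can' X c]
    have hs: "?w a b (hfield c d X) = ?w b a (hfield c d X)" and vs: "?w a b (vfield c d X) = ?w b a (vfield c d X)" for a b d
      using D(3)[of a b d] D'(3)[of a b d] D(1)[of a b d] D'(1)[of a b d] by simp_all
    have ht: "(\<Sum>b\<in>UNIV. ycoord c b X * ?w b a (hfield c d X)) = 0"
      and vt: "(\<Sum>b\<in>UNIV. ycoord c b X * ?w b a (vfield c d X)) = 0" for a d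
      using D(4)[of a d] D'(4)[of a d] D(2)[of a d] D'(2)[of a d] by (simp_all add: right_diff_distrib sum_subtractf)
    fix a
    show "(\<Sum>d\<in>UNIV. gcomp A g c a d X * wcomp A W c d b X Z) = (\<Sum>d\<in>UNIV. gcomp A g c b d X * wcomp A W c d a X Z)" for b
      unfolding low exp[of a b] exp[of b a] hs[of a b] vs[of a b] ..
    have sw: "(\<Sum>b\<in>UNIV. (\<Sum>d\<in>UNIV. \<theta> d * K b d) * ycoord c b X) = (\<Sum>d\<in>UNIV. \<theta> d * (\<Sum>b\<in>UNIV. ycoord c b X * K b d))"
      for K :: "'n \<Rightarrow> 'n \<Rightarrow> real" and \<theta>
      unfolding sum_distrib_left sum_distrib_right by (subst sum.swap) (simp add: mult_ac)
    show "(\<Sum>b\<in>UNIV. (\<Sum>d\<in>UNIV. gcomp A g c a d X * wcomp A W c d b X Z) * ycoord c b X) = 0"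
      unfolding low exp distrib_right sum.distrib sw hs[of a] vs[of a] ht vt by simp
  qed
  then have "differ_by_sym_transverse A g nab nab'"
    unfolding differ_by_sym_transverse_def using W comp by (intro exI[of _ W]) simp
  moreover have "regular A nab'" using N'.canonical_strongly_regular[OF can'] N'.strongly_regular_regular by blast
  ultimately show ?thesis using assms(2) unfolding conn_class_def by simp
qed

end

section \<open>The Cartan and Landsberg tensors\<close>

lemma (in smooth_atlas) smooth_near_Pair:
  assumes "smooth_near B f p" "smooth_near B h p"
  shows "smooth_near B (\<lambda>q. (f q, h q)) p"
  using assms unfolding smooth_near_iff_charts comp_def by (simp add: smooth_at_Pair)

lemma linear_form_on_add:
  assumes "linear_form_on V f" "linear_form_on V h"
  shows "linear_form_on V (\<lambda>u. f u + h u)"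
  using assms unfolding linear_form_on_def by (simp add: algebra_simps)

section \<open>Tensoriality of the Cartan tensor\<close>

context metric_atlas
begin

text \<open>Components of vectors pulled back from M are constant along the fibres, so a vertical
  derivative falls on the metric alone.\<close>

lemma vertical_metric_derivative:
  assumes X: "X \<in> slit A" and c: "c \<in> charts_at A (fst X)" and e: "e \<in> charts_at A (fst X)"
  shows "pd (lift_chart A c) (0, w) (\<lambda>Y. g Y (tvec_of A e (fst Y) u) (tvec_of A e (fst Y) v)) X =
    (\<Sum>a\<in>UNIV. \<Sum>b\<in>UNIV. tvec_of A e (fst X) u c $ a * tvec_of A e (fst X) v c $ b * pd (lift_chart A c) (0, w) (gcomp A g c a b) X)"
proof -
  have C: "lift_chart A c \<in> charts_at (slit_atlas A) X" using X c by simp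
  let ?p = "\<lambda>u a Y. tvec_of A e (fst Y) u c $ a"
  have sm: "smooth_near (slit_atlas A) (?p u a) X" for u a
    using smooth_section_nearD(3)[OF section_tvec_of[OF e] c] .
  have d0: "pd (lift_chart A c) (0, w) (?p u a) X = 0" for u a
  proof -
    have s: "smooth_near A (\<lambda>p. tvec_of A e p u c $ a) (fst X)"
      by (rule base.smooth_near_nth[OF base.smooth_near_tvec_of[OF e c base.smooth_near_const]])
    show ?thesis using pd_fst[OF X c s, of 0 w] linear_0[OF base.linear_pd[OF c s]] by simp
  qed
  have "pd (lift_chart A c) (0, w) (\<lambda>Y. g Y (tvec_of A e (fst Y) u) (tvec_of A e (fst Y) v)) X =
      pd (lift_chart A c) (0, w) (\<lambda>Y. \<Sum>a\<in>UNIV. \<Sum>b\<in>UNIV. ?p u a Y * ?p v b Y * gcomp A g c a b Y) X"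
    by (rule E.pd_cong[OF C C]) (simp add: g_expansion base.tvec_of_in)
  also have "\<dots> = (\<Sum>a\<in>UNIV. \<Sum>b\<in>UNIV. ?p u a X * ?p v b X * pd (lift_chart A c) (0, w) (gcomp A g c a b) X)"
    by (simp add: E.pd_sum[OF C] E.pd_mult[OF C] E.smooth_near_sum E.smooth_near_mult sm smooth_gcomp[OF X c] d0)
  finally show ?thesis .
qed

end

context hessian_metric
begin

text \<open>Each side is half the derivative of g(u, v) along the vertical vector that corresponds
  to \<open>w\<close>, and this vector does not depend on the chart.\<close>

lemma Ct_change:
  assumes X: "X \<in> slit A" and c: "c \<in> charts_at A (fst X)" and d: "d \<in> charts_at A (fst X)"
    and u: "u \<in> fibre A X" and v: "v \<in> fibre A X" and w: "w \<in> fibre A X"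
  shows "(\<Sum>a\<in>UNIV. \<Sum>b\<in>UNIV. \<Sum>e\<in>UNIV. u c $ a * v c $ b * w c $ e * Ct c a b e X) =
    (\<Sum>a\<in>UNIV. \<Sum>b\<in>UNIV. \<Sum>e\<in>UNIV. u d $ a * v d $ b * w d $ e * Ct d a b e X)"
proof -
  let ?f = "\<lambda>Y. g Y (tvec_of A c (fst Y) (u c)) (tvec_of A c (fst Y) (v c))"
  have uv: "tvec_of A c (fst X) (u c) = u" "tvec_of A c (fst X) (v c) = v"
    using base.tangent_eq_tvec_of[OF c] u v by auto
  have S: "(\<Sum>a\<in>UNIV. \<Sum>b\<in>UNIV. \<Sum>e\<in>UNIV. u x $ a * v x $ b * w x $ e * Ct x a b e X) =
      1/2 * pd (lift_chart A x) (0, w x) ?f X" if x: "x \<in> charts_at A (fst X)" for x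
    unfolding vertical_metric_derivative[OF X x c] uv pd_expansion[OF X x smooth_gcomp[OF X x]] dy_gcomp
    by (simp add: sum_distrib_left mult_ac)
  let ?Z = "cfield c (0, w c) X"
  have Z: "?Z \<in> TE A X" by (rule cfield_in)
  have Zc: "?Z (lift_chart A c) = (0, w c)" using X c by simp
  have "?Z (lift_chart A d) = (0, w d)"
    using proj_change[OF X c d Z] vertical_change[OF X c d Z] base.tangent_change[OF c d w] linear_0[OF base.linear_transition[OF c d]]
    by (simp add: Zc prod_eq_iff)
  then have "pd (lift_chart A c) (0, w c) ?f X = pd (lift_chart A d) (0, w d) ?f X"
    using E.dir_deriv_change_chart[OF lift_at[OF X c] lift_at[OF X d] smooth_metric[OF X section_tvec_of[OF c] section_tvec_of[OF c]] Z]
    by (simp add: dir_deriv_eq_pd Zc)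
  then show ?thesis unfolding S[OF c] S[OF d] by simp
qed

lemma Cartan_tensor:
  obtains K where "pullback_tensor3 A K"
    and "\<And>X c a b e. X \<in> slit A \<Longrightarrow> c \<in> charts_at A (fst X) \<Longrightarrow> tcomp A K c a b e X = Ct c a b e X"
  by (rule tensor3_of_components[of Ct, OF smooth_Ct Ct_change]) (assumption | blast)+

section \<open>Horizontal fields and horizontal lifts\<close>

lemma smooth_field_hfield:
  assumes X: "X \<in> slit A" and c: "c \<in> charts_at A (fst X)"
  shows "smooth_field_near A (hfield c d) X"
  unfolding smooth_field_near_def hfield_def cfield_def
proof (intro conjI ballI)
  fix C assume C: "C \<in> charts_at (slit_atlas A) X"
  have "smooth_near (slit_atlas A) (\<lambda>Y. - (\<chi> a. N c a d Y)) X"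
    by (rule E.smooth_near_vec) (simp add: E.smooth_near_minus smooth_barthel[OF X c])
  then have "smooth_near (slit_atlas A) (\<lambda>Y. (axis d 1, - (\<chi> a. N c a d Y))) X"
    by (rule E.smooth_near_Pair[OF E.smooth_near_const])
  then show "smooth_near (slit_atlas A) (\<lambda>Y. tvec_of (slit_atlas A) (lift_chart A c) Y (axis d 1, - (\<chi> a. N c a d Y)) C) X"
    by (rule E.smooth_near_tvec_of[OF lift_at[OF X c] C])
qed (rule E.tvec_of_in)

text \<open>For the components of y itself the lift is the spray \<open>y\<^sup>k
  \<partial>/\<partial>x\<^sup>k - 2 G\<^sup>e \<partial>/\<partial>y\<^sup>e\<close>, since N
  contracts with y to twice G.\<close>

definition hlift :: "('m, real ^ 'n) chart \<Rightarrow> real ^ 'n \<Rightarrow> ('m, 'n) tpoint \<Rightarrow> ('m, 'n) etvec" where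
  "hlift c w X = cfield c (w, - (\<chi> a. \<Sum>d\<in>UNIV. N c a d X * w $ d)) X"

lemma hlift_in: "hlift c w X \<in> TE A X"
  by (simp add: hlift_def cfield_in)

lemma forms_hlift:
  assumes "X \<in> slit A" "c \<in> charts_at A (fst X)"
  shows "dx_form A c a (hlift c w X) = w $ a" "barthel_form c a X (hlift c w X) = 0"
  using assms by (simp_all add: hlift_def barthel_form_def)

lemma hlift_expansion:
  assumes X: "X \<in> slit A" and c: "c \<in> charts_at A (fst X)"
    and f: "\<And>Z W r q. Z \<in> TE A X \<Longrightarrow> W \<in> TE A X \<Longrightarrow> f (tlin r Z q W) = r * f Z + q * (f W :: real)"
  shows "f (hlift c w X) = (\<Sum>d\<in>UNIV. w $ d * f (hfield c d X))"
proof -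
  have "f (hlift c w X) = (\<Sum>d\<in>UNIV. dx_form A c d (hlift c w X) * f (hfield c d X)) +
      (\<Sum>d\<in>UNIV. barthel_form c d X (hlift c w X) * f (vfield c d X))"
    by (rule adapted_expansion[OF X c hlift_in]) (rule f)
  then show ?thesis unfolding forms_hlift[OF X c] by simp
qed

end

section \<open>Linearity, symmetry and smoothness of \<open>Dg\<close>\<close>

context finsler
begin

lemma Dg_tlin:
  assumes X: "X \<in> slit A" and c: "c \<in> charts_at A (fst X)" and Z: "Z \<in> TE A X" "W \<in> TE A X"
  shows "Dg A g nab c a b X (tlin r Z q W) = r * Dg A g nab c a b X Z + q * Dg A g nab c a b X W"
proof -
  have C: "lift_chart A c \<in> charts_at (slit_atlas A) X" using X c by simp
  note l = E.linear_pd[OF C smooth_gcomp[OF X c]]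
  show ?thesis
    unfolding Dg_eq[OF X] olow_def conn_form_tlin[OF X c Z] tlin_apply linear_add[OF l] linear_scale[OF l]
    by (simp add: algebra_simps sum.distrib sum_distrib_left)
qed

lemma Dg_sym:
  assumes X: "X \<in> slit A" and c: "c \<in> charts_at A (fst X)"
  shows "Dg A g nab c a b X Z = Dg A g nab c b a X Z"
  unfolding Dg_eq[OF X] pd_gcomp_sym[OF X c, of _ a b] by simp

lemma smooth_form_components:
  assumes X: "X \<in> slit A" and c: "c \<in> charts_at A (fst X)" and Z: "smooth_field_near A Z X"
  shows "smooth_near (slit_atlas A) (\<lambda>Y. dx_form A c d (Z Y)) X" "smooth_near (slit_atlas A) (\<lambda>Y. dy_form A c d (Z Y)) X"
proof -
  have "smooth_near (slit_atlas A) (\<lambda>Y. Z Y (lift_chart A c)) X"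
    using Z X c unfolding smooth_field_near_def by simp
  then show "smooth_near (slit_atlas A) (\<lambda>Y. dx_form A c d (Z Y)) X" "smooth_near (slit_atlas A) (\<lambda>Y. dy_form A c d (Z Y)) X"
    unfolding dx_form_def dy_form_def
    by (rule E.smooth_near_nth[OF E.smooth_near_bounded_linear[OF bounded_linear_fst]],
        rule E.smooth_near_nth[OF E.smooth_near_bounded_linear[OF bounded_linear_snd]])
qed

lemma smooth_Dg:
  assumes X: "X \<in> slit A" and c: "c \<in> charts_at A (fst X)" and Z: "smooth_field_near A Z X"
  shows "smooth_near (slit_atlas A) (\<lambda>Y. Dg A g nab c a b Y (Z Y)) X"
proof -
  have C: "lift_chart A c \<in> charts_at (slit_atlas A) X" using X c by simp
  have "smooth_near (slit_atlas A) (\<lambda>Y. (\<Sum>k\<in>UNIV. dx_form A c k (Z Y) * dx A c k (gcomp A g c a b) Y) +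
      (\<Sum>k\<in>UNIV. dy_form A c k (Z Y) * dy A c k (gcomp A g c a b) Y)
      - (\<Sum>e\<in>UNIV. gcomp A g c b e Y * conn_form A nab c e a Y (Z Y)) - (\<Sum>e\<in>UNIV. gcomp A g c a e Y * conn_form A nab c e b Y (Z Y))) X"
    unfolding dx_eq_pd dy_eq_pd
    by (intro E.smooth_near_add E.smooth_near_diff E.smooth_near_sum E.smooth_near_mult smooth_form_components[OF X c Z]
        E.smooth_near_pd[OF C] smooth_gcomp[OF X c] smooth_conn_form[OF X c Z])
  then show ?thesis
  proof (rule E.smooth_near_cong[OF C C, rotated])
    fix Y assume "lift_chart A c \<in> charts_at (slit_atlas A) Y"
    then have Y: "Y \<in> slit A" "c \<in> charts_at A (fst Y)" by auto
    show "(\<Sum>k\<in>UNIV. dx_form A c k (Z Y) * dx A c k (gcomp A g c a b) Y) +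
      (\<Sum>k\<in>UNIV. dy_form A c k (Z Y) * dy A c k (gcomp A g c a b) Y)
      - (\<Sum>e\<in>UNIV. gcomp A g c b e Y * conn_form A nab c e a Y (Z Y)) - (\<Sum>e\<in>UNIV. gcomp A g c a e Y * conn_form A nab c e b Y (Z Y))
      = Dg A g nab c a b Y (Z Y)"
      using pd_expansion[OF Y smooth_gcomp[OF Y], of "fst (Z Y (lift_chart A c))" "snd (Z Y (lift_chart A c))" a b]
      by (simp add: Dg_eq[OF Y(1)] olow_def dx_form_def dy_form_def)
  qed
qed

end

section \<open>Covariant derivative of tensors with three slots\<close>

context connection_atlas
begin

definition covariant3 ::
  "('m, 'n) cotensor3 \<Rightarrow> ('m, real ^ 'n) chart \<Rightarrow> 'n \<Rightarrow> 'n \<Rightarrow> 'n \<Rightarrow> ('m, 'n) tpoint \<Rightarrow> ('m, 'n) etvec \<Rightarrow> real" where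
  "covariant3 K c a b d X Z = pd (lift_chart A c) (Z (lift_chart A c)) (tcomp A K c a b d) X
    - (\<Sum>e\<in>UNIV. conn_form A nab c e a X Z * tcomp A K c e b d X)
    - (\<Sum>e\<in>UNIV. conn_form A nab c e b X Z * tcomp A K c a e d X)
    - (\<Sum>e\<in>UNIV. conn_form A nab c e d X Z * tcomp A K c a b e X)"

text \<open>One application of \<open>covariant_slot\<close> per slot. The auxiliary linear form
  carries the terms in which the other two slots are differentiated.\<close>

lemma covariant3_expansion:
  assumes K: "pullback_tensor3 A K" and X: "X \<in> slit A" and c: "c \<in> charts_at A (fst X)" and Z: "Z \<in> TE A X"
    and s: "smooth_section_near A s X" and t: "smooth_section_near A t X" and r: "smooth_section_near A r X"
  shows "pd (lift_chart A c) (Z (lift_chart A c)) (\<lambda>Y. K Y (s Y) (t Y) (r Y)) X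
      - K X (nab s X Z) (t X) (r X) - K X (s X) (nab t X Z) (r X) - K X (s X) (t X) (nab r X Z) =
    (\<Sum>a\<in>UNIV. \<Sum>b\<in>UNIV. \<Sum>d\<in>UNIV. s X c $ a * t X c $ b * r X c $ d * covariant3 K c a b d X Z)"
proof -
  let ?pd = "\<lambda>f. pd (lift_chart A c) (Z (lift_chart A c)) f X"
  let ?e = "frame A c" and ?n = "\<lambda>s. nab s X Z"
  note fr = section_frame[OF c]
  note lin = tensor3_linear[OF K] and sm = smooth_tensor3[OF K X]
  have n: "?n s \<in> fibre A X" if "smooth_section_near A s X" for s using nab_in[OF X that Z] .
  note val = smooth_section_nearD(1)
  have 1: "?pd (\<lambda>Y. K Y (s Y) (t Y) (r Y)) - K X (?n s) (t X) (r X) - (K X (s X) (?n t) (r X) + K X (s X) (t X) (?n r)) =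
      (\<Sum>a\<in>UNIV. s X c $ a * (?pd (\<lambda>Y. K Y (?e a Y) (t Y) (r Y)) - K X (?n (?e a)) (t X) (r X)
        - (K X (?e a X) (?n t) (r X) + K X (?e a X) (t X) (?n r))))"
    by (rule covariant_slot[OF X c Z, where h = "\<lambda>Y u. K Y u (t Y) (r Y)" and m = "\<lambda>u. K X u (?n t) (r X) + K X u (t X) (?n r)"])
      (intro linear_form_on_add lin(3) sm val[OF t] val[OF r] n s t r X | assumption)+
  have 2: "?pd (\<lambda>Y. K Y (?e a Y) (t Y) (r Y)) - K X (?e a X) (?n t) (r X) - (K X (?n (?e a)) (t X) (r X) + K X (?e a X) (t X) (?n r)) =
      (\<Sum>b\<in>UNIV. t X c $ b * (?pd (\<lambda>Y. K Y (?e a Y) (?e b Y) (r Y)) - K X (?e a X) (?n (?e b)) (r X)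
        - (K X (?n (?e a)) (?e b X) (r X) + K X (?e a X) (?e b X) (?n r))))" for a
    by (rule covariant_slot[OF X c Z, where h = "\<lambda>Y u. K Y (?e a Y) u (r Y)" and m = "\<lambda>u. K X (?n (?e a)) u (r X) + K X (?e a X) u (?n r)"])
      (intro linear_form_on_add lin(2) sm frame_in val[OF r] n fr t r X | assumption)+
  have 3: "?pd (\<lambda>Y. K Y (?e a Y) (?e b Y) (r Y)) - K X (?e a X) (?e b X) (?n r) - (K X (?n (?e a)) (?e b X) (r X) + K X (?e a X) (?n (?e b)) (r X)) =
      (\<Sum>d\<in>UNIV. r X c $ d * (?pd (\<lambda>Y. K Y (?e a Y) (?e b Y) (?e d Y)) - K X (?e a X) (?e b X) (?n (?e d))
        - (K X (?n (?e a)) (?e b X) (?e d X) + K X (?e a X) (?n (?e b)) (?e d X))))" for a b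
    by (rule covariant_slot[OF X c Z, where h = "\<lambda>Y u. K Y (?e a Y) (?e b Y) u" and m = "\<lambda>u. K X (?n (?e a)) (?e b X) u + K X (?e a X) (?n (?e b)) u"])
      (intro linear_form_on_add lin(1) sm frame_in n fr r X | assumption)+
  have 4: "?pd (\<lambda>Y. K Y (?e a Y) (?e b Y) (?e d Y)) - K X (?e a X) (?e b X) (?n (?e d))
        - (K X (?n (?e a)) (?e b X) (?e d X) + K X (?e a X) (?n (?e b)) (?e d X)) = covariant3 K c a b d X Z" for a b d
    using linear_form_expansion[OF c lin(3)[OF X frame_in[of c b X] frame_in[of c d X]] n[OF fr[of a]]]
      linear_form_expansion[OF c lin(2)[OF X frame_in[of c a X] frame_in[of c d X]] n[OF fr[of b]]]
      linear_form_expansion[OF c lin(1)[OF X frame_in[of c a X] frame_in[of c b X]] n[OF fr[of d]]]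
    unfolding covariant3_def tcomp_def[abs_def] conn_form_def by simp
  have e3: "?pd (\<lambda>Y. K Y (?e a Y) (?e b Y) (r Y)) - K X (?e a X) (?n (?e b)) (r X) - (K X (?n (?e a)) (?e b X) (r X) + K X (?e a X) (?e b X) (?n r))
      = (\<Sum>d\<in>UNIV. r X c $ d * covariant3 K c a b d X Z)" for a b
    using 3[of a b] unfolding 4 by linarith
  have e2: "?pd (\<lambda>Y. K Y (?e a Y) (t Y) (r Y)) - K X (?n (?e a)) (t X) (r X) - (K X (?e a X) (?n t) (r X) + K X (?e a X) (t X) (?n r))
      = (\<Sum>b\<in>UNIV. t X c $ b * (\<Sum>d\<in>UNIV. r X c $ d * covariant3 K c a b d X Z))" for a
    using 2[of a] unfolding e3 by linarith
  show ?thesis using 1 unfolding e2 by (simp add: sum_distrib_left mult.assoc diff_diff_eq)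
qed

lemma covariant3_change:
  assumes K: "pullback_tensor3 A K" and X: "X \<in> slit A" and c: "c \<in> charts_at A (fst X)" and d: "d \<in> charts_at A (fst X)"
    and Z: "Z \<in> TE A X" and u: "u \<in> fibre A X" and v: "v \<in> fibre A X" and w: "w \<in> fibre A X"
  shows "(\<Sum>a\<in>UNIV. \<Sum>b\<in>UNIV. \<Sum>e\<in>UNIV. u c $ a * v c $ b * w c $ e * covariant3 K c a b e X Z) =
    (\<Sum>a\<in>UNIV. \<Sum>b\<in>UNIV. \<Sum>e\<in>UNIV. u d $ a * v d $ b * w d $ e * covariant3 K d a b e X Z)"
proof -
  let ?s = "\<lambda>w Y. tvec_of A c (fst Y) (w c)"
  note s = section_tvec_of[OF c]
  have e: "?s u X = u" "?s v X = v" "?s w X = w" using base.tangent_eq_tvec_of[OF c] u v w by auto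
  have "pd (lift_chart A c) (Z (lift_chart A c)) (\<lambda>Y. K Y (?s u Y) (?s v Y) (?s w Y)) X =
      pd (lift_chart A d) (Z (lift_chart A d)) (\<lambda>Y. K Y (?s u Y) (?s v Y) (?s w Y)) X"
    unfolding dir_deriv_eq_pd[symmetric]
    by (rule E.dir_deriv_change_chart) (simp_all add: X c d Z smooth_tensor3[OF K X s s s])
  then show ?thesis
    using covariant3_expansion[OF K X c Z s s s, of "u c" "v c" "w c"] covariant3_expansion[OF K X d Z s s s, of "u c" "v c" "w c"]
    by (simp add: e)
qed

end

section \<open>Tensors defined by a canonical connection\<close>

context hessian_finsler
begin

text \<open>The Barthel coefficients do not transform as a tensor, but their horizontal lift is the
  vector that projects to \<open>w\<close> and is annihilated by \<nabla>y. Both properties are free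
  of coordinates.\<close>

lemma hlift_change:
  assumes can: "canonical" and X: "X \<in> slit A" and c: "c \<in> charts_at A (fst X)" and d: "d \<in> charts_at A (fst X)"
    and w: "w \<in> fibre A X"
  shows "hlift c (w c) X = hlift d (w d) X"
proof -
  let ?Z = "hlift c (w c) X"
  note n = nab_in[OF X section_snd[OF X] hlift_in]
  have "nab snd X ?Z = (\<lambda>_. 0)"
    by (rule base.tangent_eqI[OF c n base.zero_in])
      (use canonical_omega_bar[OF can X c hlift_in, of _ c "w c"] in \<open>simp add: vec_eq_iff omega_bar_def forms_hlift[OF X c]\<close>)
  then have "barthel_form d a X ?Z = 0" for a
    using canonical_omega_bar[OF can X d hlift_in, of a c "w c"] by (simp add: omega_bar_def)
  moreover have "fst (?Z (lift_chart A d)) = w d"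
    using proj_change[OF X c d hlift_in] base.tangent_change[OF c d w] X c by (simp add: hlift_def)
  ultimately have "?Z (lift_chart A d) = hlift d (w d) X (lift_chart A d)"
    using X d by (simp add: hlift_def prod_eq_iff vec_eq_iff barthel_form_def dx_form_def dy_form_def eq_neg_iff_add_eq_0)
  then show ?thesis using E.tangent_eqI[OF lift_at[OF X d] hlift_in hlift_in] by blast
qed

lemma Dg_hfield:
  assumes can: "canonical" and X: "X \<in> slit A" and c: "c \<in> charts_at A (fst X)"
  shows "Dg A g nab c a b X (hfield c d X) = - 2 * (olow c a b X (hfield c d X) - Gam_barthel c a b d X)"
  using Gam_metric[OF X c, of "\<lambda>a b. N c a b X" a b d] canonicalD(3)[OF can X c, of a b d]
  unfolding Dg_eq[OF X] pd_hfield_gcomp[OF X c] by simp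

lemma Dg_vfield:
  assumes can: "canonical" and X: "X \<in> slit A" and c: "c \<in> charts_at A (fst X)"
  shows "Dg A g nab c a b X (vfield c d X) = 2 * Ct c a b d X - 2 * olow c a b X (vfield c d X)"
  using canonicalD(1)[OF can X c, of a b d] X c
  unfolding Dg_eq[OF X] by (simp add: vfield_def dy_gcomp[symmetric] dy_eq_pd)

text \<open>Neither term of the difference is a tensor. Their difference is -1/2 times
  \<open>Dg\<close> on \<open>\<delta>/\<delta>x\<^sup>d\<close>, and evaluating \<open>Dg\<close>
  on horizontal lifts, which are intrinsic, makes all three slots invariant.\<close>

lemma horizontal_difference_tensor:
  assumes can: "canonical"
  obtains K where "pullback_tensor3 A K"
    and "\<And>X c a b d. X \<in> slit A \<Longrightarrow> c \<in> charts_at A (fst X) \<Longrightarrow>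
      tcomp A K c a b d X = olow c a b X (hfield c d X) - Gam_barthel c a b d X"
proof -
  let ?k = "\<lambda>c a b d X. - 1/2 * Dg A g nab c a b X (hfield c d X)"
  have sm: "smooth_near (slit_atlas A) (?k c a b d) X" if "X \<in> slit A" "c \<in> charts_at A (fst X)" for X c a b d
    by (intro E.smooth_near_mult E.smooth_near_const smooth_Dg[OF that smooth_field_hfield[OF that]])
  have ch: "(\<Sum>a\<in>UNIV. \<Sum>b\<in>UNIV. \<Sum>e\<in>UNIV. u c $ a * v c $ b * w c $ e * ?k c a b e X) =
      (\<Sum>a\<in>UNIV. \<Sum>b\<in>UNIV. \<Sum>e\<in>UNIV. u d $ a * v d $ b * w d $ e * ?k d a b e X)"
    if X: "X \<in> slit A" and c: "c \<in> charts_at A (fst X)" and d: "d \<in> charts_at A (fst X)"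
      and uvw: "u \<in> fibre A X" "v \<in> fibre A X" "w \<in> fibre A X" for X c d u v w
  proof -
    have S: "(\<Sum>a\<in>UNIV. \<Sum>b\<in>UNIV. \<Sum>e\<in>UNIV. u x $ a * v x $ b * w x $ e * ?k x a b e X) =
        - 1/2 * (\<Sum>a\<in>UNIV. \<Sum>b\<in>UNIV. u x $ a * v x $ b * Dg A g nab x a b X (hlift x (w x) X))" if x: "x \<in> charts_at A (fst X)" for x
    proof -
      have "Dg A g nab x a b X (hlift x (w x) X) = (\<Sum>e\<in>UNIV. w x $ e * Dg A g nab x a b X (hfield x e X))" for a b
        by (rule hlift_expansion[OF X x]) (rule Dg_tlin[OF X x])
      then show ?thesis by (simp add: sum_distrib_left mult_ac)
    qed
    show ?thesis
      unfolding S[OF c] S[OF d] hlift_change[OF can X c d uvw(3)] Dg_change[OF X c d hlift_in uvw(1,2)] ..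
  qed
  obtain K where K: "pullback_tensor3 A K"
    and k: "\<And>X c a b e. X \<in> slit A \<Longrightarrow> c \<in> charts_at A (fst X) \<Longrightarrow> tcomp A K c a b e X = ?k c a b e X"
    using tensor3_of_components[of ?k, OF sm ch] by blast
  show thesis by (rule that[OF K]) (simp add: k Dg_hfield[OF can] field_simps)
qed

text \<open>Along the spray the forms of a Chern connection reduce to N, so the formula for
  \<open>Land\<close> is the covariant derivative of the Cartan tensor in that direction.\<close>

lemma Landsberg_tensor:
  assumes can: "canonical" and chern: "\<And>X c a b d. X \<in> slit A \<Longrightarrow> c \<in> charts_at A (fst X) \<Longrightarrow>
    olow c a b X (hfield c d X) = Gam_barthel c a b d X"
  obtains K where "pullback_tensor3 A K"
    and "\<And>X c a b d. X \<in> slit A \<Longrightarrow> c \<in> charts_at A (fst X) \<Longrightarrow> tcomp A K c a b d X = Land c a b d X"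
proof -
  obtain C where C: "pullback_tensor3 A C"
    and Cc: "\<And>X c a b e. X \<in> slit A \<Longrightarrow> c \<in> charts_at A (fst X) \<Longrightarrow> tcomp A C c a b e X = Ct c a b e X"
    using Cartan_tensor by blast
  have L: "Land c a b d X = covariant3 C c a b d X (hlift c (snd X c) X)"
    if X: "X \<in> slit A" and c: "c \<in> charts_at A (fst X)" for X c a b d
  proof -
    let ?S = "hlift c (snd X c) X"
    \<comment> \<open>The spray contracts the last index of \<Gamma> with y. As \<Gamma> is
      symmetric in its last two indices, the result is again N.\<close>
    have \<omega>: "conn_form A nab c e k X ?S = N c e k X" for e k
    proof (rule lower_inject[OF X c, where h = "\<lambda>e. conn_form A nab c e k X ?S" and k = "\<lambda>e. N c e k X"])
      fix f
      have "(\<Sum>d\<in>UNIV. gcomp A g c f d X * conn_form A nab c d k X ?S) = olow c f k X ?S" by (simp add: olow_def)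
      also have "\<dots> = (\<Sum>d\<in>UNIV. ycoord c d X * Gam_barthel c f k d X)"
        using hlift_expansion[OF X c, where f = "olow c f k X", OF olow_tlin[OF X c]] by (simp add: chern[OF X c] ycoord_def)
      also have "\<dots> = (\<Sum>d\<in>UNIV. ycoord c d X * Gam_barthel c f d k X)"
        by (intro sum.cong refl arg_cong[of _ _ "\<lambda>z. _ * z"])
          (simp add: Gam_def gx_sym[OF X c, of _ k] Ct_sym12[OF X c, of _ k])
      also have "\<dots> = (\<Sum>d\<in>UNIV. gcomp A g c f d X * N c d k X)" by (rule Gam_barthel_contract[OF X c])
      finally show "(\<Sum>d\<in>UNIV. gcomp A g c f d X * conn_form A nab c d k X ?S) = (\<Sum>d\<in>UNIV. gcomp A g c f d X * N c d k X)" .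
    qed
    have "pd (lift_chart A c) (?S (lift_chart A c)) (tcomp A C c a b d) X = pd (lift_chart A c) (?S (lift_chart A c)) (Ct c a b d) X"
      by (rule pd_cong_chart[OF X c Cc])
    also have "\<dots> = (\<Sum>k\<in>UNIV. ycoord c k X * dx A c k (Ct c a b d) X) - 2 * (\<Sum>e\<in>UNIV. sp c e X * dy A c e (Ct c a b d) X)"
    proof -
      have "(\<Sum>k\<in>UNIV. N c e k X * snd X c $ k) = 2 * sp c e X" for e
        using barthel_contract[OF X c, of e] by (simp add: ycoord_def)
      then show ?thesis
        using pd_expansion[OF X c smooth_Ct[OF X c], of "snd X c" "- (\<chi> a. \<Sum>d\<in>UNIV. N c a d X * snd X c $ d)" a b d] X c
        by (simp add: hlift_def ycoord_def sum_negf sum_distrib_left mult.assoc)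
    qed
    finally show ?thesis unfolding covariant3_def Land_def \<omega> Cc[OF X c] by simp
  qed
  have ch: "(\<Sum>a\<in>UNIV. \<Sum>b\<in>UNIV. \<Sum>e\<in>UNIV. u c $ a * v c $ b * w c $ e * Land c a b e X) =
      (\<Sum>a\<in>UNIV. \<Sum>b\<in>UNIV. \<Sum>e\<in>UNIV. u d $ a * v d $ b * w d $ e * Land d a b e X)"
    if X: "X \<in> slit A" and c: "c \<in> charts_at A (fst X)" and d: "d \<in> charts_at A (fst X)"
      and uvw: "u \<in> fibre A X" "v \<in> fibre A X" "w \<in> fibre A X" for X c d u v w
    unfolding L[OF X c] L[OF X d] hlift_change[OF can X c d slitD(1)[OF X]] by (rule covariant3_change[OF C X c d hlift_in uvw])
  show thesis
    using tensor3_of_components[of Land, OF smooth_Land ch] that by blast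
qed

end

section \<open>Connections with prescribed coefficients\<close>

lemma sym_transverse_cong:
  assumes "\<And>X c a b d. X \<in> slit A \<Longrightarrow> c \<in> charts_at A (fst X) \<Longrightarrow> K c a b d X = K' c a b d X"
  shows "sym_transverse A K \<longleftrightarrow> sym_transverse A K'"
  unfolding sym_transverse_def by (intro ball_cong refl) (simp add: assms)

context hessian_finsler
begin

text \<open>
  Adding \<open>Dg / 2\<close> makes the connection metric, so that it becomes the Cartan connection; this leaves
  the horizontal and vertical parts free to be prescribed.
\<close>

lemma prescribed_connection:
  assumes conds: "conds_alpha_epsilon A g nab"
    and \<Lambda>: "pullback_tensor3 A \<Lambda>" "sym_transverse A (tcomp A \<Lambda>)"
    and V: "pullback_tensor3 A V" "sym_transverse A (tcomp A V)"
  obtains nab' where "finsler_connection A nab'" "conds_alpha_epsilon A g nab'"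
    and "\<And>X c a b d. X \<in> slit A \<Longrightarrow> c \<in> charts_at A (fst X) \<Longrightarrow>
      lower3 A g (Hcoeff A nab') c a b d X = Gam_barthel c a b d X + tcomp A \<Lambda> c a b d X"
    and "\<And>X c a b d. X \<in> slit A \<Longrightarrow> c \<in> charts_at A (fst X) \<Longrightarrow>
      lower3 A g (Vcoeff A nab') c a b d X = tcomp A V c a b d X"
proof -
  have can: "canonical" by (rule conds_imp_canonical[OF conds])
  obtain C where C: "pullback_tensor3 A C"
    and Cc: "\<And>X c a b e. X \<in> slit A \<Longrightarrow> c \<in> charts_at A (fst X) \<Longrightarrow> tcomp A C c a b e X = Ct c a b e X"
    using Cartan_tensor by blast
  \<comment> \<open>On horizontal vectors \<open>Dg / 2\<close> cancels the deviation from \<Gamma>,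
    and \<Lambda> is put in its place. On vertical vectors it turns the present coefficients into
    the Cartan tensor, which the last two sums exchange for V.\<close>
  define \<beta> where "\<beta> c a b X Z = 1/2 * Dg A g nab c a b X Z + (\<Sum>d\<in>UNIV. tcomp A \<Lambda> c a b d X * dx_form A c d Z)
    + (\<Sum>d\<in>UNIV. tcomp A V c a b d X * omega_bar nab c d X Z) - (\<Sum>d\<in>UNIV. tcomp A C c a b d X * omega_bar nab c d X Z)" for c a b X Z
  have lin: "\<beta> c a b X (tlin r Z q W) = r * \<beta> c a b X Z + q * \<beta> c a b X W"
    if X: "X \<in> slit A" and c: "c \<in> charts_at A (fst X)" and Z: "Z \<in> TE A X" "W \<in> TE A X" for X c a b Z W r q
    unfolding \<beta>_def Dg_tlin[OF X c Z] dx_form_tlin omega_bar_tlin[OF X Z]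
    by (simp add: algebra_simps sum.distrib sum_distrib_left)
  have smooth: "smooth_near (slit_atlas A) (\<lambda>Y. \<beta> c a b Y (Z Y)) X"
    if X: "X \<in> slit A" and c: "c \<in> charts_at A (fst X)" and Z: "smooth_field_near A Z X" for X c a b Z
    unfolding \<beta>_def
    by (intro E.smooth_near_add E.smooth_near_diff E.smooth_near_mult E.smooth_near_sum E.smooth_near_const smooth_Dg[OF X c Z]
        smooth_tcomp[OF \<Lambda>(1) X c] smooth_tcomp[OF V(1) X c] smooth_tcomp[OF C X c] smooth_form_components[OF X c Z] smooth_omega_bar[OF X c Z])
  have change: "(\<Sum>a\<in>UNIV. \<Sum>b\<in>UNIV. u c $ a * v c $ b * \<beta> c a b X Z) = (\<Sum>a\<in>UNIV. \<Sum>b\<in>UNIV. u d $ a * v d $ b * \<beta> d a b X Z)"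
    if X: "X \<in> slit A" and c: "c \<in> charts_at A (fst X)" and d: "d \<in> charts_at A (fst X)" and Z: "Z \<in> TE A X"
      and u: "u \<in> fibre A X" and v: "v \<in> fibre A X" for X c d Z u v
  proof -
    have K: "(\<Sum>a\<in>UNIV. \<Sum>b\<in>UNIV. u x $ a * v x $ b * (\<Sum>d\<in>UNIV. tcomp A K x a b d X * w x $ d)) = K X u v w"
      if "pullback_tensor3 A K" "w \<in> fibre A X" "x \<in> charts_at A (fst X)" for K w x
      unfolding tensor3_expansion[OF that(1) X that(3) u v that(2)] by (simp add: sum_distrib_left mult_ac)
    have proj_component: "proj Z x $ d = dx_form A x d Z" for x d by (simp add: proj_def dx_form_def)
    have f: "proj Z \<in> fibre A X" "nab snd X Z \<in> fibre A X" using proj_in[OF X Z] nab_in[OF X section_snd[OF X] Z] by auto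
    \<comment> \<open>Every term is a tensor applied to \<open>u\<close>, \<open>v\<close> and
      either Z, its projection or \<nabla>y on Z, hence the same in all charts.\<close>
    have S: "(\<Sum>a\<in>UNIV. \<Sum>b\<in>UNIV. u x $ a * v x $ b * \<beta> x a b X Z) =
        1/2 * (\<Sum>a\<in>UNIV. \<Sum>b\<in>UNIV. u x $ a * v x $ b * Dg A g nab x a b X Z) + \<Lambda> X u v (proj Z)
        + V X u v (nab snd X Z) - C X u v (nab snd X Z)" if x: "x \<in> charts_at A (fst X)" for x
      using K[OF \<Lambda>(1) f(1) x] K[OF V(1) f(2) x] K[OF C f(2) x]
      unfolding \<beta>_def distrib_left right_diff_distrib sum.distrib sum_subtractf
        dx_form_def[symmetric] omega_bar_def[symmetric] proj_component
      by (simp add: sum_distrib_left)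
    show ?thesis unfolding S[OF c] S[OF d] Dg_change[OF X c d Z u v] ..
  qed
  obtain W where W: "pullback_endo_form A W"
    and Wc: "\<And>X c Z a b. X \<in> slit A \<Longrightarrow> c \<in> charts_at A (fst X) \<Longrightarrow> wcomp A W c a b X Z = (\<Sum>d\<in>UNIV. ginv A g c a d X * \<beta> c d b X Z)"
    using endo_form_of_lowered[of \<beta>, OF lin smooth change] by blast
  have Wl: "(\<Sum>d\<in>UNIV. gcomp A g c a d X * wcomp A W c d b X Z) = \<beta> c a b X Z"
    if "X \<in> slit A" "c \<in> charts_at A (fst X)" for X c Z a b
    unfolding Wc[OF that] by (rule lower_raise[OF that])
  let ?n = "\<lambda>s X Z. tlin 1 (nab s X Z) 1 (W X Z (s X))"
  have n: "finsler_connection A ?n" by (rule connection_add[OF W])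
  interpret N': hessian_finsler A g ?n by unfold_locales (rule n)
  have cf: "conn_form A ?n c a b X Z = conn_form A nab c a b X Z + wcomp A W c a b X Z" for c a b X Z
    by (simp add: conn_form_def wcomp_def tlin_apply)
  have Vs: "tcomp A V c a b d X = tcomp A V c b a d X" "(\<Sum>a\<in>UNIV. ycoord c a X * tcomp A V c a b d X) = 0"
    and \<Lambda>s: "tcomp A \<Lambda> c a b d X = tcomp A \<Lambda> c b a d X" "(\<Sum>a\<in>UNIV. ycoord c a X * tcomp A \<Lambda> c a b d X) = 0"
    if "X \<in> slit A" "c \<in> charts_at A (fst X)" for X c a b d
    using V(2) \<Lambda>(2) that unfolding sym_transverse_def by blast+
  have sym: "\<beta> c a b X Z = \<beta> c b a X Z" if X: "X \<in> slit A" and c: "c \<in> charts_at A (fst X)" for X c a b Z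
    unfolding \<beta>_def Dg_sym[OF X c, of a b] Vs(1)[OF X c, of a b] \<Lambda>s(1)[OF X c, of a b] Cc[OF X c] Ct_sym12[OF X c, of a b] ..
  have tr: "(\<Sum>b\<in>UNIV. \<beta> c a b X Z * ycoord c b X) = 0" if X: "X \<in> slit A" and c: "c \<in> charts_at A (fst X)" and Z: "Z \<in> TE A X" for X c a Z
  proof -
    let ?y = "\<lambda>b. ycoord c b X"
    have sw: "(\<Sum>b\<in>UNIV. ?y b * (\<Sum>d\<in>UNIV. K b d * \<theta> d)) = (\<Sum>d\<in>UNIV. (\<Sum>b\<in>UNIV. ?y b * K b d) * \<theta> d)"
      for K :: "'n \<Rightarrow> 'n \<Rightarrow> real" and \<theta>
      unfolding sum_distrib_left sum_distrib_right by (subst sum.swap) (simp add: mult_ac)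
    have e: "(\<Sum>b\<in>UNIV. ?y b * Dg A g nab c b a X Z) = 0"
      using conds X c Z unfolding conds_alpha_epsilon_def cond_epsilon_def by blast
    have "(\<Sum>b\<in>UNIV. \<beta> c a b X Z * ?y b) = (\<Sum>b\<in>UNIV. ?y b * \<beta> c b a X Z)" by (simp add: sym[OF X c, of a] mult.commute)
    also have "\<dots> = 1/2 * (\<Sum>b\<in>UNIV. ?y b * Dg A g nab c b a X Z) + (\<Sum>d\<in>UNIV. (\<Sum>b\<in>UNIV. ?y b * tcomp A \<Lambda> c b a d X) * dx_form A c d Z)
       + (\<Sum>d\<in>UNIV. (\<Sum>b\<in>UNIV. ?y b * tcomp A V c b a d X) * omega_bar nab c d X Z)
       - (\<Sum>d\<in>UNIV. (\<Sum>b\<in>UNIV. ?y b * tcomp A C c b a d X) * omega_bar nab c d X Z)"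
      unfolding \<beta>_def distrib_left right_diff_distrib sum.distrib sum_subtractf sw sum_distrib_left[of "1/2"]
      by (simp add: mult.left_commute)
    finally show ?thesis unfolding e Vs(2)[OF X c] \<Lambda>s(2)[OF X c] Cc[OF X c] Ct_transverse(1)[OF X c] by simp
  qed
  note inv = invariance[OF n, of "wcomp A W", OF cf]
  have conds': "conds_alpha_epsilon A g ?n"
    using conds inv(2-6) unfolding conds_alpha_epsilon_def by (simp add: Wl sym tr)
  have can': "N'.canonical" by (rule N'.conds_imp_canonical[OF conds'])
  have ol: "N'.olow c a b X Z = olow c a b X Z + \<beta> c a b X Z" if "X \<in> slit A" "c \<in> charts_at A (fst X)" for X c a b Z
    unfolding N'.olow_def olow_def cf distrib_left sum.distrib Wl[OF that] ..
  show thesis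
  proof (rule that[OF n conds'])
    fix X c a b d assume X: "X \<in> slit A" and c: "c \<in> charts_at A (fst X)"
    have bar: "omega_bar nab c e X (hfield c d X) = 0" "omega_bar nab c e X (vfield c d X) = axis d 1 $ e" for e
      unfolding canonical_omega_bar[OF can X c hfield_in] canonical_omega_bar[OF can X c vfield_in]
      by (simp_all add: forms_hfield[OF X c])
    show "lower3 A g (Hcoeff A ?n) c a b d X = Gam_barthel c a b d X + tcomp A \<Lambda> c a b d X"
      unfolding N'.canonical_coeffs[OF can' X c] ol[OF X c] \<beta>_def bar Dg_hfield[OF can X c]
      by (simp add: forms_hfield[OF X c] field_simps)
    show "lower3 A g (Vcoeff A ?n) c a b d X = tcomp A V c a b d X"
      unfolding N'.canonical_coeffs[OF can' X c] ol[OF X c] \<beta>_def bar Dg_vfield[OF can X c] Cc[OF X c]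
      by (simp add: forms_hfield[OF X c] field_simps)
  qed
qed

lemma zero_tensor: "pullback_tensor3 A (\<lambda>X u v w. 0)" "sym_transverse A (tcomp A (\<lambda>X u v w. 0))"
  by (auto simp: pullback_tensor3_def linear_form_on_def sym_transverse_def tcomp_def[abs_def] intro: E.smooth_near_const)

lemma canonical_lambda:
  assumes can: "canonical"
  shows "\<exists>\<Lambda>. pullback_tensor3 A \<Lambda> \<and> sym_transverse A (tcomp A \<Lambda>) \<and>
    (\<forall>X\<in>slit A. \<forall>c\<in>charts_at A (fst X). \<forall>a b d.
      lower3 A g (Hcoeff A nab) c a b d X = lower3 A g (Gamma_coeff A L) c a b d X + tcomp A \<Lambda> c a b d X)"
proof -
  obtain K where K: "pullback_tensor3 A K" and k: "\<And>X c a b d. X \<in> slit A \<Longrightarrow> c \<in> charts_at A (fst X) \<Longrightarrow>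
      tcomp A K c a b d X = olow c a b X (hfield c d X) - Gam_barthel c a b d X"
    using horizontal_difference_tensor[OF can] by blast
  have "sym_transverse A (tcomp A K)"
    unfolding sym_transverse_def using k canonicalD(3,4)[OF can] by simp
  moreover have "lower3 A g (Hcoeff A nab) c a b d X = lower3 A g (Gamma_coeff A L) c a b d X + tcomp A K c a b d X"
    if "X \<in> slit A" "c \<in> charts_at A (fst X)" for X c a b d
    using k[OF that] canonical_coeffs(3)[OF can that] Gamma_low[OF that] by simp
  ultimately show ?thesis using K by blast
qed

lemma canonical_vertical:
  assumes can: "canonical"
  shows "sym_transverse A (lower3 A g (Vcoeff A nab))"
  unfolding sym_transverse_def using canonicalD(1,2)[OF can] canonical_coeffs(4)[OF can] by simp

section \<open>The notable connections\<close>

lemma notable_in_class: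
  assumes can: "canonical" and notable: "notable_connection A L H V nab'"
    and H: "\<And>X c a b d. X \<in> slit A \<Longrightarrow> c \<in> charts_at A (fst X) \<Longrightarrow> lower3 A g H c a b d X = Gam_barthel c a b d X + S c a b d X"
    and S: "sym_transverse A S" and V: "sym_transverse A (lower3 A g V)"
  shows "nab' \<in> conn_class A g nab"
proof -
  have n: "finsler_connection A nab'" "regular A nab'" and co: "\<And>X c a b d. X \<in> slit A \<Longrightarrow> c \<in> charts_at A (fst X) \<Longrightarrow>
      Hcoeff A nab' c a b d X = H c a b d X \<and> Vcoeff A nab' c a b d X = V c a b d X"
    using notable unfolding notable_connection_def by blast+
  interpret N': hessian_finsler A g nab' by unfold_locales (rule n)
  have lo: "lower3 A g (Hcoeff A nab') c a b d X = lower3 A g H c a b d X"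
    "lower3 A g (Vcoeff A nab') c a b d X = lower3 A g V c a b d X"
    if "X \<in> slit A" "c \<in> charts_at A (fst X)" for X c a b d
    unfolding lower3_def using co[OF that] by simp_all
  have "sym_transverse A (lower3 A g (Vcoeff A nab'))"
    by (rule sym_transverse_cong[THEN iffD2, OF _ V]) (rule lo)
  then have "N'.canonical" by (intro N'.canonical_of_coeffs[OF n(2) _ S]) (simp_all add: lo H)
  then show ?thesis by (rule canonical_difference[OF can n(1)])
qed

lemma notable_exists:
  assumes conds: "conds_alpha_epsilon A g nab"
    and \<Lambda>: "pullback_tensor3 A \<Lambda>" "sym_transverse A (tcomp A \<Lambda>)"
    and V: "pullback_tensor3 A K" "sym_transverse A (tcomp A K)"
    and Hl: "\<And>X c a b d. X \<in> slit A \<Longrightarrow> c \<in> charts_at A (fst X) \<Longrightarrow> lower3 A g H c a b d X = Gam_barthel c a b d X + tcomp A \<Lambda> c a b d X"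
    and Vl: "\<And>X c a b d. X \<in> slit A \<Longrightarrow> c \<in> charts_at A (fst X) \<Longrightarrow> lower3 A g V c a b d X = tcomp A K c a b d X"
  shows "\<exists>nab'. notable_connection A L H V nab'"
proof -
  obtain nab' where n: "finsler_connection A nab'" "conds_alpha_epsilon A g nab'"
    and h: "\<And>X c a b d. X \<in> slit A \<Longrightarrow> c \<in> charts_at A (fst X) \<Longrightarrow>
      lower3 A g (Hcoeff A nab') c a b d X = Gam_barthel c a b d X + tcomp A \<Lambda> c a b d X"
    and v: "\<And>X c a b d. X \<in> slit A \<Longrightarrow> c \<in> charts_at A (fst X) \<Longrightarrow> lower3 A g (Vcoeff A nab') c a b d X = tcomp A K c a b d X"
    using prescribed_connection[OF conds \<Lambda> V] by blast
  interpret N': hessian_finsler A g nab' by unfold_locales (rule n)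
  have can': "N'.canonical" by (rule N'.conds_imp_canonical[OF n(2)])
  have "Hcoeff A nab' c a b d X = H c a b d X" "Vcoeff A nab' c a b d X = V c a b d X"
    if X: "X \<in> slit A" and c: "c \<in> charts_at A (fst X)" for X c a b d
  proof -
    show "Hcoeff A nab' c a b d X = H c a b d X"
      by (rule lower_inject[OF X c, where h = "\<lambda>a. Hcoeff A nab' c a b d X" and k = "\<lambda>a. H c a b d X"])
        (use h[OF X c] Hl[OF X c] in \<open>simp add: lower3_def\<close>)
    show "Vcoeff A nab' c a b d X = V c a b d X"
      by (rule lower_inject[OF X c, where h = "\<lambda>a. Vcoeff A nab' c a b d X" and k = "\<lambda>a. V c a b d X"])
        (use v[OF X c] Vl[OF X c] in \<open>simp add: lower3_def\<close>)
  qed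
  then have "notable_connection A L H V nab'"
    unfolding notable_connection_def
    using n N'.canonical_horizontal[OF can'] by (simp add: conds_alpha_epsilon_def)
  then show ?thesis by blast
qed

lemma notable_connections:
  assumes conds: "conds_alpha_epsilon A g nab"
    and notable: "notable \<in> {Berwald_connection A L, Chern_connection A L, Cartan_connection A L, Hashiguchi_connection A L}"
  shows "(\<exists>nab'. notable nab') \<and> (\<forall>nab'. notable nab' \<longrightarrow> nab' \<in> conn_class A g nab)"
proof -
  have can: "canonical" by (rule conds_imp_canonical[OF conds])
  obtain C where C: "pullback_tensor3 A C"
    and Cc: "\<And>X c a b e. X \<in> slit A \<Longrightarrow> c \<in> charts_at A (fst X) \<Longrightarrow> tcomp A C c a b e X = Ct c a b e X"
    using Cartan_tensor by blast
  have Cs: "sym_transverse A (tcomp A C)"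
    unfolding sym_transverse_def using Cc Ct_sym12 Ct_transverse(1) by simp
  define O' :: "('m, 'n) cotensor3" where "O' = (\<lambda>X u v w. 0)"
  have O': "pullback_tensor3 A O'" "sym_transverse A (tcomp A O')" unfolding O'_def by (rule zero_tensor)+
  \<comment> \<open>A Chern connection, needed beforehand: it makes the Landsberg tensor available
    for the Berwald and Hashiguchi connections.\<close>
  obtain ch where ch: "finsler_connection A ch" "conds_alpha_epsilon A g ch"
    and chh: "\<And>X c a b d. X \<in> slit A \<Longrightarrow> c \<in> charts_at A (fst X) \<Longrightarrow> 
      lower3 A g (Hcoeff A ch) c a b d X = Gam_barthel c a b d X + tcomp A O' c a b d X"
    and "\<And>X c a b d. X \<in> slit A \<Longrightarrow> c \<in> charts_at A (fst X) \<Longrightarrow> lower3 A g (Vcoeff A ch) c a b d X = tcomp A O' c a b d X"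
  proof (rule prescribed_connection[OF conds O' O'])
    fix nab' assume a: "finsler_connection A nab'" "conds_alpha_epsilon A g nab'"
      "\<And>X c a b d. X \<in> slit A \<Longrightarrow> c \<in> charts_at A (fst X) \<Longrightarrow>
        lower3 A g (Hcoeff A nab') c a b d X = Gam_barthel c a b d X + tcomp A O' c a b d X"
      "\<And>X c a b d. X \<in> slit A \<Longrightarrow> c \<in> charts_at A (fst X) \<Longrightarrow> lower3 A g (Vcoeff A nab') c a b d X = tcomp A O' c a b d X"
    show thesis by (rule that[OF a])
  qed
  interpret Ch: hessian_finsler A g ch by unfold_locales (rule ch)
  have chc: "Ch.canonical" by (rule Ch.conds_imp_canonical[OF ch(2)])
  obtain K where K: "pullback_tensor3 A K"
    and Kc: "\<And>X c a b d. X \<in> slit A \<Longrightarrow> c \<in> charts_at A (fst X) \<Longrightarrow> tcomp A K c a b d X = Land c a b d X"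
  proof (rule Ch.Landsberg_tensor[OF chc])
    show "Ch.olow c a b X (hfield c d X) = Gam_barthel c a b d X" if "X \<in> slit A" "c \<in> charts_at A (fst X)" for X c a b d
      using chh[OF that] Ch.canonical_coeffs(3)[OF chc that] by (simp add: tcomp_def O'_def)
  qed blast
  have Ks: "sym_transverse A (tcomp A K)"
    unfolding sym_transverse_def using Kc Land_sym Land_transverse by simp
  have claim: "(\<exists>nab'. notable_connection A L H V nab') \<and> (\<forall>nab'. notable_connection A L H V nab' \<longrightarrow> nab' \<in> conn_class A g nab)"
    if t: "pullback_tensor3 A \<Lambda>" "sym_transverse A (tcomp A \<Lambda>)" "pullback_tensor3 A U" "sym_transverse A (tcomp A U)"
      and H: "\<And>X c a b d. X \<in> slit A \<Longrightarrow> c \<in> charts_at A (fst X) \<Longrightarrow> lower3 A g H c a b d X = Gam_barthel c a b d X + tcomp A \<Lambda> c a b d X"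
      and V: "\<And>X c a b d. X \<in> slit A \<Longrightarrow> c \<in> charts_at A (fst X) \<Longrightarrow> lower3 A g V c a b d X = tcomp A U c a b d X" for \<Lambda> U H V
  proof -
    have "sym_transverse A (lower3 A g V)" by (rule sym_transverse_cong[THEN iffD2, OF _ t(4)]) (rule V)
    then show ?thesis using notable_exists[OF conds t H V] notable_in_class[OF can _ H t(2)] by blast
  qed
  have z: "tcomp A O' c a b d X = 0" "lower3 A g (\<lambda>c a b d X. 0) c a b d X = 0" for c a b d X
    by (simp_all add: tcomp_def lower3_def O'_def)
  \<comment> \<open>The pairs (\<Lambda>, V) are (Landsberg, 0) for Berwald, (0, 0) for Chern, (0,
    Cartan) for Cartan and (Landsberg, Cartan) for Hashiguchi.\<close>
  have "(\<exists>nab'. Berwald_connection A L nab') \<and> (\<forall>nab'. Berwald_connection A L nab' \<longrightarrow> nab' \<in> conn_class A g nab)"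
    unfolding Berwald_connection_def by (rule claim[OF K Ks O']) (simp_all add: z Berwald_low Kc)
  moreover have "(\<exists>nab'. Chern_connection A L nab') \<and> (\<forall>nab'. Chern_connection A L nab' \<longrightarrow> nab' \<in> conn_class A g nab)"
    unfolding Chern_connection_def by (rule claim[OF O' O']) (simp_all add: z Gamma_low)
  moreover have "(\<exists>nab'. Cartan_connection A L nab') \<and> (\<forall>nab'. Cartan_connection A L nab' \<longrightarrow> nab' \<in> conn_class A g nab)"
    unfolding Cartan_connection_def by (rule claim[OF O' C Cs]) (simp_all add: z Gamma_low Cartan_low Cc)
  moreover have "(\<exists>nab'. Hashiguchi_connection A L nab') \<and> (\<forall>nab'. Hashiguchi_connection A L nab' \<longrightarrow> nab' \<in> conn_class A g nab)"
    unfolding Hashiguchi_connection_def by (rule claim[OF K Ks C Cs]) (simp_all add: Berwald_low Kc Cartan_low Cc)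
  ultimately show ?thesis using notable by blast
qed

end

theorem theorem3p10:
  fixes A :: "('m::{t2_space, second_countable_topology}, real ^ 'n) chart set"
    and g :: "('m, 'n) cotensor2"
    and nab :: "('m, 'n) connection"
  assumes "connected_smooth_manifold A"
    and "pullback_metric A g"
    and "finsler_connection A nab"
  shows
    "(regular A nab \<and> cond_beta A g nab \<and> cond_gamma A g nab \<longrightarrow>
        finsler_lagrangian A (half_energy g) \<and> is_vertical_hessian_of A g (half_energy g))
     \<and>
     (conds_alpha_epsilon A g nab \<longrightarrow>
        (\<exists>\<Lambda>. pullback_tensor3 A \<Lambda> \<and> sym_transverse A (tcomp A \<Lambda>) \<and>
           (\<forall>X\<in>slit A. \<forall>c\<in>charts_at A (fst X). \<forall>a b d.
              lower3 A g (Hcoeff A nab) c a b d X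
                = lower3 A g (Gamma_coeff A (half_energy g)) c a b d X + tcomp A \<Lambda> c a b d X)) \<and>
        strongly_regular A nab \<and>
        sym_transverse A (lower3 A g (Vcoeff A nab)) \<and>
        (\<forall>X\<in>slit A. horizontal A nab X = barthel_horizontal A (half_energy g) X))
     \<and>
     (\<forall>nab'. finsler_connection A nab' \<and> differ_by_sym_transverse A g nab nab' \<longrightarrow>
        (regular A nab' \<longleftrightarrow> regular A nab) \<and>
        (cond_beta A g nab' \<longleftrightarrow> cond_beta A g nab) \<and>
        (cond_gamma A g nab' \<longleftrightarrow> cond_gamma A g nab) \<and>
        (cond_delta A g nab' \<longleftrightarrow> cond_delta A g nab) \<and>
        (cond_epsilon A g nab' \<longleftrightarrow> cond_epsilon A g nab))
     \<and>
     (conds_alpha_epsilon A g nab \<longrightarrow>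
        (\<forall>\<Lambda> V. pullback_tensor3 A \<Lambda> \<and> sym_transverse A (tcomp A \<Lambda>) \<and>
               pullback_tensor3 A V \<and> sym_transverse A (tcomp A V) \<longrightarrow>
           (\<exists>nab'. finsler_connection A nab' \<and> conds_alpha_epsilon A g nab' \<and>
              (\<forall>X\<in>slit A. \<forall>c\<in>charts_at A (fst X). \<forall>a b d.
                 lower3 A g (Hcoeff A nab') c a b d X
                   = lower3 A g (Gamma_coeff A (half_energy g)) c a b d X + tcomp A \<Lambda> c a b d X \<and>
                 lower3 A g (Vcoeff A nab') c a b d X = tcomp A V c a b d X))))
     \<and>
     (conds_alpha_epsilon A g nab \<longrightarrow>
        (\<forall>nab'. finsler_connection A nab' \<and> conds_alpha_epsilon A g nab' \<longrightarrow>
           nab' \<in> conn_class A g nab) \<and>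
        (\<forall>notable \<in> {Berwald_connection A (half_energy g), Chern_connection A (half_energy g),
                      Cartan_connection A (half_energy g), Hashiguchi_connection A (half_energy g)}.
           (\<exists>nab'. notable nab') \<and> (\<forall>nab'. notable nab' \<longrightarrow> nab' \<in> conn_class A g nab)))"
proof -
  interpret F: finsler A g nab by unfold_locales fact+
  let ?L = "half_energy g"
  have hess: "hessian_metric A g" if "cond_beta A g nab" "cond_gamma A g nab"
    by unfold_locales
      (use F.vertical_derivative_transverse[OF that] in \<open>simp add: F.dy_eq_pd\<close>)
  have hf: "hessian_finsler A g nab" if "conds_alpha_epsilon A g nab"
  proof -
    interpret hessian_metric A g by (rule hess) (use that in \<open>simp_all add: conds_alpha_epsilon_def\<close>)
    show ?thesis by unfold_locales
  qed
  have 1: "finsler_lagrangian A ?L \<and> is_vertical_hessian_of A g ?L"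
    if "regular A nab \<and> cond_beta A g nab \<and> cond_gamma A g nab"
  proof -
    interpret hessian_metric A g by (rule hess) (use that in blast)+
    show ?thesis using finsler_lagrangian_half_energy vertical_hessian_half_energy by blast
  qed
  have 2: "(\<exists>\<Lambda>. pullback_tensor3 A \<Lambda> \<and> sym_transverse A (tcomp A \<Lambda>) \<and>
           (\<forall>X\<in>slit A. \<forall>c\<in>charts_at A (fst X). \<forall>a b d.
              lower3 A g (Hcoeff A nab) c a b d X
                = lower3 A g (Gamma_coeff A ?L) c a b d X + tcomp A \<Lambda> c a b d X)) \<and>
        strongly_regular A nab \<and>
        sym_transverse A (lower3 A g (Vcoeff A nab)) \<and>
        (\<forall>X\<in>slit A. horizontal A nab X = barthel_horizontal A ?L X)"
    if c: "conds_alpha_epsilon A g nab"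
  proof -
    interpret hessian_finsler A g nab by (rule hf[OF c])
    have can: canonical by (rule conds_imp_canonical[OF c])
    show ?thesis
      by (intro conjI ballI canonical_lambda[OF can] canonical_strongly_regular[OF can]
          canonical_vertical[OF can] canonical_horizontal[OF can])
  qed
  have 3: "(regular A nab' \<longleftrightarrow> regular A nab) \<and>
        (cond_beta A g nab' \<longleftrightarrow> cond_beta A g nab) \<and>
        (cond_gamma A g nab' \<longleftrightarrow> cond_gamma A g nab) \<and>
        (cond_delta A g nab' \<longleftrightarrow> cond_delta A g nab) \<and>
        (cond_epsilon A g nab' \<longleftrightarrow> cond_epsilon A g nab)"
    if n: "finsler_connection A nab' \<and> differ_by_sym_transverse A g nab nab'" for nab'
  proof -
    obtain W where W: "sym_transverse_form A g W"
      and diff: "\<And>X c Z a b. X \<in> slit A \<Longrightarrow> c \<in> charts_at A (fst X) \<Longrightarrow> Z \<in> TE A X \<Longrightarrow>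
        conn_form A nab' c a b X Z = conn_form A nab c a b X Z + wcomp A W c a b X Z"
      using n unfolding differ_by_sym_transverse_def by blast
    have sym: "(\<Sum>d\<in>UNIV. gcomp A g c a d X * wcomp A W c d b X Z) = (\<Sum>d\<in>UNIV. gcomp A g c b d X * wcomp A W c d a X Z)"
      and tr: "(\<Sum>b\<in>UNIV. (\<Sum>d\<in>UNIV. gcomp A g c a d X * wcomp A W c d b X Z) * ycoord c b X) = 0"
      if "X \<in> slit A" "c \<in> charts_at A (fst X)" "Z \<in> TE A X" for X c Z a b
      using W that unfolding sym_transverse_form_def Let_def by blast+
    show ?thesis
      using F.invariance(2-6)[of nab' "wcomp A W", OF _ diff sym tr] n by blast
  qed
  have 4: "\<exists>nab'. finsler_connection A nab' \<and> conds_alpha_epsilon A g nab' \<and>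
              (\<forall>X\<in>slit A. \<forall>c\<in>charts_at A (fst X). \<forall>a b d.
                 lower3 A g (Hcoeff A nab') c a b d X
                   = lower3 A g (Gamma_coeff A ?L) c a b d X + tcomp A \<Lambda> c a b d X \<and>
                 lower3 A g (Vcoeff A nab') c a b d X = tcomp A V c a b d X)"
    if c: "conds_alpha_epsilon A g nab"
      and t: "pullback_tensor3 A \<Lambda> \<and> sym_transverse A (tcomp A \<Lambda>) \<and> pullback_tensor3 A V \<and> sym_transverse A (tcomp A V)"
    for \<Lambda> V
  proof -
    interpret hessian_finsler A g nab by (rule hf[OF c])
    from t have t': "pullback_tensor3 A \<Lambda>" "sym_transverse A (tcomp A \<Lambda>)" "pullback_tensor3 A V" "sym_transverse A (tcomp A V)"
      by auto
    obtain nab' where n: "finsler_connection A nab'" "conds_alpha_epsilon A g nab'"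
      and h: "\<And>X c a b d. X \<in> slit A \<Longrightarrow> c \<in> charts_at A (fst X) \<Longrightarrow>
        lower3 A g (Hcoeff A nab') c a b d X = Gam_barthel c a b d X + tcomp A \<Lambda> c a b d X"
      and v: "\<And>X c a b d. X \<in> slit A \<Longrightarrow> c \<in> charts_at A (fst X) \<Longrightarrow> lower3 A g (Vcoeff A nab') c a b d X = tcomp A V c a b d X"
      using prescribed_connection[OF c t'] by blast
    show ?thesis
      by (rule exI[of _ nab'], intro conjI ballI allI n) (simp_all add: h v Gamma_low)
  qed
  have 5: "nab' \<in> conn_class A g nab"
    if c: "conds_alpha_epsilon A g nab" and n: "finsler_connection A nab' \<and> conds_alpha_epsilon A g nab'" for nab'
  proof -
    interpret hessian_finsler A g nab by (rule hf[OF c])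
    interpret N': hessian_finsler A g nab' by unfold_locales (use n in blast)
    show ?thesis
      by (rule canonical_difference[OF conds_imp_canonical[OF c] _ N'.conds_imp_canonical]) (use n in blast)+
  qed
  have 6: "(\<exists>nab'. notable nab') \<and> (\<forall>nab'. notable nab' \<longrightarrow> nab' \<in> conn_class A g nab)"
    if c: "conds_alpha_epsilon A g nab"
      and "notable \<in> {Berwald_connection A ?L, Chern_connection A ?L, Cartan_connection A ?L, Hashiguchi_connection A ?L}"
    for notable
  proof -
    interpret hessian_finsler A g nab by (rule hf[OF c])
    show ?thesis by (rule notable_connections[OF that])
  qed
  show ?thesis
    by (rule conjI, rule impI, erule 1, rule conjI, rule impI, erule 2, rule conjI, intro allI impI, erule 3,
        rule conjI, intro allI impI, erule (1) 4, rule impI, rule conjI, intro allI impI, erule (1) 5,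
        rule ballI, erule (1) 6)
qed

end
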